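(* Let $N\ge1$ be an integer, $\tau>0$, $\mu>0$, and let $\varphi$ be $\mu$-strongly-convex-strongly-concave and $M$-Lipschitz with respect to $\|\cdot\|_2$ on the neighbourhood $U$ of $\mathcal Z$ described in the context. Let $z_0\in\mathcal Z$ and let $z_{k+1}=\Pi_{\mathcal Z}\big(z_k-\gamma_k\, g(z_k,\mathbf e_k,\tau,\xi_k^{\pm})\big)$ with $\gamma_k=\frac1{\mu(k+1)}$, $k=0,\dots,N$, and let $\bar z_N=(\bar x_N,\bar y_N)=\frac1{N+1}\sum_{k=0}^N z_k$. Let $(x^*,y^* )$ be the saddle point of $\varphi$ on $\mathcal X\times\mathcal Y$. Then $$\mathbb E\left[\varphi(\bar x_N,y^* )-\varphi(x^*,\bar y_N)\right]\le\frac{M_{all}^2\log(N+1)}{2\mu(N+1)}+\frac{\Delta n\Omega}{\tau}+2\tau M,$$ where $M_{all}^2=3\left(3nM^2+\frac{n^2(\sigma^2+\Delta^2)}{\tau^2}\right)$.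
   Context: Problem: $\min_{x\in\mathcal X}\max_{y\in\mathcal Y}\varphi(x,y)$, where $\mathcal X\subset\mathbb R^{n_x}$, $\mathcal Y\subset\mathbb R^{n_y}$ are nonempty compact convex sets, $\mathcal Z=\mathcal X\times\mathcal Y$, $n=n_x+n_y$, $z=(x,y)$, $\varphi(z)=\varphi(x,y)$. $\Omega$ is the Euclidean diameter of $\mathcal Z$, and $\Pi_{\mathcal Z}$ is the Euclidean projection onto $\mathcal Z$ (this is the prox-operator step of Mirror Descent with the Bregman divergence $V_z(w)=\frac12\|z-w\|_2^2$). The function $\varphi$ is defined on $U=U_X\times U_Y$, with $U_X\subset\mathbb R^{n_x}$, $U_Y\subset\mathbb R^{n_y}$ open convex, such that $U$ contains all points $z+\tau e$ with $z\in\mathcal Z$, $\|e\|_2\le1$. A function $f$ is $\mu$-strongly convex on a set if it is continuously differentiable and $f(y)\ge f(x)+\langle\nabla f(x),y-x\rangle+\frac\mu2\|y-x\|_2^2$ for all $x,y$ in the set; $f$ is $\mu$-strongly concave if $-f$ is $\mu$-strongly convex. $\varphi$ is $\mu$-strongly-convex-strongly-concave if $\varphi(\cdot,y)$ is $\mu$-strongly convex for all $y$ and $\varphi(x,\cdot)$ is $\mu$-strongly concave for all $x$. $M$-Lipschitz ($M>0$): $|\varphi(z)-\varphi(z')|\le M\|z-z'\|_2$ for all $z,z'\in U$. A saddle point satisfies $\varphi(x^*,y)\le\varphi(x^*,y^* )\le\varphi(x,y^* )$ for all $x\in\mathcal X,y\in\mathcal Y$. Oracle: only noisy values $\tilde\varphi(z,\xi)=\varphi(z)+\xi+\delta(z)$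 are available, where $\delta$ is a deterministic measurable function on $U$ with $|\delta|\le\Delta$, and $\xi$ is a real random variable with $\mathbb E\xi=0$, $\mathbb E[\xi^2]\le\sigma^2$ ($\Delta,\sigma>0$), generated independently of the query point. Gradient estimator: for $\mathbf e=(\mathbf e_x,\mathbf e_y)$ uniformly distributed on the Euclidean unit sphere of $\mathbb R^n$, $$g(z,\mathbf e,\tau,\xi^{\pm})=\frac{n\left(\tilde\varphi(z+\tau\mathbf e,\xi^+)-\tilde\varphi(z-\tau\mathbf e,\xi^-)\right)}{2\tau}\begin{pmatrix}\mathbf e_x\\-\mathbf e_y\end{pmatrix}.$$ At each iteration $k$, $\mathbf e_k$ and the noises $\xi_k^+,\xi_k^-$ are generated independently of each other and of the previous iterations. *)

theory Defs
  imports "HOL-Probability.Probability"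
begin

text \<open>Intended for open \<open>S\<close>: \<open>GDERIV\<close> is the full (not the relative) gradient of \<open>f\<close>.\<close>

definition strongly_convex_on :: "'a::euclidean_space set \<Rightarrow> real \<Rightarrow> ('a \<Rightarrow> real) \<Rightarrow> bool" where
  "strongly_convex_on S \<mu> f \<longleftrightarrow>
     (\<exists>grad. (\<forall>x\<in>S. GDERIV f x :> grad x) \<and> continuous_on S grad \<and>
        (\<forall>x\<in>S. \<forall>y\<in>S. f y \<ge> f x + grad x \<bullet> (y - x) + \<mu> / 2 * (norm (y - x))\<^sup>2))"

definition strongly_concave_on :: "'a::euclidean_space set \<Rightarrow> real \<Rightarrow> ('a \<Rightarrow> real) \<Rightarrow> bool" where
  "strongly_concave_on S \<mu> f \<longleftrightarrow> strongly_convex_on S \<mu> (\<lambda>x. - f x)"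

definition strongly_convex_concave_on ::
  "'a::euclidean_space set \<Rightarrow> 'b::euclidean_space set \<Rightarrow> real \<Rightarrow> ('a \<times> 'b \<Rightarrow> real) \<Rightarrow> bool" where
  "strongly_convex_concave_on A B \<mu> \<phi> \<longleftrightarrow>
     (\<forall>y\<in>B. strongly_convex_on A \<mu> (\<lambda>x. \<phi> (x, y))) \<and>
     (\<forall>x\<in>A. strongly_concave_on B \<mu> (\<lambda>y. \<phi> (x, y)))"

definition saddle_point ::
  "('a \<times> 'b \<Rightarrow> real) \<Rightarrow> 'a set \<Rightarrow> 'b set \<Rightarrow> 'a \<Rightarrow> 'b \<Rightarrow> bool" where
  "saddle_point \<phi> X Y xs ys \<longleftrightarrow>
     xs \<in> X \<and> ys \<in> Y \<and>
     (\<forall>x\<in>X. \<forall>y\<in>Y. \<phi> (xs, y) \<le> \<phi> (xs, ys) \<and> \<phi> (xs, ys) \<le> \<phi> (x, ys))"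

text \<open>
  The normalised surface measure of the Euclidean unit sphere, as a Borel measure on the whole
  space: a Borel set \<open>A\<close> gets the share of the volume of the unit ball lying in the cone
  \<open>{x. sgn x \<in> A}\<close>, where \<open>sgn x = x /\<^sub>R norm x\<close>.
\<close>

definition uniform_sphere :: "'a::euclidean_space measure" where
  "uniform_sphere = distr (uniform_measure lborel (ball 0 1)) borel sgn"

lemma borel_measurable_sgn_euclidean [measurable]:
  "(sgn :: 'a::euclidean_space \<Rightarrow> 'a) \<in> borel_measurable borel"
  unfolding sgn_div_norm by measurable

lemma prob_space_uniform_sphere: "prob_space (uniform_sphere :: 'a::euclidean_space measure)"
proof -
  have "emeasure lborel (ball (0::'a) 1) \<noteq> 0"
    using content_ball_pos[of 1 "0::'a"] by (auto simp: measure_def)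
  then interpret prob_space "uniform_measure lborel (ball (0::'a) 1)"
    using emeasure_lborel_ball_finite[of "0::'a" 1]
    by (intro prob_space_uniform_measure) auto
  show ?thesis
    unfolding uniform_sphere_def by (rule prob_space_distr) measurable
qed

definition noisy_value :: "('z \<Rightarrow> real) \<Rightarrow> ('z \<Rightarrow> real) \<Rightarrow> 'z \<Rightarrow> real \<Rightarrow> real" where
  "noisy_value \<phi> \<delta> z \<xi> = \<phi> z + \<xi> + \<delta> z"

definition grad_estimator ::
  "((real^'nx) \<times> (real^'ny) \<Rightarrow> real \<Rightarrow> real) \<Rightarrow> (real^'nx) \<times> (real^'ny) \<Rightarrow> (real^'nx) \<times> (real^'ny)
     \<Rightarrow> real \<Rightarrow> real \<Rightarrow> real \<Rightarrow> (real^'nx) \<times> (real^'ny)" where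
  "grad_estimator oracle z e \<tau> \<xi>p \<xi>m =
     (real (CARD('nx) + CARD('ny)) * (oracle (z + \<tau> *\<^sub>R e) \<xi>p - oracle (z - \<tau> *\<^sub>R e) \<xi>m) / (2 * \<tau>))
       *\<^sub>R (fst e, - snd e)"

definition centered_noise :: "'w measure \<Rightarrow> real \<Rightarrow> ('w \<Rightarrow> real) \<Rightarrow> bool" where
  "centered_noise P \<sigma> \<xi> \<longleftrightarrow>
     \<xi> \<in> borel_measurable P \<and> integrable P \<xi> \<and> integrable P (\<lambda>\<omega>. (\<xi> \<omega>)\<^sup>2) \<and>
     prob_space.expectation P \<xi> = 0 \<and> prob_space.expectation P (\<lambda>\<omega>. (\<xi> \<omega>)\<^sup>2) \<le> \<sigma>\<^sup>2"

datatype draw = Direction nat | Noise_plus nat | Noise_minus nat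

definition generated_events :: "'w measure \<Rightarrow> ('w \<Rightarrow> 'a::topological_space) \<Rightarrow> 'w set set" where
  "generated_events P f = {f -` A \<inter> space P | A. A \<in> sets borel}"

text \<open>
  \<open>indep_vars\<close> requires a common value type, so the mutual independence of the vector-valued
  directions and the real-valued noises of all iterations \<open>k \<le> N\<close> is stated through
  the \<open>\<sigma>\<close>-algebras they generate. Directions lie on the sphere everywhere, not just
  almost surely, since the objective is only constrained on a neighbourhood of the feasible set.
\<close>

definition independent_sampling ::
  "'w measure \<Rightarrow> nat \<Rightarrow> real \<Rightarrow> (nat \<Rightarrow> 'w \<Rightarrow> 'a::euclidean_space)
     \<Rightarrow> (nat \<Rightarrow> 'w \<Rightarrow> real) \<Rightarrow> (nat \<Rightarrow> 'w \<Rightarrow> real) \<Rightarrow> bool" where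
  "independent_sampling P N \<sigma> e \<xi>p \<xi>m \<longleftrightarrow>
     (\<forall>k\<le>N. e k \<in> borel_measurable P \<and> distr P borel (e k) = uniform_sphere \<and>
             (\<forall>\<omega>\<in>space P. e k \<omega> \<in> sphere 0 1)) \<and>
     (\<forall>k\<le>N. centered_noise P \<sigma> (\<xi>p k) \<and> centered_noise P \<sigma> (\<xi>m k)) \<and>
     prob_space.indep_sets P
       (\<lambda>d. case d of
              Direction k \<Rightarrow> generated_events P (e k)
            | Noise_plus k \<Rightarrow> generated_events P (\<xi>p k)
            | Noise_minus k \<Rightarrow> generated_events P (\<xi>m k))
       (Direction ` {..N} \<union> Noise_plus ` {..N} \<union> Noise_minus ` {..N})"

end

theory Submission
  imports Defs
begin

text \<open>
  The estimator is unbiased, up to the noise \<open>\<delta>\<close>, for the gradient of the average of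
  \<open>\<phi>\<close> over a ball of radius \<open>\<tau>\<close> (divergence theorem), and this average is again strongly
  convex-concave; its second moment is of order \<open>n M\<^sup>2\<close> rather than \<open>n\<^sup>2 M\<^sup>2\<close> because the
  odd function \<open>\<phi>(z + \<tau> e) - \<phi>(z - \<tau> e)\<close> of the direction satisfies a Poincare inequality
  on the sphere. The standard analysis of mirror descent with steps \<open>1 / (\<mu> (k + 1))\<close> then
  produces the harmonic sum \<open>H\<close> of order \<open>N + 1\<close>, which exceeds \<open>ln (N + 1)\<close>. For
  \<open>N + 1 \<ge> 8\<close> we have \<open>H \<le> 3/2 ln (N + 1)\<close>, and the second moment is in fact at most
  2/3 of the constant in the claim; for smaller \<open>N\<close> already the deterministic bound
  \<open>M\<^sup>2 / (2 \<mu>)\<close> on the gap suffices.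
\<close>

subsection \<open>The uniform distribution on the sphere\<close>

text \<open>The sphere carries only the cone measure \<open>uniform_sphere\<close>, so surface
  integrals are reached as limits of integrals over thin shells, and statements about directions
  come from Lebesgue measure on a ball of pairs of vectors. The Poincare constant arises from
  rotating such a pair through a quarter turn: it is \<open>(pi / 2)\<^sup>2\<close>, bounded here
  by 3. Splitting off \<delta> costs a factor 2, and with \<open>\<kappa> = n / (2 * \<tau>)\<close>
  the second moment becomes \<open>6 * n * M\<^sup>2\<close> plus noise terms. The
  \<open>M\<close>-part is exactly 2/3 of the corresponding part of \<open>Mall2\<close>, so the
  bound 3 leaves nothing to spare there, and the harmonic sum may lose the factor 3/2. Another
  obstacle: strong convexity-concavity provides one gradient per frozen variable, whereas smoothing
  needs a single jointly continuous gradient; it is recovered from convexity and the Lipschitz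
  bound. Finally, \<phi> and \<delta> are controlled only on the neighbourhood, so both are cut off
  to zero outside it before integrals over the whole space are formed.\<close>

lemma nn_integral_lborel_scaleR:
  fixes f :: "'a::euclidean_space \<Rightarrow> ennreal"
  assumes [measurable]: "f \<in> borel_measurable borel" and "c \<noteq> 0"
  shows "(\<integral>\<^sup>+x. f x \<partial>lborel) = ennreal (\<bar>c\<bar> ^ DIM('a)) * (\<integral>\<^sup>+x. f (c *\<^sub>R x) \<partial>lborel)"
  by (subst lborel_affine[OF assms(2), of 0])
     (simp add: nn_integral_density nn_integral_distr nn_integral_cmult)

lemma emeasure_lborel_unit_ball:
  "emeasure lborel (ball (0::'a::euclidean_space) 1) \<noteq> 0"
  "emeasure lborel (ball (0::'a::euclidean_space) 1) \<noteq> \<infinity>"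
  using content_ball_pos[of 1 "0::'a"] emeasure_lborel_ball_finite[of "0::'a" 1]
  by (auto simp: measure_def)

lemma sets_uniform_sphere [simp, measurable_cong]: "sets uniform_sphere = sets borel"
  and space_uniform_sphere [simp]: "space uniform_sphere = UNIV"
  by (auto simp: uniform_sphere_def)

lemma nn_integral_uniform_sphere:
  fixes g :: "'a::euclidean_space \<Rightarrow> ennreal"
  assumes [measurable]: "g \<in> borel_measurable borel"
  shows "(\<integral>\<^sup>+x. g (sgn x) * indicator (ball 0 1) x \<partial>lborel) =
    emeasure lborel (ball (0::'a) 1) * (\<integral>\<^sup>+x. g x \<partial>uniform_sphere)"
proof -
  have "(\<integral>\<^sup>+x. g x \<partial>uniform_sphere) =
      (\<integral>\<^sup>+x. g (sgn x) * indicator (ball 0 1) x \<partial>lborel) / emeasure lborel (ball (0::'a) 1)"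
    by (simp add: uniform_sphere_def nn_integral_distr nn_integral_uniform_measure)
  then show ?thesis
    using emeasure_lborel_unit_ball[where 'a='a]
    by (simp add: ennreal_times_divide ennreal_mult_divide_eq mult.commute[of "emeasure lborel (ball (0::'a) 1)"])
qed

lemma nn_integral_sgn_ball:
  fixes g :: "'a::euclidean_space \<Rightarrow> ennreal"
  assumes [measurable]: "g \<in> borel_measurable borel" and "r > 0"
  shows "(\<integral>\<^sup>+x. g (sgn x) * indicator (ball 0 r) x \<partial>lborel) =
    ennreal (r ^ DIM('a)) * (\<integral>\<^sup>+x. g (sgn x) * indicator (ball 0 1) x \<partial>lborel)"
proof -
  have "indicator (ball 0 r) (r *\<^sub>R x) = (indicator (ball 0 1) x :: ennreal)" for x :: 'a
    using \<open>r > 0\<close> by (auto simp: indicator_def mult_less_cancel_left2)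
  then show ?thesis
    using \<open>r > 0\<close>
    by (subst nn_integral_lborel_scaleR[where c = r]) (measurable, auto simp: sgn_scaleR)
qed

text \<open>Under Lebesgue measure, norm and direction separate. The push-forwards along
  \<open>norm\<close> of the density \<open>g (sgn x)\<close> and of the constant mean
  \<open>c\<close> agree on all half-lines, because the integral of a function of
  \<open>sgn x\<close> over a ball of radius \<open>r\<close> merely scales with
  \<open>r ^ DIM('a)\<close>. Half-lines generate the Borel sets, and \<open>fin\<close> keeps the
  measures finite on them.\<close>

lemma nn_integral_radial:
  fixes g :: "'a::euclidean_space \<Rightarrow> ennreal" and \<rho> :: "real \<Rightarrow> ennreal"
  assumes g [measurable]: "g \<in> borel_measurable borel" and [measurable]: "\<rho> \<in> borel_measurable borel"
    and fin: "(\<integral>\<^sup>+x. g x \<partial>uniform_sphere) \<noteq> \<infinity>"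
  shows "(\<integral>\<^sup>+x. \<rho> (norm x) * g (sgn x) \<partial>lborel) =
    (\<integral>\<^sup>+x. \<rho> (norm (x::'a)) \<partial>lborel) * (\<integral>\<^sup>+x. g x \<partial>uniform_sphere)"
proof -
  define c where "c = (\<integral>\<^sup>+x. g x \<partial>uniform_sphere)"
  have radial: "emeasure (distr (density lborel (\<lambda>x::'a. h (sgn x))) borel norm) {..<r} =
      (if r > 0 then ennreal (r ^ DIM('a)) * (emeasure lborel (ball (0::'a) 1) * (\<integral>\<^sup>+x. h x \<partial>uniform_sphere)) else 0)"
    if [measurable]: "h \<in> borel_measurable borel" for r and h :: "'a \<Rightarrow> ennreal"
  proof -
    have "norm -` {..<r} = ball (0::'a) r" by auto
    then have "emeasure (distr (density lborel (\<lambda>x::'a. h (sgn x))) borel norm) {..<r} =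
        (\<integral>\<^sup>+x. h (sgn x) * indicator (ball 0 r) x \<partial>lborel)"
      by (simp add: emeasure_distr emeasure_density)
    also have "\<dots> = (if r > 0 then ennreal (r ^ DIM('a)) *
        (emeasure lborel (ball (0::'a) 1) * (\<integral>\<^sup>+x. h x \<partial>uniform_sphere)) else 0)"
      by (cases "r > 0") (simp_all add: nn_integral_sgn_ball[where r = r] nn_integral_uniform_sphere not_less ball_empty)
    finally show ?thesis .
  qed
  have "distr (density lborel (\<lambda>x::'a. g (sgn x))) borel norm = distr (density lborel (\<lambda>x::'a. c)) borel norm"
  proof (rule measure_eqI_generator_eq[where E = "range lessThan" and A = "\<lambda>i. {..<real i}" and \<Omega> = UNIV])
    interpret prob_space "uniform_sphere :: 'a measure" by (rule prob_space_uniform_sphere)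
    show "emeasure (distr (density lborel (\<lambda>x::'a. g (sgn x))) borel norm) S =
        emeasure (distr (density lborel (\<lambda>x::'a. c)) borel norm) S" if "S \<in> range lessThan" for S
      using that radial[OF g] radial[of "\<lambda>_. c"] emeasure_space_1 by (auto simp: c_def)
    show "emeasure (distr (density lborel (\<lambda>x::'a. g (sgn x))) borel norm) {..<real i} \<noteq> \<infinity>" for i
      unfolding radial[OF g] using emeasure_lborel_unit_ball(2)[where 'a='a] fin
      by (auto simp: ennreal_mult_eq_top_iff)
    have "{..<a} \<inter> {..<b} = {..<min a b}" for a b :: real by auto
    then show "Int_stable (range lessThan :: real set set)"
      by (auto simp: Int_stable_def)
    show "(\<Union>i. {..<real i}) = UNIV"
      using reals_Archimedean2 by auto
    have "sets (borel :: real measure) = sigma_sets UNIV (range lessThan)"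
      by (subst borel_eq_lessThan) (simp add: eucl_lessThan)
    then show "sets (distr (density lborel (\<lambda>x::'a. g (sgn x))) borel norm) = sigma_sets UNIV (range lessThan)"
      "sets (distr (density lborel (\<lambda>x::'a. c)) borel norm) = sigma_sets UNIV (range lessThan)"
      by simp_all
  qed auto
  then have "(\<integral>\<^sup>+x. \<rho> x \<partial>distr (density lborel (\<lambda>x::'a. g (sgn x))) borel norm) =
      (\<integral>\<^sup>+x. \<rho> x \<partial>distr (density lborel (\<lambda>x::'a. c)) borel norm)"
    by simp
  then show ?thesis
    by (simp add: nn_integral_distr nn_integral_density nn_integral_cmult c_def mult.commute)
qed

section \<open>Real-valued integrals over the ball and the sphere\<close>

lemma integral_uniform_measure_real:
  fixes f :: "'a \<Rightarrow> real"
  assumes [measurable]: "A \<in> sets M" "f \<in> borel_measurable M"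
    and "emeasure M A \<noteq> 0" "emeasure M A \<noteq> \<infinity>"
  shows "(\<integral>x. f x \<partial>uniform_measure M A) = (\<integral>x. indicator A x * f x \<partial>M) / measure M A"
proof -
  have eq: "indicator A x / emeasure M A = ennreal (indicator A x / measure M A)" for x
    using assms(3,4) by (auto simp: indicator_def measure_def divide_ennreal[symmetric] zero_less_measure_iff
      enn2real_positive_iff top.not_eq_extremum zero_less_iff_neq_zero)
  show ?thesis
    unfolding uniform_measure_def eq by (subst integral_density) (auto simp: mult.commute)
qed

lemma measure_lborel_unit_ball_pos: "measure lborel (ball (0::'a::euclidean_space) 1) > 0"
  using content_ball_pos[of 1 "0::'a"] by simp

lemma integral_uniform_sphere:
  fixes g :: "'a::euclidean_space \<Rightarrow> real"
  assumes [measurable]: "g \<in> borel_measurable borel"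
  shows "(\<integral>x. indicator (ball 0 1) x * g (sgn x) \<partial>lborel) =
    measure lborel (ball (0::'a) 1) * (\<integral>x. g x \<partial>uniform_sphere)"
  unfolding uniform_sphere_def using measure_lborel_unit_ball_pos[where 'a='a]
  by (simp add: integral_distr integral_uniform_measure_real emeasure_lborel_unit_ball[simplified])

lemma integral_lborel_scaleR:
  fixes f :: "'a::euclidean_space \<Rightarrow> real"
  assumes [measurable]: "f \<in> borel_measurable borel" and "c \<noteq> 0"
  shows "(\<integral>x. f x \<partial>lborel) = \<bar>c\<bar> ^ DIM('a) * (\<integral>x. f (c *\<^sub>R x) \<partial>lborel)"
  by (subst lborel_affine[OF assms(2), of 0])
     (simp add: integral_density integral_distr)

lemma integral_sgn_ball:
  fixes g :: "'a::euclidean_space \<Rightarrow> real"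
  assumes [measurable]: "g \<in> borel_measurable borel" and "r > 0"
  shows "(\<integral>x. indicator (ball 0 r) x * g (sgn x) \<partial>lborel) =
    r ^ DIM('a) * (\<integral>x. indicator (ball 0 1) x * g (sgn x) \<partial>lborel)"
proof -
  have "indicator (ball 0 r) (r *\<^sub>R x) = (indicator (ball 0 1) x :: real)" for x :: 'a
    using \<open>r > 0\<close> by (auto simp: indicator_def mult_less_cancel_left2)
  then show ?thesis
    using \<open>r > 0\<close>
    by (subst integral_lborel_scaleR[where c = r]) (measurable, auto simp: sgn_scaleR)
qed

lemma AE_lborel_not_sphere: "AE x in lborel. norm (x::'a::euclidean_space) \<noteq> r"
proof (rule AE_I')
  show "sphere 0 r \<in> null_sets (lborel :: 'a measure)"
    using negligible_sphere[of "0::'a" r] by (auto simp: null_sets_completion_iff negligible_iff_null_sets)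
qed auto

text \<open>Each difference quotient integrates to 0 because Lebesgue measure is translation
  invariant, and the Lipschitz bound with the bounded support allows dominated convergence. Asking
  for the derivative only almost everywhere admits functions with kinks on spheres.\<close>

lemma integral_directional_derivative_eq_0:
  fixes F :: "'a::euclidean_space \<Rightarrow> real"
  assumes lip: "C-lipschitz_on UNIV F" and supp: "\<And>x. norm x \<ge> 1 \<Longrightarrow> F x = 0"
    and [measurable]: "D \<in> borel_measurable borel"
    and der: "AE x in lborel. ((\<lambda>t. F (x + t *\<^sub>R w)) has_real_derivative D x) (at 0)"
  shows "(\<integral>x. D x \<partial>lborel) = 0"
proof -
  define s where "s m x = (F (x + (1 / real (Suc m)) *\<^sub>R w) - F x) / (1 / real (Suc m))" for m x
  have F_cont: "continuous_on UNIV F"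
    using lip lipschitz_on_continuous_on by blast
  then have [measurable]: "F \<in> borel_measurable borel"
    by (rule borel_measurable_continuous_onI)
  have Fd: "\<bar>F x - F y\<bar> \<le> C * norm (x - y)" for x y
    using lipschitz_onD[OF lip, of x y] by (simp add: dist_norm dist_real_def)
  have "C \<ge> 0" using lip by (rule lipschitz_on_nonneg)
  have ind: "integrable lborel (\<lambda>x::'a. c * indicator (cball 0 r) x)" for c r :: real
    using emeasure_lborel_cball_finite[of "0::'a" r] by (intro integrable_mult_right integrable_real_indicator) auto
  \<comment> \<open>\<open>F\<close> vanishes at the unit vector \<open>b\<close>, which is within
    distance 2 of every point of the unit ball; hence \<open>F\<close> is bounded by
    \<open>2 * C\<close>.\<close>
  obtain b :: 'a where b: "norm b = 1"
    using vector_choose_size[of 1] by auto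
  have F_int: "integrable lborel F"
  proof (rule Bochner_Integration.integrable_bound[OF ind[of "2 * C" 1]])
    have "norm (F x) \<le> norm (2 * C * indicator (cball 0 1) x)" for x
    proof (cases "norm x \<le> 1")
      case True
      have "\<bar>F x\<bar> \<le> C * norm (x - b)" using Fd[of x b] supp[of b] b by simp
      also have "\<dots> \<le> C * 2"
        using True b norm_triangle_ineq4[of x b] \<open>C \<ge> 0\<close> by (intro mult_left_mono) auto
      finally show ?thesis using True \<open>C \<ge> 0\<close> by (simp add: indicator_def mult.commute)
    qed (simp add: supp)
    then show "AE x in lborel. norm (F x) \<le> norm (2 * C * indicator (cball 0 1) x)" by simp
  qed simp
  have "(\<lambda>m. \<integral>x. s m x \<partial>lborel) \<longlonglongrightarrow> (\<integral>x. D x \<partial>lborel)"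
  \<comment> \<open>The increments are at most \<open>norm w\<close> long, so every quotient
    vanishes outside the ball of radius \<open>1 + norm w\<close>.\<close>
  proof (rule integral_dominated_convergence[where w = "\<lambda>x. C * norm w * indicator (cball 0 (1 + norm w)) x"])
    show "AE x in lborel. (\<lambda>m. s m x) \<longlonglongrightarrow> D x"
      using der
    proof eventually_elim
      case (elim x)
      have "((\<lambda>h. (F (x + h *\<^sub>R w) - F x) / h) \<longlongrightarrow> D x) (at 0)"
        using elim by (simp add: has_field_derivative_iff)
      moreover have "filterlim (\<lambda>m. 1 / real (Suc m)) (at 0) sequentially"
        using LIMSEQ_Suc[OF lim_1_over_n[where 'a=real]] by (intro filterlim_atI) auto
      ultimately show ?case
        unfolding s_def by (rule filterlim_compose)
    qed
    show "AE x in lborel. norm (s m x) \<le> C * norm w * indicator (cball 0 (1 + norm w)) x" for m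
    proof (rule AE_I2)
      fix x :: 'a
      have wn: "norm ((1 / real (Suc m)) *\<^sub>R w) \<le> norm w"
        using mult_left_mono[of 1 "1 + real m" "norm w"] by (simp add: divide_simps)
      show "norm (s m x) \<le> C * norm w * indicator (cball 0 (1 + norm w)) x"
      proof (cases "norm x \<le> 1 + norm w")
        case True
        have "\<bar>F (x + (1 / real (Suc m)) *\<^sub>R w) - F x\<bar> \<le> C * norm w * (1 / real (Suc m))"
          using Fd[of "x + (1 / real (Suc m)) *\<^sub>R w" x] by simp
        then have "\<bar>s m x\<bar> \<le> C * norm w"
          unfolding s_def abs_divide by (subst pos_divide_le_eq) auto
        with True show ?thesis by (simp add: indicator_def)
      next
        case False
        moreover have "norm x \<le> norm (x + (1 / real (Suc m)) *\<^sub>R w) + norm ((1 / real (Suc m)) *\<^sub>R w)"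
          using norm_triangle_ineq4[of "x + (1 / real (Suc m)) *\<^sub>R w" "(1 / real (Suc m)) *\<^sub>R w"]
          by (simp del: norm_scaleR)
        ultimately have "norm (x + (1 / real (Suc m)) *\<^sub>R w) \<ge> 1" "norm x \<ge> 1"
          using wn norm_ge_zero[of w] by linarith+
        with False show ?thesis by (simp add: s_def supp)
      qed
    qed
    show "s m \<in> borel_measurable lborel" for m
      unfolding s_def by measurable
    show "integrable lborel (\<lambda>x::'a. C * norm w * indicator (cball 0 (1 + norm w)) x)"
      by (rule ind)
  qed simp
  moreover have "(\<integral>x. s m x \<partial>lborel) = 0" for m
  proof -
    let ?h = "(1 / real (Suc m)) *\<^sub>R w"
    have tr: "distr lborel borel (\<lambda>x. ?h + x) = lborel"
      using lborel_affine[of 1 ?h] by (simp add: density_1)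
    have "integrable (distr lborel borel (\<lambda>x. ?h + x)) F"
      unfolding tr by (rule F_int)
    then have 1: "integrable lborel (\<lambda>x. F (?h + x))"
      by (subst (asm) integrable_distr_eq) simp_all
    have 2: "(\<integral>x. F (?h + x) \<partial>lborel) = (\<integral>x. F x \<partial>lborel)"
      by (subst (2) tr[symmetric], subst integral_distr) simp_all
    show ?thesis
      unfolding s_def using 1 2 F_int by (simp add: add.commute)
  qed
  ultimately show ?thesis
    by (simp add: LIMSEQ_const_iff)
qed

subsection \<open>The divergence theorem on the ball\<close>

text \<open>Multiply \<open>f\<close> by a ramp that is 1 up to radius \<open>1 - \<epsilon>\<close>
  and falls linearly to 0 at radius 1. The directional derivative of the product integrates to 0,
  which equates a ball integral involving \<open>D\<close> with a shell integral divided by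
  \<open>\<epsilon>\<close>. As \<open>\<epsilon>\<close> tends to 0 the latter becomes the
  spherical integral; the shell takes up a share of the ball asymptotic to
  \<open>\<epsilon> * DIM('a)\<close>, the source of the dimension factor.\<close>

theorem sphere_divergence:
  fixes f D :: "'a::euclidean_space \<Rightarrow> real"
  assumes lip: "L-lipschitz_on (cball 0 1) f"
    and [measurable]: "f \<in> borel_measurable borel" "D \<in> borel_measurable borel"
    and der: "\<And>u. norm u < 1 \<Longrightarrow> ((\<lambda>t. f (u + t *\<^sub>R w)) has_real_derivative D u) (at 0)"
    and bnd: "\<And>u. norm u < 1 \<Longrightarrow> \<bar>D u\<bar> \<le> K"
  shows "real DIM('a) * (\<integral>e. f e * (e \<bullet> w) \<partial>uniform_sphere) = (\<integral>u. D u \<partial>uniform_measure lborel (ball 0 1))"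
proof -
  define B where "B = ball (0::'a) 1"
  have [measurable]: "B \<in> sets borel" by (simp add: B_def)
  \<comment> \<open>\<open>f\<close> is Lipschitz only on the closed unit ball. Composition with the
    projection makes it globally Lipschitz, as the zero-integral lemma requires; the ramp hides the
    change outside the ball.\<close>
  define proj where "proj = closest_point (cball (0::'a) 1)"
  have proj_in: "norm (proj x) \<le> 1" for x
    using closest_point_in_set[of "cball (0::'a) 1" x] by (simp add: proj_def)
  have proj_self: "proj x = x" if "norm x \<le> 1" for x
    using that by (simp add: proj_def closest_point_self)
  have proj_dist: "norm (proj x - proj y) \<le> norm (x - y)" for x y
    using closest_point_lipschitz[of "cball (0::'a) 1" x y] by (simp add: proj_def dist_norm)
  have "L \<ge> 0" using lip by (rule lipschitz_on_nonneg)
  have fd: "\<bar>f x - f y\<bar> \<le> L * norm (x - y)" if "norm x \<le> 1" "norm y \<le> 1" for x y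
    using lipschitz_onD[OF lip, of x y] that by (simp add: dist_norm dist_real_def)
  define C where "C = \<bar>f 0\<bar> + L"
  have fC: "\<bar>f x\<bar> \<le> C" if "norm x \<le> 1" for x
    using fd[of x 0] that mult_left_le[OF that \<open>L \<ge> 0\<close>] by (simp add: C_def)
  have "C \<ge> 0" using \<open>L \<ge> 0\<close> by (simp add: C_def)
  have bounded_int: "integrable lborel (\<lambda>x. indicator B x * g x)"
    if [measurable]: "g \<in> borel_measurable borel" and "\<And>x. norm x < 1 \<Longrightarrow> \<bar>g x\<bar> \<le> c" for g :: "'a \<Rightarrow> real" and c
    using that(2) emeasure_lborel_ball_finite[of "0::'a" 1]
    by (intro integrableI_bounded_set[where A = B and B = c]) (auto simp: B_def indicator_def)
  let ?g = "\<lambda>e. f e * (e \<bullet> w)"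
  let ?n = "DIM('a)"
  define shell where "shell \<epsilon> x = (indicator B x - indicator (ball 0 (1 - \<epsilon>)) x :: real)" for \<epsilon> and x :: 'a
  have [measurable]: "shell \<epsilon> \<in> borel_measurable borel" for \<epsilon>
    unfolding shell_def by (intro borel_measurable_diff borel_measurable_indicator) auto
  have shell_eq: "shell \<epsilon> x = indicator B x * indicator {x. 1 - \<epsilon> \<le> norm x} x" if "0 < \<epsilon>" for \<epsilon> x
    using that by (auto simp: shell_def B_def indicator_def)
  \<comment> \<open>A shell is a difference of two concentric balls, and integrals of functions of
    \<open>sgn x\<close> scale with a power of the radius, so the shell average of such a function
    equals its ball average.\<close>
  have shell_int: "(\<integral>x. shell \<epsilon> x * g (sgn x) \<partial>lborel) = (1 - (1 - \<epsilon>) ^ ?n) * (\<integral>x. indicator B x * g (sgn x) \<partial>lborel)"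
    if [measurable]: "g \<in> borel_measurable borel" and bg: "\<And>x. norm x \<le> 1 \<Longrightarrow> \<bar>g x\<bar> \<le> c"
      and \<epsilon>: "0 < \<epsilon>" "\<epsilon> < 1" for g :: "'a \<Rightarrow> real" and c \<epsilon>
  proof -
    have b: "\<bar>g (sgn x)\<bar> \<le> c" for x using bg[of "sgn x"] by (simp add: norm_sgn)
    have i1: "integrable lborel (\<lambda>x. indicator B x * g (sgn x))"
      using b by (intro bounded_int[where c = c]) auto
    have i2: "integrable lborel (\<lambda>x. indicator (ball 0 (1 - \<epsilon>)) x * g (sgn x))"
      using b emeasure_lborel_ball_finite[of "0::'a" "1 - \<epsilon>"]
      by (intro integrableI_bounded_set[where A = "ball 0 (1 - \<epsilon>)" and B = c]) (auto simp: indicator_def)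
    show ?thesis
      unfolding shell_def left_diff_distrib using i1 i2 integral_sgn_ball[of g "1 - \<epsilon>"] \<epsilon>
      by (simp add: B_def)
  qed
  have identity: "(\<integral>x. indicator B x * (min 1 ((1 - norm x) / \<epsilon>) * D x) \<partial>lborel) =
      (\<integral>x. shell \<epsilon> x * (f x * (sgn x \<bullet> w)) \<partial>lborel) / \<epsilon>" if \<epsilon>: "0 < \<epsilon>" "\<epsilon> < 1" for \<epsilon>
  proof -
    define ramp where "ramp x = max 0 (min 1 ((1 - norm x) / \<epsilon>))" for x :: 'a
    define F where "F x = ramp x * f (proj x)" for x
    \<comment> \<open>The almost everywhere derivative of \<open>F\<close>: the ramp times
      \<open>D\<close>, and on the shell also \<open>f\<close> times the slope
      \<open>- (sgn x \<bullet> w) / \<epsilon>\<close> of the ramp. The two spheres where the ramp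
      has a kink are null sets.\<close>
    define DF where "DF x = indicator B x * (min 1 ((1 - norm x) / \<epsilon>) * D x) - shell \<epsilon> x * (f x * (sgn x \<bullet> w)) / \<epsilon>" for x
    have [measurable]: "DF \<in> borel_measurable borel" unfolding DF_def by measurable
    have chi_le: "\<bar>ramp x\<bar> \<le> 1" for x by (auto simp: ramp_def)
    have chi_d: "\<bar>ramp x - ramp y\<bar> \<le> norm (x - y) / \<epsilon>" for x y
    proof -
      have "\<bar>ramp x - ramp y\<bar> \<le> \<bar>(1 - norm x) / \<epsilon> - (1 - norm y) / \<epsilon>\<bar>"
        unfolding ramp_def by (simp add: max_def min_def)
      also have "\<dots> = \<bar>norm y - norm x\<bar> / \<epsilon>"
        using \<epsilon> by (simp add: diff_divide_distrib[symmetric])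
      also have "\<dots> \<le> norm (x - y) / \<epsilon>"
        using \<epsilon> norm_triangle_ineq3[of y x] by (intro divide_right_mono) (auto simp: norm_minus_commute)
      finally show ?thesis .
    qed
    have lipF: "(C / \<epsilon> + L)-lipschitz_on UNIV F"
    proof (rule lipschitz_onI)
      fix x y :: 'a
      have "F x - F y = (ramp x - ramp y) * f (proj x) + ramp y * (f (proj x) - f (proj y))"
        by (simp add: F_def algebra_simps)
      then have "\<bar>F x - F y\<bar> \<le> \<bar>ramp x - ramp y\<bar> * \<bar>f (proj x)\<bar> + \<bar>ramp y\<bar> * \<bar>f (proj x) - f (proj y)\<bar>"
        by (metis abs_mult abs_triangle_ineq)
      also have "\<dots> \<le> (norm (x - y) / \<epsilon>) * C + 1 * (L * norm (x - y))"
      proof (intro add_mono mult_mono chi_d chi_le fC proj_in)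
        show "\<bar>f (proj x) - f (proj y)\<bar> \<le> L * norm (x - y)"
          using fd[OF proj_in proj_in, of x y] mult_left_mono[OF proj_dist \<open>L \<ge> 0\<close>, of x y] by linarith
      qed (use \<epsilon> in auto)
      also have "\<dots> = (C / \<epsilon> + L) * dist x y" by (simp add: dist_norm algebra_simps)
      finally show "dist (F x) (F y) \<le> (C / \<epsilon> + L) * dist x y" by (simp add: dist_real_def)
    qed (use \<epsilon> \<open>C \<ge> 0\<close> \<open>L \<ge> 0\<close> in auto)
    have "(\<integral>x. DF x \<partial>lborel) = 0"
    proof (rule integral_directional_derivative_eq_0[OF lipF])
      show "F x = 0" if "norm x \<ge> 1" for x
      proof -
        have "(1 - norm x) / \<epsilon> \<le> 0" using \<epsilon> that by (simp add: divide_nonpos_pos)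
        then show ?thesis by (simp add: F_def ramp_def)
      qed
      show "AE x in lborel. ((\<lambda>t. F (x + t *\<^sub>R w)) has_real_derivative DF x) (at 0)"
        using AE_lborel_not_sphere[of 1] AE_lborel_not_sphere[of "1 - \<epsilon>"]
      proof eventually_elim
        case (elim x)
        have cont: "continuous (at 0) (\<lambda>t. norm (x + t *\<^sub>R w))" by (intro continuous_intros)
        have lt: "\<forall>\<^sub>F t in nhds 0. norm (x + t *\<^sub>R w) < r" if "norm x < r" for r
          using order_tendstoD(2)[OF tendsto_at_iff_tendsto_nhds[THEN iffD1, OF cont[unfolded continuous_at]]] that by simp
        have gt: "\<forall>\<^sub>F t in nhds 0. norm (x + t *\<^sub>R w) > r" if "norm x > r" for r
          using order_tendstoD(1)[OF tendsto_at_iff_tendsto_nhds[THEN iffD1, OF cont[unfolded continuous_at]]] that by simp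
        consider "norm x < 1 - \<epsilon>" | "1 - \<epsilon> < norm x" "norm x < 1" | "norm x > 1"
          using elim by linarith
        then show ?case
        proof cases
          case 1
          then have "DF x = D x" using \<epsilon> by (auto simp: DF_def shell_eq B_def indicator_def pos_le_divide_eq)
          moreover have "\<forall>\<^sub>F t in nhds 0. F (x + t *\<^sub>R w) = f (x + t *\<^sub>R w)"
            using lt[OF 1] by eventually_elim (use \<epsilon> in \<open>simp add: F_def ramp_def proj_self pos_le_divide_eq min_absorb1\<close>)
          ultimately show ?thesis
            using der[of x] 1 \<epsilon> by (subst DERIV_cong_ev[OF refl _ refl]) auto
        next
          case 2
          have DFx: "DF x = (1 - norm x) / \<epsilon> * D x - f x * (sgn x \<bullet> w) / \<epsilon>"
            using 2 \<epsilon> by (simp add: DF_def shell_eq B_def indicator_def min_def pos_le_divide_eq)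
          have ev: "\<forall>\<^sub>F t in nhds 0. F (x + t *\<^sub>R w) = (1 - norm (x + t *\<^sub>R w)) / \<epsilon> * f (x + t *\<^sub>R w)"
            using lt[OF 2(2)] gt[OF 2(1)]
            by eventually_elim (use \<epsilon> in \<open>simp add: F_def ramp_def proj_self pos_divide_le_eq min_absorb2\<close>)
          have "x \<noteq> 0" using 2 \<epsilon> by auto
          have "((\<lambda>t. norm (x + t *\<^sub>R w)) has_derivative (\<lambda>t. (t *\<^sub>R w) \<bullet> sgn x)) (at 0)"
            by (rule has_derivative_compose[where g = norm and f = "\<lambda>t. x + t *\<^sub>R w"])
              (use \<open>x \<noteq> 0\<close> in \<open>auto intro!: derivative_eq_intros has_derivative_norm\<close>)
          then have nd: "((\<lambda>t. norm (x + t *\<^sub>R w)) has_real_derivative (sgn x \<bullet> w)) (at 0)"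
            by (simp add: has_field_derivative_def inner_commute mult_commute_abs)
          have "((\<lambda>t. (1 - norm (x + t *\<^sub>R w)) / \<epsilon> * f (x + t *\<^sub>R w)) has_real_derivative DF x) (at 0)"
            using DERIV_mult[OF DERIV_cdivide[OF DERIV_diff[OF DERIV_const nd]] der[OF 2(2)], of 1 \<epsilon>]
            by (simp add: DFx mult.commute)
          with ev show ?thesis
            by (subst DERIV_cong_ev[OF refl _ refl]) auto
        next
          case 3
          have "\<forall>\<^sub>F t in nhds 0. F (x + t *\<^sub>R w) = 0"
            using gt[OF 3] by eventually_elim (use \<epsilon> in \<open>simp add: F_def ramp_def divide_nonpos_pos min_def max_def zero_le_divide_iff\<close>)
          moreover have "DF x = 0" using 3 \<epsilon> by (simp add: DF_def shell_eq B_def indicator_def)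
          ultimately show ?thesis
            by (subst DERIV_cong_ev[OF refl _ refl]) auto
        qed
      qed
    qed simp
    moreover have "integrable lborel (\<lambda>x. indicator B x * (min 1 ((1 - norm x) / \<epsilon>) * D x))"
    proof (rule bounded_int[where c = K])
      fix x :: 'a assume x: "norm x < 1"
      have "\<bar>min 1 ((1 - norm x) / \<epsilon>)\<bar> \<le> 1" using x \<epsilon> by (simp add: min_def)
      then show "\<bar>min 1 ((1 - norm x) / \<epsilon>) * D x\<bar> \<le> K"
        using mult_mono[OF _ bnd[OF x], of "\<bar>min 1 ((1 - norm x) / \<epsilon>)\<bar>" 1] by (simp add: abs_mult)
    qed simp
    moreover have "integrable lborel (\<lambda>x. shell \<epsilon> x * (f x * (sgn x \<bullet> w)) / \<epsilon>)"
      unfolding shell_eq[OF \<epsilon>(1)] mult.assoc times_divide_eq_right[symmetric]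
    proof (rule bounded_int[where c = "C * norm w / \<epsilon>"])
      fix x :: 'a assume x: "norm x < 1"
      have "\<bar>sgn x \<bullet> w\<bar> \<le> norm w"
        using Cauchy_Schwarz_ineq2[of "sgn x" w] by (auto simp: norm_sgn split: if_splits)
      then have "\<bar>f x\<bar> * \<bar>sgn x \<bullet> w\<bar> \<le> C * norm w"
        using fC[of x] x \<open>C \<ge> 0\<close> by (intro mult_mono) auto
      then show "\<bar>indicator {x. 1 - \<epsilon> \<le> norm x} x * (f x * ((sgn x \<bullet> w) / \<epsilon>))\<bar> \<le> C * norm w / \<epsilon>"
        using \<epsilon> \<open>C \<ge> 0\<close> by (auto simp: indicator_def abs_mult divide_right_mono)
    qed measurable
    ultimately show ?thesis unfolding DF_def by simp
  qed
  \<comment> \<open>Starting at 1/2 keeps every width strictly below 1, as \<open>identity\<close>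
    and \<open>shell_int\<close> demand.\<close>
  define \<epsilon> where "\<epsilon> m = 1 / real (Suc (Suc m))" for m
  have eps: "0 < \<epsilon> m" "\<epsilon> m < 1" for m by (auto simp: \<epsilon>_def)
  have eps0: "\<epsilon> \<longlonglongrightarrow> 0" unfolding \<epsilon>_def by (intro LIMSEQ_Suc lim_1_over_n)
  then have eps_at: "filterlim \<epsilon> (at 0) sequentially"
    using eps(1) by (intro filterlim_atI) (auto simp: less_imp_neq[symmetric])
  let ?lhs = "\<lambda>m. \<integral>x. indicator B x * (min 1 ((1 - norm x) / \<epsilon> m) * D x) \<partial>lborel"
  have lim1: "?lhs \<longlonglongrightarrow> (\<integral>x. indicator B x * D x \<partial>lborel)"
  proof (rule integral_dominated_convergence[where w = "\<lambda>x. indicator B x * K"])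
    show "integrable lborel (\<lambda>x. indicator B x * K)"
      by (rule bounded_int[where c = "\<bar>K\<bar>"]) auto
    show "AE x in lborel. (\<lambda>m. indicator B x * (min 1 ((1 - norm x) / \<epsilon> m) * D x)) \<longlonglongrightarrow> indicator B x * D x"
    proof (rule AE_I2)
      fix x :: 'a
      show "(\<lambda>m. indicator B x * (min 1 ((1 - norm x) / \<epsilon> m) * D x)) \<longlonglongrightarrow> indicator B x * D x"
      proof (cases "norm x < 1")
        case True
        have "\<forall>\<^sub>F m in sequentially. \<epsilon> m < 1 - norm x"
          using order_tendstoD(2)[OF eps0, of "1 - norm x"] True by simp
        then have "\<forall>\<^sub>F m in sequentially. indicator B x * (min 1 ((1 - norm x) / \<epsilon> m) * D x) = indicator B x * D x"
        proof eventually_elim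
          case (elim m)
          then have "1 \<le> (1 - norm x) / \<epsilon> m" using eps[of m] by (simp add: pos_le_divide_eq)
          then show ?case by simp
        qed
        then show ?thesis by (rule tendsto_eventually)
      qed (simp add: B_def)
    qed
    show "AE x in lborel. norm (indicator B x * (min 1 ((1 - norm x) / \<epsilon> m) * D x)) \<le> indicator B x * K" for m
    proof (rule AE_I2)
      fix x :: 'a
      show "norm (indicator B x * (min 1 ((1 - norm x) / \<epsilon> m) * D x)) \<le> indicator B x * K"
      proof (cases "norm x < 1")
        case x: True
        have "\<bar>min 1 ((1 - norm x) / \<epsilon> m)\<bar> \<le> 1" using x eps[of m] by (simp add: min_def)
        then show ?thesis
          using mult_mono[OF _ bnd[OF x], of "\<bar>min 1 ((1 - norm x) / \<epsilon> m)\<bar>" 1] x by (simp add: abs_mult B_def)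
      qed (simp add: B_def)
    qed
  qed measurable
  \<comment> \<open>A difference quotient at 0 of \<open>1 - (1 - x) ^ ?n\<close>, whose derivative
    there is the dimension.\<close>
  define q where "q m = (1 - (1 - \<epsilon> m) ^ ?n) / \<epsilon> m" for m
  have "((\<lambda>x. 1 - (1 - x) ^ ?n) has_real_derivative real ?n) (at 0)"
    by (auto intro!: derivative_eq_intros)
  then have "((\<lambda>h. (1 - (1 - h) ^ ?n) / h) \<longlongrightarrow> real ?n) (at 0)"
    by (simp add: has_field_derivative_iff)
  then have q: "q \<longlonglongrightarrow> real ?n"
    unfolding q_def by (rule filterlim_compose[OF _ eps_at])
  define I where "I = (\<integral>x. indicator B x * ?g (sgn x) \<partial>lborel)"
  define V where "V = measure lborel B"
  have V: "(\<integral>x. indicator B x \<partial>lborel) = V" by (simp add: V_def)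
  \<comment> \<open>On the shell \<open>x\<close> lies within \<open>\<epsilon> m\<close> of
    \<open>sgn x\<close>, so replacing \<open>f x\<close> by \<open>f (sgn x)\<close> costs at most
    \<open>L * \<epsilon> m\<close>. The bound tends to 0 even after the division by
    \<open>\<epsilon> m\<close>, because the shell volume \<open>\<epsilon> m * q m * V\<close> is
    itself of that order.\<close>
  have err: "\<bar>?lhs m - q m * I\<bar> \<le> L * norm w * (\<epsilon> m * q m * V)" for m
  proof -
    note e = eps[of m]
    have sw: "\<bar>sgn x \<bullet> w\<bar> \<le> norm w" for x
      using Cauchy_Schwarz_ineq2[of "sgn x" w] by (auto simp: norm_sgn split: if_splits)
    have sf: "\<bar>f x * (sgn x \<bullet> w)\<bar> \<le> C * norm w" if "norm x \<le> 1" for x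
      using fC[OF that] sw[of x] \<open>C \<ge> 0\<close> unfolding abs_mult by (intro mult_mono) auto
    have sf': "\<bar>?g x\<bar> \<le> C * norm w" if "norm x \<le> 1" for x
    proof -
      have "\<bar>x \<bullet> w\<bar> \<le> norm w"
        using Cauchy_Schwarz_ineq2[of x w] mult_right_mono[OF that norm_ge_zero[of w]] by simp
      then show ?thesis using fC[OF that] \<open>C \<ge> 0\<close> unfolding abs_mult by (intro mult_mono) auto
    qed
    have gI: "(\<integral>x. shell (\<epsilon> m) x * ?g (sgn x) \<partial>lborel) = (1 - (1 - \<epsilon> m) ^ ?n) * I"
      unfolding I_def using sf' e by (intro shell_int[where c = "C * norm w"]) auto
    have i1: "integrable lborel (\<lambda>x. shell (\<epsilon> m) x * (f x * (sgn x \<bullet> w)))"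
      unfolding shell_eq[OF e(1)] mult.assoc
      using sf \<open>C \<ge> 0\<close> by (intro bounded_int[where c = "C * norm w"]) (auto simp: indicator_def)
    have i2: "integrable lborel (\<lambda>x. shell (\<epsilon> m) x * ?g (sgn x))"
      unfolding shell_eq[OF e(1)] mult.assoc
      using sf'[of "sgn _"] \<open>C \<ge> 0\<close> by (intro bounded_int[where c = "C * norm w"]) (auto simp: indicator_def norm_sgn)
    have i3: "integrable lborel (\<lambda>x. shell (\<epsilon> m) x * (\<epsilon> m * L * norm w))"
      unfolding shell_eq[OF e(1)] mult.assoc
      using e \<open>L \<ge> 0\<close> by (intro bounded_int[where c = "\<epsilon> m * L * norm w"]) (auto simp: indicator_def)
    have "\<bar>(\<integral>x. shell (\<epsilon> m) x * (f x * (sgn x \<bullet> w)) \<partial>lborel) - (\<integral>x. shell (\<epsilon> m) x * ?g (sgn x) \<partial>lborel)\<bar> =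
        \<bar>\<integral>x. shell (\<epsilon> m) x * (f x * (sgn x \<bullet> w)) - shell (\<epsilon> m) x * ?g (sgn x) \<partial>lborel\<bar>"
      using i1 i2 by simp
    also have "\<dots> \<le> (\<integral>x. shell (\<epsilon> m) x * (\<epsilon> m * L * norm w) \<partial>lborel)"
    proof (rule order_trans[OF integral_abs_bound integral_mono])
      fix x :: 'a
      show "\<bar>shell (\<epsilon> m) x * (f x * (sgn x \<bullet> w)) - shell (\<epsilon> m) x * ?g (sgn x)\<bar> \<le> shell (\<epsilon> m) x * (\<epsilon> m * L * norm w)"
      proof (cases "1 - \<epsilon> m \<le> norm x \<and> norm x < 1")
        case True
        have "norm (x - sgn x) = 1 - norm x"
        proof -
          have "x \<noteq> 0" using True e by auto
          have "x - sgn x = (norm x - 1) *\<^sub>R sgn x"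
            by (simp add: sgn_div_norm left_diff_distrib scaleR_diff_left \<open>x \<noteq> 0\<close>)
          then show ?thesis using True \<open>x \<noteq> 0\<close> by (simp add: norm_sgn)
        qed
        moreover have "\<bar>f x - f (sgn x)\<bar> \<le> L * norm (x - sgn x)"
          using True by (intro fd) (auto simp: norm_sgn)
        ultimately have "\<bar>f x - f (sgn x)\<bar> \<le> L * \<epsilon> m"
          using True \<open>L \<ge> 0\<close> mult_left_mono[of "norm (x - sgn x)" "\<epsilon> m" L] by simp
        then have "\<bar>f x - f (sgn x)\<bar> * \<bar>sgn x \<bullet> w\<bar> \<le> (L * \<epsilon> m) * norm w"
          using sw[of x] e \<open>L \<ge> 0\<close> by (intro mult_mono) auto
        then show ?thesis
          using True by (simp add: shell_eq[OF e(1)] B_def left_diff_distrib[symmetric] abs_mult mult_ac)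
      next
        case False
        then show ?thesis by (auto simp: shell_eq[OF e(1)] B_def)
      qed
    qed (use i1 i2 i3 in auto)
    also have "\<dots> = (1 - (1 - \<epsilon> m) ^ ?n) * V * (\<epsilon> m * L * norm w)"
      using shell_int[of "\<lambda>_. 1" 1 "\<epsilon> m"] e V by simp
    finally have main: "\<bar>(\<integral>x. shell (\<epsilon> m) x * (f x * (sgn x \<bullet> w)) \<partial>lborel) - (1 - (1 - \<epsilon> m) ^ ?n) * I\<bar> \<le>
      (1 - (1 - \<epsilon> m) ^ ?n) * V * (\<epsilon> m * L * norm w)" unfolding gI .
    have "?lhs m - q m * I = ((\<integral>x. shell (\<epsilon> m) x * (f x * (sgn x \<bullet> w)) \<partial>lborel) - (1 - (1 - \<epsilon> m) ^ ?n) * I) / \<epsilon> m"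
      unfolding identity[OF e] q_def using e by (simp add: field_simps)
    then have "\<bar>?lhs m - q m * I\<bar> \<le> (1 - (1 - \<epsilon> m) ^ ?n) * V * (\<epsilon> m * L * norm w) / \<epsilon> m"
      using divide_right_mono[OF main, of "\<epsilon> m"] e by (simp only: abs_divide) simp
    also have "\<dots> = L * norm w * (\<epsilon> m * q m * V)" using e by (simp add: q_def)
    finally show ?thesis .
  qed
  have "(\<lambda>m. ?lhs m - q m * I) \<longlonglongrightarrow> 0"
  proof (rule Lim_null_comparison[where g = "\<lambda>m. L * norm w * (\<epsilon> m * q m * V)"])
    show "(\<lambda>m. L * norm w * (\<epsilon> m * q m * V)) \<longlonglongrightarrow> 0"
      using tendsto_mult[OF tendsto_const[of "L * norm w"] tendsto_mult[OF tendsto_mult[OF eps0 q] tendsto_const[of V]]]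
      by simp
  qed (use err in auto)
  moreover have "(\<lambda>m. ?lhs m - q m * I) \<longlonglongrightarrow> (\<integral>x. indicator B x * D x \<partial>lborel) - real ?n * I"
    by (intro tendsto_intros lim1 q)
  ultimately have "(\<integral>x. indicator B x * D x \<partial>lborel) = real ?n * I"
    using LIMSEQ_unique by fastforce
  moreover have "I = V * (\<integral>e. ?g e \<partial>uniform_sphere)"
    unfolding I_def B_def V_def by (subst integral_uniform_sphere[of ?g, symmetric]) auto
  ultimately show ?thesis
    using measure_lborel_unit_ball_pos[where 'a='a] emeasure_lborel_unit_ball[where 'a='a]
    by (subst integral_uniform_measure_real) (auto simp: B_def V_def)
qed

section \<open>First consequences for the uniform laws on ball and sphere\<close>

lemma prob_space_uniform_ball: "prob_space (uniform_measure lborel (ball (0::'a::euclidean_space) 1))"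
  using emeasure_lborel_unit_ball[where 'a='a] by (intro prob_space_uniform_measure) auto

lemma AE_uniform_sphere: "AE e in uniform_sphere. norm (e :: 'a::euclidean_space) = 1"
proof -
  have "AE x in uniform_measure lborel (ball (0::'a) 1). norm (sgn x) = 1"
    by (rule AE_uniform_measureI) (use AE_lborel_singleton[of "0::'a"] in \<open>auto simp: norm_sgn\<close>)
  then show ?thesis
    unfolding uniform_sphere_def by (subst AE_distr_iff) auto
qed

text \<open>The divergence theorem for a linear function, whose directional derivative is constant.
  The division by the dimension is what later yields \<open>n * M\<^sup>2\<close> in place of
  \<open>n\<^sup>2 * M\<^sup>2\<close>.\<close>

lemma integral_inner_uniform_sphere:
  fixes v w :: "'a::euclidean_space"
  shows "(\<integral>e. (e \<bullet> v) * (e \<bullet> w) \<partial>uniform_sphere) = (v \<bullet> w) / DIM('a)"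
proof -
  interpret prob_space "uniform_measure lborel (ball (0::'a) 1)" by (rule prob_space_uniform_ball)
  have "real DIM('a) * (\<integral>e. (e \<bullet> v) * (e \<bullet> w) \<partial>uniform_sphere) =
      (\<integral>u. w \<bullet> v \<partial>uniform_measure lborel (ball (0::'a) 1))"
  proof (rule sphere_divergence[where L = "norm v" and K = "\<bar>w \<bullet> v\<bar>"])
    show "(norm v)-lipschitz_on (cball 0 1) (\<lambda>u. u \<bullet> v)"
      by (rule lipschitz_onI) (auto simp: dist_norm dist_real_def inner_diff_left[symmetric] mult.commute
        intro: order_trans[OF Cauchy_Schwarz_ineq2])
    show "((\<lambda>t. (u + t *\<^sub>R w) \<bullet> v) has_real_derivative w \<bullet> v) (at 0)" for u :: 'a
      by (auto simp: inner_add_left intro!: derivative_eq_intros)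
  qed auto
  also have "\<dots> = v \<bullet> w"
    using prob_space by (simp add: inner_commute)
  finally show ?thesis by (simp add: field_simps)
qed

lemma nn_integral_inner_uniform_sphere:
  fixes v :: "'a::euclidean_space"
  shows "(\<integral>\<^sup>+e. ennreal ((e \<bullet> v)\<^sup>2) \<partial>uniform_sphere) = ennreal ((norm v)\<^sup>2 / DIM('a))"
proof -
  interpret prob_space "uniform_sphere :: 'a measure" by (rule prob_space_uniform_sphere)
  have "AE e in uniform_sphere. norm ((e \<bullet> v)\<^sup>2) \<le> (norm v)\<^sup>2"
    using AE_uniform_sphere
  proof eventually_elim
    case (elim e)
    then have "\<bar>e \<bullet> v\<bar> \<le> \<bar>norm v\<bar>" using Cauchy_Schwarz_ineq2[of e v] by simp
    then show ?case unfolding abs_le_square_iff by simp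
  qed
  then have "integrable uniform_sphere (\<lambda>e. (e \<bullet> v)\<^sup>2)"
    by (rule integrable_const_bound) simp
  then show ?thesis
    using integral_inner_uniform_sphere[of v v]
    by (subst nn_integral_eq_integral) (auto simp: power2_eq_square dot_square_norm)
qed

subsection \<open>Rotations of a pair of vectors\<close>

text \<open>The first component travels from \<open>fst p\<close> at angle 0 to \<open>snd p\<close>
  at angle \<open>pi / 2\<close>, with initial velocity \<open>snd p\<close>. Differentiating a
  function along this path pairs its gradient with the second component, whose direction is uniform
  once the first is fixed.\<close>

definition pair_rotation :: "real \<Rightarrow> 'a::real_vector \<times> 'a \<Rightarrow> 'a \<times> 'a" where
  "pair_rotation \<theta> p = (cos \<theta> *\<^sub>R fst p + sin \<theta> *\<^sub>R snd p, cos \<theta> *\<^sub>R snd p - sin \<theta> *\<^sub>R fst p)"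

lemma pair_rotation_measurable [measurable]:
  "(pair_rotation \<theta> :: 'a::euclidean_space \<times> 'a \<Rightarrow> _) \<in> borel_measurable borel"
  unfolding pair_rotation_def by (intro borel_measurable_continuous_onI continuous_intros)

lemma pair_rotation_add: "pair_rotation \<theta> (pair_rotation \<eta> p) = pair_rotation (\<theta> + \<eta>) p"
  by (auto simp: pair_rotation_def cos_add sin_add algebra_simps)

lemma norm_pair_rotation: "norm (pair_rotation \<theta> p) = norm (p :: 'a::real_inner \<times> 'a)"
proof -
  let ?x = "fst p" and ?y = "snd p" and ?c = "cos \<theta>" and ?s = "sin \<theta>"
  have cs: "?c * ?c + ?s * ?s = 1" using sin_cos_squared_add[of \<theta>] by (simp add: power2_eq_square)
  have "pair_rotation \<theta> p \<bullet> pair_rotation \<theta> p =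
      (?c * ?c * (?x \<bullet> ?x) + ?s * ?s * (?x \<bullet> ?x)) + (?c * ?c * (?y \<bullet> ?y) + ?s * ?s * (?y \<bullet> ?y))"
    by (simp add: pair_rotation_def inner_prod_def inner_add_left inner_add_right inner_diff_left
      inner_diff_right inner_commute algebra_simps)
  also have "\<dots> = (?c * ?c + ?s * ?s) * (?x \<bullet> ?x) + (?c * ?c + ?s * ?s) * (?y \<bullet> ?y)"
    by (simp only: distrib_right)
  also have "\<dots> = p \<bullet> p" by (simp add: cs inner_prod_def)
  finally show ?thesis by (simp add: norm_eq_sqrt_inner)
qed

section \<open>Shears and rotations preserve Lebesgue measure\<close>

lemma nn_integral_lborel_translate:
  fixes f :: "'a::euclidean_space \<Rightarrow> ennreal"
  assumes [measurable]: "f \<in> borel_measurable borel"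
  shows "(\<integral>\<^sup>+x. f (x + a) \<partial>lborel) = (\<integral>\<^sup>+x. f x \<partial>lborel)"
proof -
  have tr: "distr lborel borel (\<lambda>x. a + x) = lborel"
    using lborel_affine[of 1 a] by (simp add: density_1)
  show ?thesis
    by (subst (2) tr[symmetric], subst nn_integral_distr) (simp_all add: add.commute)
qed

lemma nn_integral_shear_fst:
  fixes f :: "'a::euclidean_space \<times> 'a \<Rightarrow> ennreal"
  assumes [measurable]: "f \<in> borel_measurable borel"
  shows "(\<integral>\<^sup>+p. f (fst p + a *\<^sub>R snd p, snd p) \<partial>lborel) = (\<integral>\<^sup>+p. f p \<partial>lborel)"
proof -
  have [measurable]: "f \<in> borel_measurable (borel \<Otimes>\<^sub>M borel)" by (simp add: borel_prod)
  have "(\<integral>\<^sup>+p. f (fst p + a *\<^sub>R snd p, snd p) \<partial>(lborel \<Otimes>\<^sub>M lborel)) =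
      (\<integral>\<^sup>+y. \<integral>\<^sup>+x. f (x + a *\<^sub>R y, y) \<partial>lborel \<partial>lborel)"
    by (subst lborel_pair.nn_integral_snd[symmetric]) simp_all
  also have "\<dots> = (\<integral>\<^sup>+y. \<integral>\<^sup>+x. f (x, y) \<partial>lborel \<partial>lborel)"
    by (intro nn_integral_cong nn_integral_lborel_translate) measurable
  also have "\<dots> = (\<integral>\<^sup>+p. f p \<partial>(lborel \<Otimes>\<^sub>M lborel))"
    by (subst lborel_pair.nn_integral_snd[symmetric]) simp_all
  finally show ?thesis by (simp add: lborel_prod)
qed

lemma nn_integral_shear_snd:
  fixes f :: "'a::euclidean_space \<times> 'a \<Rightarrow> ennreal"
  assumes [measurable]: "f \<in> borel_measurable borel"
  shows "(\<integral>\<^sup>+p. f (fst p, snd p + a *\<^sub>R fst p) \<partial>lborel) = (\<integral>\<^sup>+p. f p \<partial>lborel)"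
proof -
  have [measurable]: "f \<in> borel_measurable (borel \<Otimes>\<^sub>M borel)" by (simp add: borel_prod)
  have "(\<integral>\<^sup>+p. f (fst p, snd p + a *\<^sub>R fst p) \<partial>(lborel \<Otimes>\<^sub>M lborel)) =
      (\<integral>\<^sup>+x. \<integral>\<^sup>+y. f (x, y + a *\<^sub>R x) \<partial>lborel \<partial>lborel)"
    by (subst lborel.nn_integral_fst[symmetric]) simp_all
  also have "\<dots> = (\<integral>\<^sup>+x. \<integral>\<^sup>+y. f (x, y) \<partial>lborel \<partial>lborel)"
    by (intro nn_integral_cong nn_integral_lborel_translate) measurable
  also have "\<dots> = (\<integral>\<^sup>+p. f p \<partial>(lborel \<Otimes>\<^sub>M lborel))"
    by (subst lborel.nn_integral_fst[symmetric]) simp_all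
  finally show ?thesis by (simp add: lborel_prod)
qed

text \<open>A planar rotation is a product of three shears, and a shear preserves Lebesgue measure
  by Fubini and translation invariance. The range of \<open>\<theta>\<close> keeps
  \<open>sin \<theta>\<close> positive except at 0, where the rotation is the identity.\<close>

lemma nn_integral_pair_rotation:
  fixes f :: "'a::euclidean_space \<times> 'a \<Rightarrow> ennreal"
  assumes [measurable]: "f \<in> borel_measurable borel" and \<theta>: "0 \<le> \<theta>" "\<theta> < pi"
  shows "(\<integral>\<^sup>+p. f (pair_rotation \<theta> p) \<partial>lborel) = (\<integral>\<^sup>+p. f p \<partial>lborel)"
proof (cases "\<theta> = 0")
  case True
  then show ?thesis by (simp add: pair_rotation_def)
next
  case False
  define s c where "s = sin \<theta>" and "c = cos \<theta>"
  \<comment> \<open>This is \<open>tan (\<theta> / 2)\<close>: shears with parameters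
    \<open>a\<close>, \<open>- s\<close> and \<open>a\<close> compose to the rotation.\<close>
  define a where "a = (1 - c) / s"
  have "s > 0" using False \<theta> by (simp add: s_def sin_gt_zero)
  have "(1 - c) * (1 + c) = s * s"
    using sin_cos_squared_add[of \<theta>] by (simp add: s_def c_def power2_eq_square algebra_simps)
  then have 2: "a * (1 + c) = s" and 1: "1 - a * s = c"
    using \<open>s > 0\<close> by (simp_all add: a_def field_simps)
  define f1 where "f1 p = f (fst p + a *\<^sub>R snd p, snd p)" for p
  define f2 where "f2 p = f1 (fst p, snd p + (- s) *\<^sub>R fst p)" for p
  have [measurable]: "(\<lambda>p :: 'a \<times> 'a. (fst p + r *\<^sub>R snd p, snd p)) \<in> borel_measurable borel"
    "(\<lambda>p :: 'a \<times> 'a. (fst p, snd p + r *\<^sub>R fst p)) \<in> borel_measurable borel" for r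
    by (intro borel_measurable_continuous_onI continuous_intros)+
  have [measurable]: "f1 \<in> borel_measurable borel" unfolding f1_def by measurable
  have [measurable]: "f2 \<in> borel_measurable borel" unfolding f2_def by measurable
  have "f (pair_rotation \<theta> p) = f2 (fst p + a *\<^sub>R snd p, snd p)" for p
  proof -
    let ?x = "fst p" and ?y = "snd p"
    have y: "?y + (- s) *\<^sub>R (?x + a *\<^sub>R ?y) = c *\<^sub>R ?y - s *\<^sub>R ?x"
      by (simp add: algebra_simps flip: 1)
    have "a + a * c = s" using 2 by (simp add: algebra_simps)
    then have "?x + a *\<^sub>R ?y + a *\<^sub>R (c *\<^sub>R ?y - s *\<^sub>R ?x) = (1 - a * s) *\<^sub>R ?x + s *\<^sub>R ?y"
      by (metis (no_types, opaque_lifting) add.assoc add_diff_eq diff_add_eq scaleR_left.add scaleR_left.diff scaleR_one scaleR_right_diff_distrib scaleR_scaleR)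
    then have x: "?x + a *\<^sub>R ?y + a *\<^sub>R (c *\<^sub>R ?y - s *\<^sub>R ?x) = c *\<^sub>R ?x + s *\<^sub>R ?y"
      by (simp add: 1)
    show ?thesis
      using x y by (simp add: f2_def f1_def pair_rotation_def s_def c_def)
  qed
  then have "(\<integral>\<^sup>+p. f (pair_rotation \<theta> p) \<partial>lborel) = (\<integral>\<^sup>+p. f2 p \<partial>lborel)"
    by (simp add: nn_integral_shear_fst)
  also have "\<dots> = (\<integral>\<^sup>+p. f1 p \<partial>lborel)"
    unfolding f2_def by (rule nn_integral_shear_snd) simp
  also have "\<dots> = (\<integral>\<^sup>+p. f p \<partial>lborel)"
    unfolding f1_def by (rule nn_integral_shear_fst) simp
  finally show ?thesis .
qed

lemma distr_pair_rotation:
  assumes \<theta>: "0 \<le> \<theta>" "\<theta> < pi"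
  shows "distr (uniform_measure lborel (ball (0::'a::euclidean_space \<times> 'a) 1)) borel (pair_rotation \<theta>) =
    uniform_measure lborel (ball 0 1)"
proof (rule measure_eqI)
  fix A :: "('a \<times> 'a) set"
  let ?B = "ball (0::'a \<times> 'a) 1"
  assume "A \<in> sets (distr (uniform_measure lborel ?B) borel (pair_rotation \<theta>))"
  then have [measurable]: "A \<in> sets borel" by simp
  have [measurable]: "?B \<inter> A \<in> sets borel" by auto
  have "pair_rotation \<theta> -` A \<in> sets borel"
    using measurable_sets[OF pair_rotation_measurable, of A \<theta>] by simp
  then have [measurable]: "?B \<inter> pair_rotation \<theta> -` A \<in> sets borel" by auto
  have ind: "(indicator (?B \<inter> pair_rotation \<theta> -` A) p :: ennreal) = indicator (?B \<inter> A) (pair_rotation \<theta> p)" for p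
    by (auto simp: indicator_def norm_pair_rotation)
  have "emeasure lborel (?B \<inter> pair_rotation \<theta> -` A) = (\<integral>\<^sup>+p. indicator (?B \<inter> A) (pair_rotation \<theta> p) \<partial>lborel)"
    unfolding ind[symmetric] by (rule nn_integral_indicator[symmetric]) simp
  also have "\<dots> = (\<integral>\<^sup>+p. indicator (?B \<inter> A) p \<partial>lborel)"
    by (rule nn_integral_pair_rotation) (use \<theta> in auto)
  also have "\<dots> = emeasure lborel (?B \<inter> A)"
    by (subst nn_integral_indicator) simp_all
  finally have "emeasure lborel (?B \<inter> pair_rotation \<theta> -` A) = emeasure lborel (?B \<inter> A)" .
  moreover have "emeasure (distr (uniform_measure lborel ?B) borel (pair_rotation \<theta>)) A =
      emeasure (uniform_measure lborel ?B) (pair_rotation \<theta> -` A)"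
    by (subst emeasure_distr) auto
  ultimately show "emeasure (distr (uniform_measure lborel ?B) borel (pair_rotation \<theta>)) A =
      emeasure (uniform_measure lborel ?B) A"
    using \<open>pair_rotation \<theta> -` A \<in> sets borel\<close> by simp
qed simp

lemma integral_pair_rotation:
  fixes G :: "'a::euclidean_space \<times> 'a \<Rightarrow> real"
  assumes [measurable]: "G \<in> borel_measurable borel" and \<theta>: "0 \<le> \<theta>" "\<theta> < pi"
  shows "(\<integral>p. G (pair_rotation \<theta> p) \<partial>uniform_measure lborel (ball 0 1)) =
    (\<integral>p. G p \<partial>uniform_measure lborel (ball 0 1))"
  by (subst (2) distr_pair_rotation[OF \<theta>, symmetric], subst integral_distr) simp_all

subsection \<open>A Poincare inequality on the sphere\<close>

text \<open>The homogeneous extensions used below need not be differentiable at 0. The pairs with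
  vanishing first component lie in a hyperplane, so they can be ignored.\<close>

lemma AE_uniform_ball_fst_nonzero:
  "AE p in uniform_measure lborel (ball (0::'a::euclidean_space \<times> 'a) 1). fst p \<noteq> 0"
proof -
  obtain b :: 'a where "b \<in> Basis" using nonempty_Basis by blast
  then have "(b, 0) \<in> (Basis :: ('a \<times> 'a) set)" by (simp add: Basis_prod_def)
  then have "AE p in lborel. p \<bullet> ((b, 0) :: 'a \<times> 'a) \<noteq> 0" by (rule AE_lborel_inner_neq)
  then show ?thesis
    by (intro AE_uniform_measureI) (auto elim!: eventually_mono simp: inner_prod_def)
qed

lemma AE_uniform_ball: "AE p in uniform_measure lborel (ball (0::'a::euclidean_space) 1). norm p < 1"
  by (intro AE_uniform_measureI) auto

lemma integrable_uniform_ball: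
  fixes g :: "'a::euclidean_space \<Rightarrow> real"
  assumes [measurable]: "g \<in> borel_measurable borel" and "\<And>p. norm p < 1 \<Longrightarrow> \<bar>g p\<bar> \<le> c"
  shows "integrable (uniform_measure lborel (ball (0::'a) 1)) g"
proof -
  interpret prob_space "uniform_measure lborel (ball (0::'a) 1)" by (rule prob_space_uniform_ball)
  show ?thesis
    using AE_uniform_ball by (intro integrable_const_bound[where B = c]) (auto elim!: eventually_mono simp: assms(2))
qed

lemma one_minus_cos_le: "0 \<le> h \<Longrightarrow> 1 - cos h \<le> h" for h :: real
proof -
  assume "0 \<le> h"
  have "1 - cos h = 2 * (\<bar>sin (h / 2)\<bar> * \<bar>sin (h / 2)\<bar>)"
    using cos_double_sin[of "h / 2"] by (simp add: power2_eq_square)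
  also have "\<dots> \<le> 2 * (\<bar>h / 2\<bar> * 1)"
    by (intro mult_left_mono mult_mono abs_sin_x_le_abs_x) auto
  finally show ?thesis using \<open>0 \<le> h\<close> by simp
qed

text \<open>The Maurey--Pisier argument: the rotation from \<open>(x, y)\<close> to \<open>(y, -x)\<close> is cut into many
  small rotations, each of which preserves the uniform distribution of the pair.\<close>

lemma odd_variance_le_gradient:
  fixes F :: "'a::euclidean_space \<Rightarrow> real" and v :: "'a \<Rightarrow> 'a"
  assumes lip: "C-lipschitz_on UNIV F" and odd: "\<And>x. F (- x) = - F x"
    and [measurable]: "v \<in> borel_measurable borel"
    and der: "\<And>x. x \<noteq> 0 \<Longrightarrow> (F has_derivative (\<lambda>h. v x \<bullet> h)) (at x)"
  defines "U \<equiv> uniform_measure lborel (ball (0::'a \<times> 'a) 1)"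
  shows "2 * (\<integral>p. (F (fst p))\<^sup>2 \<partial>U) \<le> (pi / 2)\<^sup>2 * (\<integral>p. (v (fst p) \<bullet> snd p)\<^sup>2 \<partial>U)"
proof -
  interpret prob_space U unfolding U_def by (rule prob_space_uniform_ball)
  have [measurable]: "F \<in> borel_measurable borel"
    using lip lipschitz_on_continuous_on by (blast intro: borel_measurable_continuous_onI)
  have fst_b [measurable]: "(fst :: 'a \<times> 'a \<Rightarrow> 'a) \<in> borel_measurable borel"
    and snd_b [measurable]: "(snd :: 'a \<times> 'a \<Rightarrow> 'a) \<in> borel_measurable borel"
    by (intro borel_measurable_continuous_onI continuous_intros)+
  have [measurable_cong]: "sets U = sets borel" by (simp add: U_def)
  have "C \<ge> 0" using lip by (rule lipschitz_on_nonneg)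
  have Fd: "\<bar>F x - F y\<bar> \<le> C * norm (x - y)" for x y
    using lipschitz_onD[OF lip, of x y] by (simp add: dist_norm dist_real_def)
  have F0: "F 0 = 0" using odd[of 0] by simp
  have Fb: "\<bar>F x\<bar> \<le> C" if "norm x < 1" for x
    using Fd[of x 0] F0 that mult_left_le[of "norm x" C] \<open>C \<ge> 0\<close> by simp
  have nfst: "norm (fst p) < 1" and nsnd: "norm (snd p) < 1" if "norm p < 1" for p :: "'a \<times> 'a"
    using norm_fst_le[of "fst p" "snd p"] norm_snd_le[of "snd p" "fst p"] that by auto
  have ball_int: "integrable U g" if "g \<in> borel_measurable borel" "\<And>p. norm p < 1 \<Longrightarrow> \<bar>g p\<bar> \<le> c"
    for g :: "'a \<times> 'a \<Rightarrow> real" and c :: real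
    unfolding U_def using that by (rule integrable_uniform_ball)
  have rot: "(\<integral>p. G (pair_rotation \<theta> p) \<partial>U) = (\<integral>p. G p \<partial>U)"
    if "G \<in> borel_measurable borel" "0 \<le> \<theta>" "\<theta> < pi" for G :: "'a \<times> 'a \<Rightarrow> real" and \<theta>
    unfolding U_def using that by (rule integral_pair_rotation)
  have quarter: "pair_rotation (pi / 2) p = (snd p, - fst p)" for p :: "'a \<times> 'a"
    by (simp add: pair_rotation_def)
  have swap: "(\<integral>p. (F (snd p))\<^sup>2 \<partial>U) = (\<integral>p. (F (fst p))\<^sup>2 \<partial>U)"
    using rot[of "\<lambda>p. (F (fst p))\<^sup>2" "pi / 2"] by (simp add: quarter)
  \<comment> \<open>The components are not independent under the uniform law on the ball, but the
    quarter turn sends \<open>F (fst p) * F (snd p)\<close> to its negative because \<open>F\<close>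
    is odd; so the correlation vanishes all the same.\<close>
  have "(\<integral>p. F (snd p) * F (- fst p) \<partial>U) = (\<integral>p. F (fst p) * F (snd p) \<partial>U)"
    using rot[of "\<lambda>p. F (fst p) * F (snd p)" "pi / 2"] by (simp add: quarter)
  then have cross: "(\<integral>p. F (fst p) * F (snd p) \<partial>U) = 0"
    by (simp add: odd mult.commute)
  have i1: "integrable U (\<lambda>p. (F (fst p))\<^sup>2)" "integrable U (\<lambda>p. (F (snd p))\<^sup>2)"
    using Fb nfst nsnd abs_le_square_iff[of _ C] \<open>C \<ge> 0\<close>
    by (auto intro!: ball_int[of _ "C\<^sup>2"])
  have i2: "integrable U (\<lambda>p. F (fst p) * F (snd p))"
    using Fb nfst nsnd \<open>C \<ge> 0\<close> by (intro ball_int[of _ "C * C"]) (auto simp: abs_mult intro!: mult_mono)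
  have "(\<integral>p. (F (fst p) - F (snd p))\<^sup>2 \<partial>U) =
      (\<integral>p. (F (fst p))\<^sup>2 + (F (snd p))\<^sup>2 - 2 * (F (fst p) * F (snd p)) \<partial>U)"
    by (simp add: power2_diff mult.assoc)
  also have "\<dots> = 2 * (\<integral>p. (F (fst p))\<^sup>2 \<partial>U)"
    using i1 i2 by (simp add: swap cross)
  finally have lhs: "(\<integral>p. (F (fst p) - F (snd p))\<^sup>2 \<partial>U) = 2 * (\<integral>p. (F (fst p))\<^sup>2 \<partial>U)" .

  \<comment> \<open>\<open>Suc m\<close> equal steps make up the quarter turn; \<open>S m\<close>
    below is the increment of \<open>F\<close> over one step, multiplied by the number of
    steps.\<close>
  define h where "h m = pi / 2 / real (Suc m)" for m
  have h: "0 < h m" "h m < pi" for m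
    by (auto simp: h_def divide_simps)
  have total: "real (Suc m) * h m = pi / 2" for m
    by (simp add: h_def del: of_nat_Suc)
  define S where "S m p = real (Suc m) * (F (fst (pair_rotation (h m) p)) - F (fst p))" for m p
  have [measurable]: "S m \<in> borel_measurable borel" for m
    unfolding S_def by measurable
  \<comment> \<open>Both \<open>1 - cos (h m)\<close> and \<open>sin (h m)\<close> are at most
    \<open>h m\<close>, so one step moves the first component by at most \<open>2 * h m\<close>;
    multiplied by \<open>Suc m\<close> this is \<open>pi\<close>, uniformly in
    \<open>m\<close>.\<close>
  have S_bound: "\<bar>S m p\<bar> \<le> C * pi" if "norm p < 1" for m p
  proof -
    have small: "\<bar>cos (h m) - 1\<bar> \<le> h m" "\<bar>sin (h m)\<bar> \<le> h m"
      using one_minus_cos_le[of "h m"] cos_le_one[of "h m"] abs_sin_x_le_abs_x[of "h m"] h[of m] by linarith+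
    have "fst (pair_rotation (h m) p) - fst p = (cos (h m) - 1) *\<^sub>R fst p + sin (h m) *\<^sub>R snd p"
      by (simp add: pair_rotation_def algebra_simps)
    then have "norm (fst (pair_rotation (h m) p) - fst p) \<le> \<bar>cos (h m) - 1\<bar> * norm (fst p) + \<bar>sin (h m)\<bar> * norm (snd p)"
      by (metis norm_scaleR norm_triangle_ineq)
    also have "\<dots> \<le> h m * 1 + h m * 1"
      using small nfst[OF that] nsnd[OF that] h[of m] by (intro add_mono mult_mono) auto
    finally have "\<bar>F (fst (pair_rotation (h m) p)) - F (fst p)\<bar> \<le> C * (2 * h m)"
      using Fd[of "fst (pair_rotation (h m) p)" "fst p"] mult_left_mono[OF _ \<open>C \<ge> 0\<close>] by fastforce
    then have "\<bar>S m p\<bar> \<le> real (Suc m) * (C * (2 * h m))"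
      unfolding S_def abs_mult by (intro mult_mono) auto
    also have "\<dots> = 2 * C * (real (Suc m) * h m)" by (simp only: mult_ac)
    also have "\<dots> = C * pi" by (simp only: total)
    finally show ?thesis .
  qed
  \<comment> \<open>Telescoping and Cauchy-Schwarz bound the square of
    \<open>F (fst p) - F (snd p)\<close> by the mean of the squared rescaled increments along the
    path; rotation invariance gives all of these the same integral.\<close>
  have steps: "2 * (\<integral>p. (F (fst p))\<^sup>2 \<partial>U) \<le> (\<integral>p. (S m p)\<^sup>2 \<partial>U)" for m
  proof -
    define R where "R j p = pair_rotation (real j * h m) p" for j and p :: "'a \<times> 'a"
    have hj: "0 \<le> real j * h m" "real j * h m < pi" if "j < Suc m" for j
    proof -
      have "real j * h m \<le> real (Suc m) * h m" using that h[of m] by (intro mult_right_mono) auto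
      also have "\<dots> = pi / 2" by (rule total)
      finally show "real j * h m < pi" using pi_gt_zero by linarith
    qed (use h[of m] in auto)
    have tele: "F (snd p) - F (fst p) = (\<Sum>j<Suc m. S m (R j p)) / real (Suc m)" for p
    proof -
      have "pair_rotation (h m) (R j p) = R (Suc j) p" for j
        by (simp add: R_def pair_rotation_add algebra_simps)
      then have "S m (R j p) / real (Suc m) = F (fst (R (Suc j) p)) - F (fst (R j p))" for j
        by (simp add: S_def del: of_nat_Suc)
      then have "(\<Sum>j<Suc m. S m (R j p)) / real (Suc m) = F (fst (R (Suc m) p)) - F (fst (R 0 p))"
        unfolding sum_divide_distrib using sum_lessThan_telescope[of "\<lambda>j. F (fst (R j p))" "Suc m"] by simp
      moreover have "R 0 p = p" by (simp add: R_def pair_rotation_def)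
      moreover have "R (Suc m) p = (snd p, - fst p)"
        unfolding R_def quarter[symmetric] total ..
      ultimately show ?thesis by simp
    qed
    have "(F (fst p) - F (snd p))\<^sup>2 \<le> (\<Sum>j<Suc m. (S m (R j p))\<^sup>2) / real (Suc m)" for p
    proof -
      have "(\<Sum>j<Suc m. S m (R j p))\<^sup>2 \<le> real (Suc m) * (\<Sum>j<Suc m. (S m (R j p))\<^sup>2)"
        using sum_squared_le_sum_of_squares[of "\<lambda>j. S m (R j p)" "{..<Suc m}"]
        by (simp add: mult.commute del: sum.lessThan_Suc)
      then have "((\<Sum>j<Suc m. S m (R j p)) / real (Suc m))\<^sup>2 \<le>
          real (Suc m) * (\<Sum>j<Suc m. (S m (R j p))\<^sup>2) / (real (Suc m))\<^sup>2"
        unfolding power_divide by (rule divide_right_mono) simp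
      also have "\<dots> = (\<Sum>j<Suc m. (S m (R j p))\<^sup>2) / real (Suc m)"
        by (simp add: power2_eq_square del: sum.lessThan_Suc of_nat_Suc)
      finally have "((\<Sum>j<Suc m. S m (R j p)) / real (Suc m))\<^sup>2 \<le> (\<Sum>j<Suc m. (S m (R j p))\<^sup>2) / real (Suc m)" .
      then show ?thesis by (simp only: tele[symmetric] power2_commute[of "F (fst p)"])
    qed
    moreover have iR: "integrable U (\<lambda>p. (S m (R j p))\<^sup>2)" for j
      using S_bound \<open>C \<ge> 0\<close> abs_le_square_iff[of _ "C * pi"] unfolding R_def
      by (intro ball_int[of _ "(C * pi)\<^sup>2"]) (auto simp: norm_pair_rotation)
    ultimately have "(\<integral>p. (F (fst p) - F (snd p))\<^sup>2 \<partial>U) \<le> (\<integral>p. (\<Sum>j<Suc m. (S m (R j p))\<^sup>2) / real (Suc m) \<partial>U)"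
      using i1 i2 by (intro integral_mono) (auto simp: power2_diff mult.assoc simp del: sum.lessThan_Suc)
    also have "\<dots> = (\<Sum>j<Suc m. (\<integral>p. (S m (R j p))\<^sup>2 \<partial>U)) / real (Suc m)"
      using iR by (simp del: sum.lessThan_Suc)
    also have "(\<Sum>j<Suc m. (\<integral>p. (S m (R j p))\<^sup>2 \<partial>U)) = (\<Sum>j<Suc m. (\<integral>p. (S m p)\<^sup>2 \<partial>U))"
      unfolding R_def using hj by (intro sum.cong refl rot[of "\<lambda>p. (S m p)\<^sup>2"]) auto
    finally show ?thesis unfolding lhs by simp
  qed
  \<comment> \<open>The increment divided by \<open>h m\<close> tends to the derivative of
    \<open>F\<close> along the rotation at angle 0, and \<open>Suc m * h m = pi / 2\<close> supplies
    the factor in front.\<close>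
  have "(\<lambda>m. \<integral>p. (S m p)\<^sup>2 \<partial>U) \<longlonglongrightarrow> (\<integral>p. (pi / 2 * (v (fst p) \<bullet> snd p))\<^sup>2 \<partial>U)"
  proof (rule integral_dominated_convergence[where w = "\<lambda>p. (C * pi)\<^sup>2"])
    show "AE p in U. (\<lambda>m. (S m p)\<^sup>2) \<longlonglongrightarrow> (pi / 2 * (v (fst p) \<bullet> snd p))\<^sup>2"
      using AE_uniform_ball_fst_nonzero unfolding U_def
    proof eventually_elim
      case (elim p)
      have "((\<lambda>t. fst (pair_rotation t p)) has_derivative (\<lambda>t. t *\<^sub>R snd p)) (at 0)"
        unfolding pair_rotation_def by (auto intro!: derivative_eq_intros)
      moreover have "(F has_derivative (\<lambda>h. v (fst p) \<bullet> h)) (at (fst (pair_rotation 0 p)))"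
        using der[OF elim] by (simp add: pair_rotation_def)
      ultimately have "((\<lambda>t. F (fst (pair_rotation t p))) has_derivative (\<lambda>t. v (fst p) \<bullet> (t *\<^sub>R snd p))) (at 0)"
        by (rule has_derivative_compose)
      then have "((\<lambda>t. F (fst (pair_rotation t p))) has_real_derivative (v (fst p) \<bullet> snd p)) (at 0)"
        by (simp add: has_field_derivative_def mult_commute_abs)
      then have lim: "((\<lambda>t. (F (fst (pair_rotation t p)) - F (fst p)) / t) \<longlongrightarrow> v (fst p) \<bullet> snd p) (at 0)"
        by (simp add: has_field_derivative_iff pair_rotation_def)
      have "h \<longlonglongrightarrow> 0" unfolding h_def
        using tendsto_mult_right_zero[OF LIMSEQ_Suc[OF lim_1_over_n[where 'a=real]], of "pi / 2"] by simp
      then have "filterlim h (at 0) sequentially"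
        using h(1) by (intro filterlim_atI) (auto simp: less_imp_neq[symmetric])
      from filterlim_compose[OF lim this]
      have "(\<lambda>m. pi / 2 * ((F (fst (pair_rotation (h m) p)) - F (fst p)) / h m)) \<longlonglongrightarrow> pi / 2 * (v (fst p) \<bullet> snd p)"
        by (intro tendsto_intros)
      moreover have "pi / 2 * ((F (fst (pair_rotation (h m) p)) - F (fst p)) / h m) = S m p" for m
        unfolding S_def h_def by (simp add: field_simps)
      ultimately show ?case by (auto intro: tendsto_power)
    qed
    show "AE p in U. norm ((S m p)\<^sup>2) \<le> (C * pi)\<^sup>2" for m
      using AE_uniform_ball unfolding U_def
    proof eventually_elim
      case (elim p)
      then show ?case using S_bound[of p m] \<open>C \<ge> 0\<close> abs_le_square_iff[of "S m p" "C * pi"] by simp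
    qed
    have "(\<lambda>p. v (fst p) \<bullet> snd p) \<in> borel_measurable borel"
      using measurable_compose[OF fst_b \<open>v \<in> borel_measurable borel\<close>] snd_b by (rule borel_measurable_inner)
    then show "(\<lambda>p. (pi / 2 * (v (fst p) \<bullet> snd p))\<^sup>2) \<in> borel_measurable U"
      by measurable
  qed simp_all
  then have "2 * (\<integral>p. (F (fst p))\<^sup>2 \<partial>U) \<le> (\<integral>p. (pi / 2 * (v (fst p) \<bullet> snd p))\<^sup>2 \<partial>U)"
    by (rule LIMSEQ_le_const) (use steps in blast)
  then show ?thesis by (simp only: power_mult_distrib integral_mult_right_zero)
qed

text \<open>With the second component fixed, the integrand over the ball is a function of the norm
  of the first component times a function of its direction, so \<open>nn_integral_radial\<close>
  applies. The weight \<open>(norm (fst p))\<^sup>2\<close> is what squaring a function homogeneous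
  of degree one produces.\<close>

lemma nn_integral_uniform_ball_pair_fst:
  fixes g :: "'a::euclidean_space \<Rightarrow> ennreal"
  assumes [measurable]: "g \<in> borel_measurable borel" and fin: "(\<integral>\<^sup>+e. g e \<partial>uniform_sphere) \<noteq> \<infinity>"
  defines "U \<equiv> uniform_measure lborel (ball (0::'a \<times> 'a) 1)"
  shows "(\<integral>\<^sup>+p. ennreal ((norm (fst p))\<^sup>2) * g (sgn (fst p)) \<partial>U) =
    (\<integral>\<^sup>+p. ennreal ((norm (fst p))\<^sup>2) \<partial>U) * (\<integral>\<^sup>+e. g e \<partial>uniform_sphere)"
proof -
  have [measurable]: "(fst :: 'a \<times> 'a \<Rightarrow> 'a) \<in> borel_measurable borel"
    by (intro borel_measurable_continuous_onI continuous_intros)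
  define \<rho> where "\<rho> s r = ennreal (r\<^sup>2) * indicator {..<1} (r\<^sup>2 + s\<^sup>2)" for s r :: real
  have rho [measurable]: "(\<lambda>p. \<rho> (fst p) (snd p)) \<in> borel_measurable (borel \<Otimes>\<^sub>M borel)"
    unfolding \<rho>_def by measurable
  have rho' [measurable]: "\<rho> s \<in> borel_measurable borel" for s
    unfolding \<rho>_def by measurable
  have [measurable]: "(\<lambda>p. \<rho> (norm (snd p)) (norm (fst p)) * h (sgn (fst p))) \<in> borel_measurable (borel \<Otimes>\<^sub>M borel)"
    if [measurable]: "h \<in> borel_measurable borel" for h :: "'a \<Rightarrow> ennreal"
    unfolding \<rho>_def by measurable
  have red: "(\<integral>\<^sup>+p. ennreal ((norm (fst p))\<^sup>2) * h (sgn (fst p)) * indicator (ball 0 1) p \<partial>(lborel :: ('a \<times> 'a) measure)) =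
      (\<integral>\<^sup>+y. \<integral>\<^sup>+x. \<rho> (norm (y::'a)) (norm x) * h (sgn x) \<partial>lborel \<partial>lborel)"
    if [measurable]: "h \<in> borel_measurable borel" for h :: "'a \<Rightarrow> ennreal"
  proof -
    have "ennreal ((norm (fst p))\<^sup>2) * h (sgn (fst p)) * indicator (ball 0 1) p =
        \<rho> (norm (snd p)) (norm (fst p)) * h (sgn (fst p))" for p :: "'a \<times> 'a"
      by (auto simp: \<rho>_def indicator_def norm_prod_def real_sqrt_lt_1_iff)
    then have "(\<integral>\<^sup>+p. ennreal ((norm (fst p))\<^sup>2) * h (sgn (fst p)) * indicator (ball 0 1) p \<partial>(lborel :: ('a \<times> 'a) measure)) =
        (\<integral>\<^sup>+p. \<rho> (norm (snd p)) (norm (fst p)) * h (sgn (fst p)) \<partial>((lborel :: 'a measure) \<Otimes>\<^sub>M (lborel :: 'a measure)))"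
      by (simp only: lborel_prod)
    also have "\<dots> = (\<integral>\<^sup>+y. \<integral>\<^sup>+x. \<rho> (norm (y::'a)) (norm x) * h (sgn x) \<partial>lborel \<partial>lborel)"
      by (subst lborel_pair.nn_integral_snd[symmetric]) simp_all
    finally show ?thesis .
  qed
  have "(\<integral>\<^sup>+y. \<integral>\<^sup>+x. \<rho> (norm (y::'a)) (norm x) * g (sgn x) \<partial>lborel \<partial>lborel) =
      (\<integral>\<^sup>+y. (\<integral>\<^sup>+x. \<rho> (norm (y::'a)) (norm (x::'a)) \<partial>lborel) * (\<integral>\<^sup>+e. g e \<partial>uniform_sphere) \<partial>lborel)"
    by (intro nn_integral_cong nn_integral_radial) (use fin in auto)
  also have "\<dots> = (\<integral>\<^sup>+y. (\<integral>\<^sup>+x. \<rho> (norm (y::'a)) (norm (x::'a)) \<partial>lborel) \<partial>lborel) * (\<integral>\<^sup>+e. g e \<partial>uniform_sphere)"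
    by (rule nn_integral_multc) (unfold \<rho>_def, measurable)
  finally show ?thesis
    using red[of g] red[of "\<lambda>_. 1"]
    by (simp add: U_def nn_integral_uniform_measure ennreal_times_divide divide_ennreal_def mult_ac)
qed

text \<open>With the first component fixed, the second has a uniform direction that separates from
  its norm, so the mean square of its direction against \<open>v x\<close> is
  \<open>(norm (v x))\<^sup>2\<close> divided by the dimension.\<close>

lemma nn_integral_uniform_ball_pair_inner:
  fixes v :: "'a::euclidean_space \<Rightarrow> 'a"
  assumes [measurable]: "v \<in> borel_measurable borel" and bound: "\<And>x. (norm (v x))\<^sup>2 \<le> K"
  defines "U \<equiv> uniform_measure lborel (ball (0::'a \<times> 'a) 1)"
  shows "(\<integral>\<^sup>+p. ennreal ((v (fst p) \<bullet> snd p)\<^sup>2) \<partial>U) \<le>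
    ennreal (K / DIM('a)) * (\<integral>\<^sup>+p. ennreal ((norm (snd p))\<^sup>2) \<partial>U)"
proof -
  have [measurable]: "(fst :: 'a \<times> 'a \<Rightarrow> 'a) \<in> borel_measurable borel" "(snd :: 'a \<times> 'a \<Rightarrow> 'a) \<in> borel_measurable borel"
    by (intro borel_measurable_continuous_onI continuous_intros)+
  define \<rho> where "\<rho> s r = ennreal (r\<^sup>2) * indicator {..<1} (s\<^sup>2 + r\<^sup>2)" for s r :: real
  have rho' [measurable]: "\<rho> s \<in> borel_measurable borel" for s
    unfolding \<rho>_def by measurable
  have ind: "ennreal ((norm (snd p))\<^sup>2) * indicator (ball 0 1) p = \<rho> (norm (fst p)) (norm (snd p))" for p :: "'a \<times> 'a"
    by (auto simp: \<rho>_def indicator_def norm_prod_def real_sqrt_lt_1_iff)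
  have sq: "ennreal ((v (fst p) \<bullet> snd p)\<^sup>2) = ennreal ((norm (snd p))\<^sup>2) * ennreal ((sgn (snd p) \<bullet> v (fst p))\<^sup>2)" for p :: "'a \<times> 'a"
    by (cases "snd p = 0")
      (simp_all add: ennreal_mult[symmetric] power_mult_distrib[symmetric] sgn_div_norm inner_commute
        mult.assoc[symmetric])
  have m1: "(\<lambda>p. \<rho> (norm (fst p)) (norm (snd p)) * ennreal ((sgn (snd p) \<bullet> v (fst p))\<^sup>2)) \<in>
      borel_measurable ((borel :: 'a measure) \<Otimes>\<^sub>M (borel :: 'a measure))"
    unfolding \<rho>_def by measurable
  have m2: "(\<lambda>p. \<rho> (norm (fst p)) (norm (snd p))) \<in> borel_measurable ((borel :: 'a measure) \<Otimes>\<^sub>M (borel :: 'a measure))"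
    unfolding \<rho>_def by measurable
  have "(\<integral>\<^sup>+p. ennreal ((v (fst p) \<bullet> snd p)\<^sup>2) * indicator (ball 0 1) p \<partial>lborel) =
      (\<integral>\<^sup>+p. \<rho> (norm (fst p)) (norm (snd p)) * ennreal ((sgn (snd p) \<bullet> v (fst p))\<^sup>2) \<partial>(lborel \<Otimes>\<^sub>M lborel))"
    unfolding sq lborel_prod by (intro nn_integral_cong) (simp add: ind[symmetric] mult_ac)
  also have "\<dots> = (\<integral>\<^sup>+x. \<integral>\<^sup>+y. \<rho> (norm x) (norm y) * ennreal ((sgn y \<bullet> v x)\<^sup>2) \<partial>lborel \<partial>lborel)"
    by (subst lborel.nn_integral_fst[symmetric]) (use m1 in simp_all)
  also have "\<dots> = (\<integral>\<^sup>+x. (\<integral>\<^sup>+y. \<rho> (norm x) (norm (y::'a)) \<partial>lborel) * ennreal ((norm (v x))\<^sup>2 / DIM('a)) \<partial>lborel)"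
    by (intro nn_integral_cong)
      (simp add: nn_integral_radial[of "\<lambda>e. ennreal ((e \<bullet> v _)\<^sup>2)"] nn_integral_inner_uniform_sphere)
  also have "\<dots> \<le> (\<integral>\<^sup>+x. (\<integral>\<^sup>+y. \<rho> (norm (x::'a)) (norm (y::'a)) \<partial>lborel) * ennreal (K / DIM('a)) \<partial>lborel)"
    by (intro nn_integral_mono mult_left_mono ennreal_leI divide_right_mono bound) auto
  also have "\<dots> = (\<integral>\<^sup>+x. \<integral>\<^sup>+y. \<rho> (norm (x::'a)) (norm (y::'a)) \<partial>lborel \<partial>lborel) * ennreal (K / DIM('a))"
    by (rule nn_integral_multc) (unfold \<rho>_def, measurable)
  also have "(\<integral>\<^sup>+x. \<integral>\<^sup>+y. \<rho> (norm (x::'a)) (norm (y::'a)) \<partial>lborel \<partial>lborel) =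
      (\<integral>\<^sup>+p. \<rho> (norm (fst p)) (norm (snd p)) \<partial>((lborel :: 'a measure) \<Otimes>\<^sub>M (lborel :: 'a measure)))"
    by (subst lborel.nn_integral_fst[symmetric]) (use m2 in simp_all)
  also have "\<dots> = (\<integral>\<^sup>+p. ennreal ((norm (snd p))\<^sup>2) * indicator (ball (0 :: 'a \<times> 'a) 1) p \<partial>lborel)"
    by (simp add: ind lborel_prod)
  finally have "(\<integral>\<^sup>+p. ennreal ((v (fst p) \<bullet> snd p)\<^sup>2) * indicator (ball 0 1) p \<partial>lborel) \<le>
    (\<integral>\<^sup>+p. ennreal ((norm (snd p))\<^sup>2) * indicator (ball (0 :: 'a \<times> 'a) 1) p \<partial>lborel) * ennreal (K / DIM('a))" .
  from divide_right_mono_ennreal[OF this, of "emeasure lborel (ball (0 :: 'a \<times> 'a) 1)"] show ?thesis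
    unfolding U_def by (simp add: nn_integral_uniform_measure ennreal_times_divide mult.commute[of "ennreal (K / _)"])
qed

text \<open>Apply the rotation inequality to the extension \<open>norm x * f (sgn x)\<close>. Its
  squared gradient is at most \<open>2 * L\<^sup>2\<close>: the tangential part is bounded by
  \<open>L\<close>, and the radial part is \<open>f\<close> itself, which oddness bounds by
  \<open>L\<close> too. This 2 cancels the 2 on the left of \<open>odd_variance_le_gradient\<close>.
  Both sides carry the same positive factor \<open>m\<close>, the mean squared norm of either
  component of the pair, so it cancels as well.\<close>

theorem sphere_poincare_odd:
  fixes f :: "'a::euclidean_space \<Rightarrow> real" and G :: "'a \<Rightarrow> 'a"
  assumes [measurable]: "f \<in> borel_measurable borel"
    and odd: "\<And>e. norm e = 1 \<Longrightarrow> f (- e) = - f e"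
    and lip: "L-lipschitz_on (sphere 0 1) f"
    and der: "\<And>e. norm e = 1 \<Longrightarrow> (f has_derivative (\<lambda>h. G e \<bullet> h)) (at e)"
    and G: "continuous_on (sphere 0 1) G" "\<And>e. norm e = 1 \<Longrightarrow> norm (G e) \<le> L"
  shows "(\<integral>e. (f e)\<^sup>2 \<partial>uniform_sphere) \<le> (pi / 2)\<^sup>2 * L\<^sup>2 / DIM('a)"
proof -
  define U where "U = uniform_measure lborel (ball (0::'a \<times> 'a) 1)"
  interpret prob_space U unfolding U_def by (rule prob_space_uniform_ball)
  interpret S: prob_space "uniform_sphere :: 'a measure" by (rule prob_space_uniform_sphere)
  have [measurable_cong]: "sets U = sets borel" by (simp add: U_def)
  have [measurable]: "(fst :: 'a \<times> 'a \<Rightarrow> 'a) \<in> borel_measurable borel" "(snd :: 'a \<times> 'a \<Rightarrow> 'a) \<in> borel_measurable borel"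
    by (intro borel_measurable_continuous_onI continuous_intros)+
  have "L \<ge> 0" using lip by (rule lipschitz_on_nonneg)
  have fd: "\<bar>f x - f y\<bar> \<le> L * norm (x - y)" if "norm x = 1" "norm y = 1" for x y
    using lipschitz_onD[OF lip, of x y] that by (simp add: dist_norm dist_real_def)
  \<comment> \<open>Antipodal points are at distance 2 and \<open>f e - f (- e) = 2 * f e\<close>,
    so the Lipschitz constant already bounds \<open>f\<close>.\<close>
  have fL: "\<bar>f e\<bar> \<le> L" if "norm e = 1" for e
  proof -
    have "norm (e - - e) = 2" using that by (simp flip: scaleR_2)
    then show ?thesis using fd[of e "- e"] odd[OF that] that by simp
  qed
  have f2: "(f e)\<^sup>2 \<le> L\<^sup>2" if "norm e = 1" for e
    using fL[OF that] \<open>L \<ge> 0\<close> abs_le_square_iff[of "f e" L] by simp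
  have nsgn: "norm (sgn x) = 1" if "x \<noteq> 0" for x :: 'a using that by (simp add: norm_sgn)
  have decomp: "norm x *\<^sub>R sgn x = x" for x :: 'a by (cases "x = 0") (simp_all add: sgn_div_norm)
  define F where "F x = norm x * f (sgn x)" for x
  \<comment> \<open>The gradient of \<open>F\<close> away from 0: the radial component
    \<open>f (sgn x)\<close> plus the tangential part of \<open>G (sgn x)\<close>. The value at 0 is
    a default that respects the norm bound.\<close>
  define v where "v x = (if x = 0 then 0 else
    f (sgn x) *\<^sub>R sgn x + (G (sgn x) - (G (sgn x) \<bullet> sgn x) *\<^sub>R sgn x))" for x
  have v_bound: "(norm (v x))\<^sup>2 \<le> 2 * L\<^sup>2" for x
  proof (cases "x = 0")
    case False
    define s where "s = sgn x"
    have s: "s \<bullet> s = 1" "norm s = 1" using nsgn[OF False] by (simp_all add: s_def dot_square_norm)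
    have "(norm (v x))\<^sup>2 = (f s)\<^sup>2 + (norm (G s))\<^sup>2 - (G s \<bullet> s)\<^sup>2"
      using False s(1) unfolding v_def s_def[symmetric] power2_norm_eq_inner
      by (simp add: inner_add_left inner_add_right inner_diff_left inner_diff_right
        inner_commute power2_eq_square)
    also have "\<dots> \<le> L\<^sup>2 + L\<^sup>2 - 0"
      using G(2)[OF s(2)] f2[OF s(2)] by (intro diff_mono add_mono f2[OF s(2)] power_mono) auto
    finally show ?thesis by simp
  qed (simp add: v_def)
  have cont_sgn: "continuous_on (- {0}) (\<lambda>x. h (sgn x))" if "continuous_on (sphere 0 1) h"
    for h :: "'a \<Rightarrow> 'b::topological_space"
    by (rule continuous_on_compose2[OF that]) (auto intro!: continuous_intros simp: norm_sgn split: if_splits)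
  have "continuous_on (- {0}) v"
  proof -
    have "continuous_on (- {0}) (\<lambda>x. f (sgn x) *\<^sub>R sgn x + (G (sgn x) - (G (sgn x) \<bullet> sgn x) *\<^sub>R sgn x))"
      by (intro continuous_intros cont_sgn G lipschitz_on_continuous_on[OF lip]) auto
    then show ?thesis by (rule continuous_on_eq) (auto simp: v_def)
  qed
  then have [measurable]: "v \<in> borel_measurable borel"
    by (intro borel_measurable_continuous_countable_exceptions[of "{0}"]) auto
  \<comment> \<open>A crude constant: it serves for continuity and domination and does not enter the
    final bound.\<close>
  have lipF: "(3 * L)-lipschitz_on UNIV F"
  proof (rule lipschitz_onI)
    fix x y :: 'a
    have "\<bar>F x - F y\<bar> \<le> 3 * L * norm (x - y)"
    proof (cases "x = 0 \<or> y = 0")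
      case True
      have "\<bar>F z\<bar> \<le> L * norm z" for z
        using fL[OF nsgn, of z] by (cases "z = 0") (simp_all add: F_def abs_mult mult.commute mult_left_mono)
      moreover have "L * norm z \<le> 3 * L * norm z" for z :: 'a
        using \<open>L \<ge> 0\<close> by (intro mult_right_mono) auto
      ultimately have "\<bar>F z\<bar> \<le> 3 * L * norm z" for z
        by (rule order_trans)
      moreover have "F 0 = 0" by (simp add: F_def)
      ultimately show ?thesis
        using True by auto
    next
      case False
      have "norm (norm y *\<^sub>R (sgn x - sgn y)) = norm ((norm y - norm x) *\<^sub>R sgn x + (x - y))"
        using decomp[of x] decomp[of y] by (simp add: algebra_simps)
      also have "\<dots> \<le> \<bar>norm y - norm x\<bar> + norm (x - y)"
        using norm_triangle_ineq[of "(norm y - norm x) *\<^sub>R sgn x" "x - y"] False by (simp add: nsgn)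
      also have "\<dots> \<le> 2 * norm (x - y)"
        using norm_triangle_ineq3[of y x] by (simp add: norm_minus_commute)
      finally have *: "norm y * norm (sgn x - sgn y) \<le> 2 * norm (x - y)" by simp
      have "F x - F y = (norm x - norm y) * f (sgn x) + norm y * (f (sgn x) - f (sgn y))"
        by (simp add: F_def algebra_simps)
      then have "\<bar>F x - F y\<bar> \<le> \<bar>norm x - norm y\<bar> * \<bar>f (sgn x)\<bar> + norm y * \<bar>f (sgn x) - f (sgn y)\<bar>"
        by (metis abs_mult abs_norm_cancel abs_triangle_ineq)
      also have "\<dots> \<le> norm (x - y) * L + norm y * (L * norm (sgn x - sgn y))"
        using False \<open>L \<ge> 0\<close> by (intro add_mono mult_mono fL fd nsgn norm_triangle_ineq3) auto
      also have "\<dots> \<le> norm (x - y) * L + L * (2 * norm (x - y))"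
        using mult_left_mono[OF * \<open>L \<ge> 0\<close>] by (simp add: mult_ac)
      finally show ?thesis by (simp add: algebra_simps)
    qed
    then show "dist (F x) (F y) \<le> 3 * L * dist x y" by (simp add: dist_norm dist_real_def)
  qed (use \<open>L \<ge> 0\<close> in auto)
  have oddF: "F (- x) = - F x" for x
    using odd[OF nsgn, of x] by (cases "x = 0") (auto simp: F_def sgn_minus)
  have derF: "(F has_derivative (\<lambda>h. v x \<bullet> h)) (at x)" if "x \<noteq> 0" for x
  proof -
    define s where "s = sgn x"
    have s: "norm s = 1" using nsgn[OF that] by (simp add: s_def)
    have xs: "x = norm x *\<^sub>R s" using decomp[of x] by (simp add: s_def)
    have dn: "(norm has_derivative (\<lambda>h. h \<bullet> s)) (at x)"
      using has_derivative_norm[OF that] by (simp add: s_def)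
    have di: "((\<lambda>y. inverse (norm y)) has_derivative (\<lambda>h. - (inverse (norm x) * (h \<bullet> s) * inverse (norm x)))) (at x)"
      using Deriv.has_derivative_inverse[OF _ dn] that by simp
    have ds: "((\<lambda>y. inverse (norm y) *\<^sub>R y) has_derivative
        (\<lambda>h. inverse (norm x) *\<^sub>R h + (- (inverse (norm x) * (h \<bullet> s) * inverse (norm x))) *\<^sub>R x)) (at x)"
      by (rule has_derivative_scaleR[OF di has_derivative_ident])
    have "(f has_derivative (\<lambda>h. G s \<bullet> h)) (at (inverse (norm x) *\<^sub>R x))"
      using der[OF s] by (simp add: s_def sgn_div_norm)
    from has_derivative_mult[OF dn has_derivative_compose[OF ds this]]
    have "((\<lambda>y. norm y * f (inverse (norm y) *\<^sub>R y)) has_derivative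
      (\<lambda>h. norm x * (G s \<bullet> (inverse (norm x) *\<^sub>R h + (- (inverse (norm x) * (h \<bullet> s) * inverse (norm x))) *\<^sub>R x)) +
        (h \<bullet> s) * f (inverse (norm x) *\<^sub>R x))) (at x)" .
    moreover have "norm x * (G s \<bullet> (inverse (norm x) *\<^sub>R h + (- (inverse (norm x) * (h \<bullet> s) * inverse (norm x))) *\<^sub>R x)) +
        (h \<bullet> s) * f (inverse (norm x) *\<^sub>R x) = v x \<bullet> h" for h
    proof -
      have "(inverse (norm x) * (h \<bullet> s) * inverse (norm x)) *\<^sub>R x = (inverse (norm x) * (h \<bullet> s)) *\<^sub>R s"
        using that by (subst (3) xs) simp
      then have "norm x * (G s \<bullet> (inverse (norm x) *\<^sub>R h + (- (inverse (norm x) * (h \<bullet> s) * inverse (norm x))) *\<^sub>R x)) =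
          G s \<bullet> h - (h \<bullet> s) * (G s \<bullet> s)"
        using that by (simp add: inner_diff_right right_diff_distrib mult.assoc[symmetric])
      moreover have "inverse (norm x) *\<^sub>R x = s" by (simp add: s_def sgn_div_norm)
      ultimately show ?thesis
        using that by (simp add: v_def s_def[symmetric] inner_add_left inner_add_right inner_diff_left
            inner_diff_right inner_commute mult.commute)
    qed
    moreover have "F = (\<lambda>y. norm y * f (inverse (norm y) *\<^sub>R y))"
      by (auto simp: F_def sgn_div_norm)
    ultimately show ?thesis by simp
  qed
  have nfst: "norm (fst p) < 1" and nsnd: "norm (snd p) < 1" if "norm p < 1" for p :: "'a \<times> 'a"
    using norm_fst_le[of "fst p" "snd p"] norm_snd_le[of "snd p" "fst p"] that by auto
  have ball_int: "integrable U g" if "g \<in> borel_measurable borel" "\<And>p. norm p < 1 \<Longrightarrow> \<bar>g p\<bar> \<le> c"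
    for g :: "'a \<times> 'a \<Rightarrow> real" and c :: real
    unfolding U_def using that by (rule integrable_uniform_ball)
  define m where "m = (\<integral>p. (norm (fst p))\<^sup>2 \<partial>U)"
  have "\<bar>(norm (fst p))\<^sup>2\<bar> \<le> 1" "\<bar>(norm (snd p))\<^sup>2\<bar> \<le> 1" if "norm p < 1" for p :: "'a \<times> 'a"
    using nfst[OF that] nsnd[OF that] by (simp_all add: power_le_one less_imp_le)
  then have im: "integrable U (\<lambda>p. (norm (fst p))\<^sup>2)" "integrable U (\<lambda>p. (norm (snd p))\<^sup>2)"
    by (auto intro!: ball_int[of _ 1])
  have m_snd: "(\<integral>p. (norm (snd p))\<^sup>2 \<partial>U) = m"
    using integral_pair_rotation[of "\<lambda>p :: 'a \<times> 'a. (norm (fst p))\<^sup>2" "pi / 2"]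
    by (simp add: m_def U_def pair_rotation_def)
  \<comment> \<open>The factor \<open>m\<close> is to be cancelled; it could vanish only if
    \<open>fst p = 0\<close> almost surely.\<close>
  have "m \<noteq> 0"
  proof
    assume "m = 0"
    then have "AE p in U. (norm (fst p))\<^sup>2 = 0"
      using im(1) by (subst (asm) m_def, subst (asm) integral_nonneg_eq_0_iff_AE) auto
    with AE_uniform_ball_fst_nonzero have "AE p in U. False"
      unfolding U_def by eventually_elim auto
    then show False by simp
  qed
  then have "m > 0" unfolding m_def by (simp add: less_le)
  have "AE e in uniform_sphere. norm ((f e)\<^sup>2) \<le> L\<^sup>2"
    using AE_uniform_sphere
  proof eventually_elim
    case (elim e)
    then show ?case using f2[OF elim] by simp
  qed
  then have f_int: "integrable uniform_sphere (\<lambda>e. (f e)\<^sup>2)"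
    by (rule S.integrable_const_bound) simp
  define q where "q = (\<integral>e. (f e)\<^sup>2 \<partial>uniform_sphere)"
  have q: "(\<integral>\<^sup>+e. ennreal ((f e)\<^sup>2) \<partial>uniform_sphere) = ennreal q" "q \<ge> 0"
    unfolding q_def using f_int by (auto simp: nn_integral_eq_integral)
  have nm: "(\<integral>\<^sup>+p. ennreal ((norm (fst p))\<^sup>2) \<partial>U) = ennreal m" "(\<integral>\<^sup>+p. ennreal ((norm (snd p))\<^sup>2) \<partial>U) = ennreal m"
    using im by (simp_all add: nn_integral_eq_integral m_snd m_def)
  have "(\<integral>\<^sup>+p. ennreal ((F (fst p))\<^sup>2) \<partial>U) = ennreal m * ennreal q"
    using nn_integral_uniform_ball_pair_fst[of "\<lambda>e. ennreal ((f e)\<^sup>2)"] nm(1)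
    by (simp add: q F_def power_mult_distrib ennreal_mult U_def[symmetric])
  then have 1: "(\<integral>p. (F (fst p))\<^sup>2 \<partial>U) = m * q"
    using \<open>m > 0\<close> q(2) by (subst integral_eq_nn_integral) (auto simp: F_def ennreal_mult[symmetric])
  have "(\<integral>\<^sup>+p. ennreal ((v (fst p) \<bullet> snd p)\<^sup>2) \<partial>U) \<le> ennreal (2 * L\<^sup>2 / DIM('a)) * ennreal m"
    using nn_integral_uniform_ball_pair_inner[of v "2 * L\<^sup>2"] v_bound nm(2) by (simp add: U_def)
  then have "(\<integral>\<^sup>+p. ennreal ((v (fst p) \<bullet> snd p)\<^sup>2) \<partial>U) \<le> ennreal (2 * L\<^sup>2 / DIM('a) * m)"
    using \<open>m > 0\<close> by (subst ennreal_mult) auto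
  then have 2: "(\<integral>p. (v (fst p) \<bullet> snd p)\<^sup>2 \<partial>U) \<le> 2 * L\<^sup>2 / DIM('a) * m"
    using \<open>m > 0\<close> by (subst integral_eq_nn_integral) (auto intro!: enn2real_leI)
  have "2 * (m * q) \<le> (pi / 2)\<^sup>2 * (\<integral>p. (v (fst p) \<bullet> snd p)\<^sup>2 \<partial>U)"
    unfolding 1[symmetric] U_def using odd_variance_le_gradient[OF lipF oddF _ derF] by simp
  also have "\<dots> \<le> (pi / 2)\<^sup>2 * (2 * L\<^sup>2 / DIM('a) * m)"
    by (intro mult_left_mono 2) auto
  also have "\<dots> = 2 * (m * ((pi / 2)\<^sup>2 * L\<^sup>2 / DIM('a)))" by simp
  finally have "m * q \<le> m * ((pi / 2)\<^sup>2 * L\<^sup>2 / DIM('a))" by (simp only: mult_le_cancel_left_pos zero_less_numeral)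
  then show ?thesis by (simp only: mult_le_cancel_left_pos[OF \<open>m > 0\<close>] q_def)
qed

subsection \<open>Gradients of convex-concave functions\<close>

text \<open>Differentiating in the direction \<open>g\<close> itself gives
  \<open>g \<bullet> g\<close>, while the Lipschitz bound limits the quotients by
  \<open>M * norm g\<close>.\<close>

lemma norm_gradient_le_lipschitz:
  fixes f :: "'a::real_inner \<Rightarrow> real"
  assumes lip: "M-lipschitz_on S f" and S: "open S" "x \<in> S"
    and der: "(f has_derivative (\<lambda>h. g \<bullet> h)) (at x)"
  shows "norm g \<le> M"
proof (cases "g = 0")
  case True
  then show ?thesis using lipschitz_on_nonneg[OF lip] by simp
next
  case False
  have "((\<lambda>t. x + t *\<^sub>R g) has_derivative (\<lambda>t. t *\<^sub>R g)) (at (0::real))"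
    by (auto intro!: derivative_eq_intros)
  moreover have "(f has_derivative (\<lambda>h. g \<bullet> h)) (at (x + 0 *\<^sub>R g))" using der by simp
  ultimately have "((\<lambda>t. f (x + t *\<^sub>R g)) has_derivative (\<lambda>t. g \<bullet> (t *\<^sub>R g))) (at 0)"
    by (rule has_derivative_compose)
  then have "((\<lambda>t. f (x + t *\<^sub>R g)) has_real_derivative (g \<bullet> g)) (at 0)"
    by (simp add: has_field_derivative_def mult_commute_abs)
  then have lim: "((\<lambda>t. (f (x + t *\<^sub>R g) - f x) / t) \<longlongrightarrow> g \<bullet> g) (at 0)"
    by (simp add: has_field_derivative_iff)
  have cont: "continuous (at 0) (\<lambda>t::real. x + t *\<^sub>R g)" by (intro continuous_intros)
  have "\<forall>\<^sub>F t in at (0::real). x + t *\<^sub>R g \<in> S"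
    using topological_tendstoD[OF cont[unfolded continuous_at] S(1)] S(2) by simp
  moreover have "\<forall>\<^sub>F t in at (0::real). t \<noteq> 0"
    by (simp add: eventually_at_filter)
  ultimately have "\<forall>\<^sub>F t in at 0. (f (x + t *\<^sub>R g) - f x) / t \<le> M * norm g"
  proof eventually_elim
    case (elim t)
    then have "\<bar>f (x + t *\<^sub>R g) - f x\<bar> \<le> M * (\<bar>t\<bar> * norm g)"
      using lipschitz_onD[OF lip, of "x + t *\<^sub>R g" x] S(2) by (simp add: dist_norm dist_real_def)
    then have "\<bar>(f (x + t *\<^sub>R g) - f x) / t\<bar> \<le> M * norm g"
      using elim by (simp add: abs_divide pos_divide_le_eq mult_ac)
    then show "(f (x + t *\<^sub>R g) - f x) / t \<le> M * norm g" by linarith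
  qed
  then have "g \<bullet> g \<le> M * norm g"
    using lim by (intro tendsto_upperbound) auto
  then have "norm g * norm g \<le> M * norm g" by (simp add: dot_square_norm power2_eq_square)
  then show ?thesis using False by simp
qed

text \<open>A limit of gradients of convex functions is a subgradient of the limit function, hence equal
  to its gradient.\<close>

lemma continuous_on_parametric_gradient:
  fixes f :: "'a::euclidean_space \<Rightarrow> 'b::metric_space \<Rightarrow> real"
  assumes S: "open S" and lip: "M-lipschitz_on (S \<times> T) (\<lambda>(x, y). f x y)"
    and der: "\<And>x y. x \<in> S \<Longrightarrow> y \<in> T \<Longrightarrow> ((\<lambda>x. f x y) has_derivative (\<lambda>h. g x y \<bullet> h)) (at x)"
    and sub: "\<And>x x' y. x \<in> S \<Longrightarrow> x' \<in> S \<Longrightarrow> y \<in> T \<Longrightarrow> f x' y \<ge> f x y + g x y \<bullet> (x' - x)"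
  shows "continuous_on (S \<times> T) (\<lambda>(x, y). g x y)"
proof (rule ccontr)
  have cont: "continuous_on (S \<times> T) (\<lambda>(x, y). f x y)"
    using lip by (rule lipschitz_on_continuous_on)
  have bound: "norm (g x y) \<le> M" if "x \<in> S" "y \<in> T" for x y
  proof (rule norm_gradient_le_lipschitz[OF _ S that(1) der[OF that]])
    show "M-lipschitz_on S (\<lambda>x. f x y)"
    proof (rule lipschitz_onI)
      show "dist (f a y) (f b y) \<le> M * dist a b" if "a \<in> S" "b \<in> S" for a b
        using lipschitz_onD[OF lip, of "(a, y)" "(b, y)"] that \<open>y \<in> T\<close> by (simp add: dist_Pair_Pair)
    qed (rule lipschitz_on_nonneg[OF lip])
  qed
  \<comment> \<open>A discontinuity at \<open>p\<close> yields points \<open>q n\<close> tending to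
    \<open>p\<close> whose gradients keep distance \<open>e\<close> from that at \<open>p\<close>.
    All gradients lie in a ball of radius \<open>M\<close>, so along a subsequence they converge to
    some \<open>l\<close>, which must be shown to be the gradient at \<open>p\<close>.\<close>
  assume "\<not> continuous_on (S \<times> T) (\<lambda>(x, y). g x y)"
  then obtain p where p: "p \<in> S \<times> T" "\<not> continuous (at p within S \<times> T) (\<lambda>(x, y). g x y)"
    by (auto simp: continuous_on_eq_continuous_within)
  then obtain e where "e > 0" and e: "\<And>d. d > 0 \<Longrightarrow> \<exists>q\<in>S \<times> T. dist q p < d \<and>
      \<not> dist (g (fst q) (snd q)) (g (fst p) (snd p)) < e"
    unfolding continuous_within_eps_delta case_prod_beta by blast
  have "\<forall>n. \<exists>q. q \<in> S \<times> T \<and> dist q p < 1 / real (Suc n) \<and> e \<le> dist (g (fst q) (snd q)) (g (fst p) (snd p))"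
  proof
    fix n
    show "\<exists>q. q \<in> S \<times> T \<and> dist q p < 1 / real (Suc n) \<and> e \<le> dist (g (fst q) (snd q)) (g (fst p) (snd p))"
      using e[of "1 / real (Suc n)"] unfolding Bex_def not_less by simp
  qed
  then obtain q where q: "\<And>n. q n \<in> S \<times> T" "\<And>n. dist (q n) p < 1 / real (Suc n)"
      "\<And>n. e \<le> dist (g (fst (q n)) (snd (q n))) (g (fst p) (snd p))"
    by metis
  have qp: "q \<longlonglongrightarrow> p"
  proof (rule metric_tendsto_imp_tendsto)
    show "(\<lambda>n. 1 / real (Suc n)) \<longlonglongrightarrow> 0" by (rule LIMSEQ_Suc[OF lim_1_over_n])
    show "\<forall>\<^sub>F n in sequentially. dist (q n) p \<le> dist (1 / real (Suc n)) 0"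
      using q(2) by (auto intro!: always_eventually less_imp_le simp del: of_nat_Suc)
  qed
  define k where "k n = g (fst (q n)) (snd (q n))" for n
  have "\<forall>n. k n \<in> cball 0 M"
    using q(1) bound by (auto simp: mem_Times_iff k_def)
  moreover have "seq_compact (cball (0::'a) M)" using compact_cball compact_eq_seq_compact_metric by blast
  ultimately obtain l r where r: "strict_mono r" and l: "(k \<circ> r) \<longlonglongrightarrow> l"
    unfolding seq_compact_def by blast
  have qr: "(q \<circ> r) \<longlonglongrightarrow> p" using qp r by (rule LIMSEQ_subseq_LIMSEQ)
  have fstr: "(\<lambda>n. fst (q (r n))) \<longlonglongrightarrow> fst p" and sndr: "(\<lambda>n. snd (q (r n))) \<longlonglongrightarrow> snd p"
    using tendsto_fst[OF qr] tendsto_snd[OF qr] by (simp_all add: o_def)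
  have flim: "(\<lambda>n. f (h n) (snd (q (r n)))) \<longlonglongrightarrow> f h0 (snd p)"
    if "h \<longlonglongrightarrow> h0" "h0 \<in> S" "\<And>n. h n \<in> S" for h h0
  proof -
    have "(\<lambda>n. (\<lambda>(x, y). f x y) (h n, snd (q (r n)))) \<longlonglongrightarrow> (\<lambda>(x, y). f x y) (h0, snd p)"
      by (rule continuous_on_tendsto_compose[OF cont])
        (use that sndr p(1) q(1) in \<open>auto intro!: tendsto_Pair always_eventually simp: mem_Times_iff\<close>)
    then show ?thesis by simp
  qed
  have sub_l: "f x' (snd p) \<ge> f (fst p) (snd p) + l \<bullet> (x' - fst p)" if "x' \<in> S" for x'
  proof (rule LIMSEQ_le)
    show "(\<lambda>n. f x' (snd (q (r n)))) \<longlonglongrightarrow> f x' (snd p)"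
      by (rule flim) (use that in auto)
    show "(\<lambda>n. f (fst (q (r n))) (snd (q (r n))) + g (fst (q (r n))) (snd (q (r n))) \<bullet> (x' - fst (q (r n))))
        \<longlonglongrightarrow> f (fst p) (snd p) + l \<bullet> (x' - fst p)"
      using l p(1) q(1)
      by (intro tendsto_add flim[OF fstr] tendsto_inner tendsto_diff tendsto_const fstr)
        (auto simp: o_def k_def mem_Times_iff)
    show "\<exists>N. \<forall>n\<ge>N. f (fst (q (r n))) (snd (q (r n))) + g (fst (q (r n))) (snd (q (r n))) \<bullet> (x' - fst (q (r n)))
        \<le> f x' (snd (q (r n)))"
      using sub that q(1) by (auto simp: mem_Times_iff)
  qed
  have fp: "fst p \<in> S" "snd p \<in> T" using p(1) by (auto simp: mem_Times_iff)
  \<comment> \<open>By \<open>sub_l\<close> the function with \<open>l \<bullet> x\<close>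
    subtracted is minimal at \<open>fst p\<close>, so its derivative vanishes there, which
    identifies \<open>l\<close>.\<close>
  have "((\<lambda>x. f x (snd p) - l \<bullet> x) has_derivative (\<lambda>h. g (fst p) (snd p) \<bullet> h - l \<bullet> h)) (at (fst p))"
    by (intro has_derivative_diff der fp) (auto intro!: derivative_eq_intros)
  then have "(\<lambda>h. g (fst p) (snd p) \<bullet> h - l \<bullet> h) = (\<lambda>h. 0)"
  proof (rule differential_zero_maxmin[OF fp(1) S])
    show "(\<forall>y\<in>S. f y (snd p) - l \<bullet> y \<le> f (fst p) (snd p) - l \<bullet> fst p) \<or>
      (\<forall>y\<in>S. f (fst p) (snd p) - l \<bullet> fst p \<le> f y (snd p) - l \<bullet> y)"
      using sub_l by (force simp: inner_diff_right)
  qed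
  then have "(g (fst p) (snd p) - l) \<bullet> (g (fst p) (snd p) - l) = 0"
    by (metis inner_diff_left)
  then have "l = g (fst p) (snd p)" by simp
  then have "(\<lambda>n. dist (g (fst (q (r n))) (snd (q (r n)))) (g (fst p) (snd p))) \<longlonglongrightarrow> 0"
    using l tendsto_dist[OF l tendsto_const[of l]] by (simp add: o_def k_def)
  then have "e \<le> 0" by (rule LIMSEQ_le_const) (use q(3) in auto)
  with \<open>e > 0\<close> show False by simp
qed

text \<open>The hypothesis yields gradients in one variable with the other frozen, continuous only
  in their own variable. \<open>continuous_on_parametric_gradient\<close> makes both partial
  gradients jointly continuous, which turns partial into joint differentiability. The second
  variable is treated through \<open>- \<phi>\<close> with the roles of \<open>A\<close> and
  \<open>B\<close> exchanged.\<close>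

lemma strongly_convex_concave_gradient:
  fixes \<phi> :: "'a::euclidean_space \<times> 'b::euclidean_space \<Rightarrow> real"
  assumes A: "open A" "convex A" and B: "open B" "convex B"
    and sc: "strongly_convex_concave_on A B \<mu> \<phi>" and "\<mu> \<ge> 0"
    and lip: "M-lipschitz_on (A \<times> B) \<phi>"
  obtains G where "continuous_on (A \<times> B) G"
    "\<And>v. v \<in> A \<times> B \<Longrightarrow> (\<phi> has_derivative (\<lambda>h. G v \<bullet> h)) (at v)"
    "\<And>v. v \<in> A \<times> B \<Longrightarrow> norm (G v) \<le> M"
    "\<And>v x. v \<in> A \<times> B \<Longrightarrow> x \<in> A \<Longrightarrow>
      \<phi> (x, snd v) \<ge> \<phi> v + fst (G v) \<bullet> (x - fst v) + \<mu> / 2 * (norm (x - fst v))\<^sup>2"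
    "\<And>v y. v \<in> A \<times> B \<Longrightarrow> y \<in> B \<Longrightarrow>
      \<phi> (fst v, y) \<le> \<phi> v + snd (G v) \<bullet> (y - snd v) - \<mu> / 2 * (norm (y - snd v))\<^sup>2"
proof -
  have "\<forall>y\<in>B. \<exists>g. (\<forall>x\<in>A. GDERIV (\<lambda>x. \<phi> (x, y)) x :> g x) \<and>
      (\<forall>x\<in>A. \<forall>x'\<in>A. \<phi> (x', y) \<ge> \<phi> (x, y) + g x \<bullet> (x' - x) + \<mu> / 2 * (norm (x' - x))\<^sup>2)"
    using sc unfolding strongly_convex_concave_on_def strongly_convex_on_def by meson
  then obtain gx where gx: "\<And>x y. y \<in> B \<Longrightarrow> x \<in> A \<Longrightarrow> GDERIV (\<lambda>x. \<phi> (x, y)) x :> gx y x"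
    and gx_sub: "\<And>x x' y. y \<in> B \<Longrightarrow> x \<in> A \<Longrightarrow> x' \<in> A \<Longrightarrow>
      \<phi> (x', y) \<ge> \<phi> (x, y) + gx y x \<bullet> (x' - x) + \<mu> / 2 * (norm (x' - x))\<^sup>2"
    by metis
  have "\<forall>x\<in>A. \<exists>g. (\<forall>y\<in>B. GDERIV (\<lambda>y. - \<phi> (x, y)) y :> g y) \<and>
      (\<forall>y\<in>B. \<forall>y'\<in>B. - \<phi> (x, y') \<ge> - \<phi> (x, y) + g y \<bullet> (y' - y) + \<mu> / 2 * (norm (y' - y))\<^sup>2)"
    using sc unfolding strongly_convex_concave_on_def strongly_concave_on_def strongly_convex_on_def by meson
  then obtain gy where gy: "\<And>x y. y \<in> B \<Longrightarrow> x \<in> A \<Longrightarrow> GDERIV (\<lambda>y. - \<phi> (x, y)) y :> gy x y"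
    and gy_sub: "\<And>x y y'. y \<in> B \<Longrightarrow> x \<in> A \<Longrightarrow> y' \<in> B \<Longrightarrow>
      - \<phi> (x, y') \<ge> - \<phi> (x, y) + gy x y \<bullet> (y' - y) + \<mu> / 2 * (norm (y' - y))\<^sup>2"
    by metis
  have nn: "0 \<le> \<mu> / 2 * (norm u)\<^sup>2" for u :: "'c::real_normed_vector"
    using \<open>\<mu> \<ge> 0\<close> by simp
  have cx: "continuous_on (A \<times> B) (\<lambda>(x, y). gx y x)"
  proof (rule continuous_on_parametric_gradient[OF A(1)])
    show "M-lipschitz_on (A \<times> B) (\<lambda>(x, y). \<phi> (x, y))" using lip by simp
    show "((\<lambda>x. \<phi> (x, y)) has_derivative (\<lambda>h. gx y x \<bullet> h)) (at x)" if "x \<in> A" "y \<in> B" for x y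
      using gx[OF that(2,1)] by (simp add: gderiv_def inner_commute)
    show "\<phi> (x, y) + gx y x \<bullet> (x' - x) \<le> \<phi> (x', y)" if "x \<in> A" "x' \<in> A" "y \<in> B" for x x' y
      using gx_sub[OF that(3,1,2)] nn[of "x' - x"] by linarith
  qed
  have "continuous_on (B \<times> A) (\<lambda>(y, x). gy x y)"
  proof (rule continuous_on_parametric_gradient[OF B(1)])
    show "M-lipschitz_on (B \<times> A) (\<lambda>(y, x). - \<phi> (x, y))"
    proof (rule lipschitz_onI)
      fix p q :: "'b \<times> 'a" assume "p \<in> B \<times> A" "q \<in> B \<times> A"
      then show "dist (case p of (y, x) \<Rightarrow> - \<phi> (x, y)) (case q of (y, x) \<Rightarrow> - \<phi> (x, y)) \<le> M * dist p q"
        using lipschitz_onD[OF lip, of "(snd p, fst p)" "(snd q, fst q)"]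
        by (auto simp: dist_prod_def dist_minus add.commute)
    qed (rule lipschitz_on_nonneg[OF lip])
    show "((\<lambda>y. - \<phi> (x, y)) has_derivative (\<lambda>h. gy x y \<bullet> h)) (at y)" if "y \<in> B" "x \<in> A" for x y
      using gy[OF that] by (simp add: gderiv_def inner_commute)
    show "- \<phi> (x, y) + gy x y \<bullet> (y' - y) \<le> - \<phi> (x, y')" if "y \<in> B" "y' \<in> B" "x \<in> A" for x y y'
      using gy_sub[OF that(1,3,2)] nn[of "y' - y"] by linarith
  qed
  then have "continuous_on (A \<times> B) ((\<lambda>(y, x). gy x y) \<circ> prod.swap)"
    by (intro continuous_on_compose continuous_on_swap) (auto simp: image_def elim!: continuous_on_subset)
  then have cy: "continuous_on (A \<times> B) (\<lambda>v. gy (fst v) (snd v))"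
    by (simp add: o_def case_prod_beta)
  \<comment> \<open>\<open>gy\<close> is a gradient of \<open>- \<phi>\<close>, hence the
    sign.\<close>
  define G where "G v = (gx (snd v) (fst v), - gy (fst v) (snd v))" for v
  have "continuous_on (A \<times> B) G"
    unfolding G_def using cx cy by (intro continuous_intros) (auto simp: case_prod_beta)
  moreover have der: "(\<phi> has_derivative (\<lambda>h. G v \<bullet> h)) (at v)" if v: "v \<in> A \<times> B" for v
  proof -
    obtain x y where xy: "v = (x, y)" "x \<in> A" "y \<in> B" using v by auto
    \<comment> \<open>Joint differentiability follows from the derivative in the first variable at
      the point together with a derivative in the second variable that is jointly continuous there,
      \<open>B\<close> being convex.\<close>
    have "((\<lambda>(x, y). \<phi> (x, y)) has_derivative
        (\<lambda>(tx, ty). gx y x \<bullet> tx + blinfun_inner_right (- gy x y) ty)) (at (x, y) within A \<times> B)"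
    proof (rule has_derivative_partialsI)
      show "((\<lambda>x. \<phi> (x, y)) has_derivative (\<lambda>h. gx y x \<bullet> h)) (at x within A)"
        using gx[OF xy(3,2)] by (auto simp: gderiv_def inner_commute intro: has_derivative_at_withinI)
      show "((\<lambda>y. \<phi> (x, y)) has_derivative blinfun_inner_right (- gy x y)) (at y within B)"
        if "x \<in> A" "y \<in> B" for x y
      proof -
        have "((\<lambda>y. \<phi> (x, y)) has_derivative (\<lambda>h. - (h \<bullet> gy x y))) (at y)"
          using has_derivative_minus[OF gy[OF that(2,1), unfolded gderiv_def]] by (simp only: minus_minus)
        moreover have "blinfun_apply (blinfun_inner_right (- gy x y)) = (\<lambda>h. - (h \<bullet> gy x y))"
          by (rule ext) (simp add: inner_commute)
        ultimately show ?thesis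
          by (simp only: has_derivative_at_withinI)
      qed
      have "continuous_on (A \<times> B) (\<lambda>v. blinfun_inner_right (- gy (fst v) (snd v)))"
        by (intro bounded_linear.continuous_on[OF bounded_linear_blinfun_inner_right] continuous_intros cy)
      then show "continuous (at (x, y) within A \<times> B) (\<lambda>(x, y). blinfun_inner_right (- gy x y))"
        using xy by (simp add: continuous_on_eq_continuous_within case_prod_unfold)
    qed (use xy B in auto)
    moreover have "at (x, y) within A \<times> B = at (x, y)"
      using xy A B by (intro at_within_open open_Times) auto
    moreover have "(\<lambda>(tx, ty). gx y x \<bullet> tx + blinfun_inner_right (- gy x y) ty) = (\<lambda>h. G v \<bullet> h)"
      by (auto simp: G_def xy(1) inner_prod_def)
    ultimately show ?thesis by (simp add: xy(1))
  qed
  moreover have "norm (G v) \<le> M" if "v \<in> A \<times> B" for v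
    using norm_gradient_le_lipschitz[OF lip open_Times[OF A(1) B(1)] that der[OF that]] .
  moreover have "\<phi> (x, snd v) \<ge> \<phi> v + fst (G v) \<bullet> (x - fst v) + \<mu> / 2 * (norm (x - fst v))\<^sup>2"
    if "v \<in> A \<times> B" "x \<in> A" for v x
    using gx_sub[of "snd v" "fst v" x] that by (auto simp: G_def)
  moreover have "\<phi> (fst v, y) \<le> \<phi> v + snd (G v) \<bullet> (y - snd v) - \<mu> / 2 * (norm (y - snd v))\<^sup>2"
    if "v \<in> A \<times> B" "y \<in> B" for v y
    using gy_sub[of "snd v" "fst v" y] that by (auto simp: G_def)
  ultimately show ?thesis by (rule that)
qed

subsection \<open>Spherical smoothing of a saddle function\<close>

text \<open>\<open>arctan x \<le> x\<close> at \<open>1 / sqrt 3 = tan (pi / 6)\<close> gives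
  \<open>pi\<^sup>2 \<le> 12\<close>. With the value 3 the \<open>M\<close>-term of the second
  moment becomes exactly 2/3 of its counterpart in \<open>Mall2\<close>.\<close>

lemma pi_half_square_le: "(pi / 2)\<^sup>2 \<le> 3"
proof -
  have "0 - arctan 0 \<le> 1 / sqrt 3 - arctan (1 / sqrt 3)"
  proof (rule DERIV_nonneg_imp_nondecreasing[where f = "\<lambda>x. x - arctan x"])
    fix x :: real
    have "((\<lambda>x. x - arctan x) has_real_derivative 1 - inverse (1 + x\<^sup>2)) (at x)"
      by (auto intro!: derivative_eq_intros)
    moreover have "0 \<le> 1 - inverse (1 + x\<^sup>2)"
      by (simp add: inverse_le_1_iff)
    ultimately show "\<exists>y. ((\<lambda>x. x - arctan x) has_real_derivative y) (at x) \<and> 0 \<le> y"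
      by blast
  qed simp
  moreover have "arctan (tan (pi / 6)) = pi / 6"
    by (rule arctan_tan) (use pi_gt_zero in linarith)+
  ultimately have "pi / 6 \<le> 1 / sqrt 3"
    by (simp add: tan_30)
  then have "(pi / 6)\<^sup>2 \<le> (1 / sqrt 3)\<^sup>2"
    using pi_gt_zero by (intro power_mono) auto
  then show ?thesis by (simp add: power_divide)
qed

text \<open>Measurability of \<phi> is asked on the whole space so that integrals over sphere and
  ball need no restriction; the application supplies a version of the objective that is 0 outside
  \<open>A \<times> B\<close>.\<close>

locale saddle_problem =
  fixes A :: "'a::euclidean_space set" and B :: "'b::euclidean_space set"
    and \<phi> :: "'a \<times> 'b \<Rightarrow> real" and G :: "'a \<times> 'b \<Rightarrow> 'a \<times> 'b" and M \<mu> :: real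
  assumes A: "open A" "convex A" and B: "open B" "convex B"
    and lip: "M-lipschitz_on (A \<times> B) \<phi>"
    and phi_measurable [measurable]: "\<phi> \<in> borel_measurable borel"
    and G_cont: "continuous_on (A \<times> B) G"
    and G_der: "\<And>v. v \<in> A \<times> B \<Longrightarrow> (\<phi> has_derivative (\<lambda>h. G v \<bullet> h)) (at v)"
    and G_norm: "\<And>v. v \<in> A \<times> B \<Longrightarrow> norm (G v) \<le> M"
    and G_convex: "\<And>v x. v \<in> A \<times> B \<Longrightarrow> x \<in> A \<Longrightarrow>
      \<phi> (x, snd v) \<ge> \<phi> v + fst (G v) \<bullet> (x - fst v) + \<mu> / 2 * (norm (x - fst v))\<^sup>2"
    and G_concave: "\<And>v y. v \<in> A \<times> B \<Longrightarrow> y \<in> B \<Longrightarrow>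
      \<phi> (fst v, y) \<le> \<phi> v + snd (G v) \<bullet> (y - snd v) - \<mu> / 2 * (norm (y - snd v))\<^sup>2"
begin

text \<open>Convexity in the first and concavity in the second variable are both used at
  \<open>v\<close>. On subtraction the value \<open>\<phi> v\<close> cancels, and the two quadratic
  terms add up to the squared distance.\<close>

lemma gap_le_inner_gradient:
  assumes "v \<in> A \<times> B" "r \<in> A \<times> B"
  shows "\<phi> (fst v, snd r) - \<phi> (fst r, snd v) \<le>
    G v \<bullet> (fst v - fst r, snd r - snd v) - \<mu> / 2 * (norm (v - r))\<^sup>2"
proof -
  have "(norm (v - r))\<^sup>2 = (norm (fst r - fst v))\<^sup>2 + (norm (snd r - snd v))\<^sup>2"
    by (simp add: norm_prod_def norm_minus_commute)
  moreover have "G v \<bullet> (fst v - fst r, snd r - snd v) = snd (G v) \<bullet> (snd r - snd v) - fst (G v) \<bullet> (fst r - fst v)"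
    by (simp add: inner_prod_def inner_diff_right)
  ultimately show ?thesis
    using G_convex[of v "fst r"] G_concave[of v "snd r"] assms
    by (auto simp: algebra_simps mem_Times_iff)
qed

text \<open>With \<open>d\<close> the distance of the points, the gap is at most
  \<open>M * d - \<mu> / 2 * d\<^sup>2\<close>, and the maximum of this over \<open>d\<close> is the
  bound. It serves the short runs.\<close>

lemma gap_le:
  assumes "v \<in> A \<times> B" "r \<in> A \<times> B" "\<mu> > 0"
  shows "\<phi> (fst v, snd r) - \<phi> (fst r, snd v) \<le> M\<^sup>2 / (2 * \<mu>)"
proof -
  define d where "d = norm (v - r)"
  have "norm (fst v - fst r, snd r - snd v) = d"
    by (simp add: d_def norm_prod_def norm_minus_commute)
  then have "G v \<bullet> (fst v - fst r, snd r - snd v) \<le> M * d"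
    using norm_cauchy_schwarz[of "G v" "(fst v - fst r, snd r - snd v)"]
      mult_right_mono[OF G_norm[OF assms(1)], of d] by (simp add: d_def)
  then have "\<phi> (fst v, snd r) - \<phi> (fst r, snd v) \<le> M * d - \<mu> / 2 * d\<^sup>2"
    using gap_le_inner_gradient[OF assms(1,2)] by (simp add: d_def)
  moreover have "0 \<le> (M - \<mu> * d)\<^sup>2 / (2 * \<mu>)" using \<open>\<mu> > 0\<close> by simp
  then have "M * d - \<mu> / 2 * d\<^sup>2 \<le> M\<^sup>2 / (2 * \<mu>)"
    using \<open>\<mu> > 0\<close> by (simp add: power2_eq_square field_simps)
  ultimately show ?thesis by simp
qed

lemma shifted_lipschitz:
  assumes p: "p \<in> A \<times> B" and q: "p + \<tau> *\<^sub>R u \<in> A \<times> B" and "norm u \<le> 1" "\<tau> > 0"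
  shows "\<bar>\<phi> (p + \<tau> *\<^sub>R u) - \<phi> p\<bar> \<le> \<tau> * M"
proof -
  have "\<bar>\<phi> (p + \<tau> *\<^sub>R u) - \<phi> p\<bar> \<le> M * norm (\<tau> *\<^sub>R u)"
    using lipschitz_onD[OF lip q p] by (simp add: dist_norm dist_real_def)
  also have "norm (\<tau> *\<^sub>R u) \<le> \<tau>" using assms(3,4) by (simp add: mult_left_le)
  then have "M * norm (\<tau> *\<^sub>R u) \<le> M * \<tau>" using lipschitz_on_nonneg[OF lip] by (rule mult_left_mono)
  finally show ?thesis by (simp add: mult.commute)
qed

section \<open>Symmetric differences around a fixed point\<close>

context
  fixes \<tau> :: real and z :: "'a \<times> 'b"
  assumes \<tau>: "\<tau> > 0" and z: "\<And>u. norm u \<le> 1 \<Longrightarrow> z + \<tau> *\<^sub>R u \<in> A \<times> B"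
begin

lemma z_minus: "norm u \<le> 1 \<Longrightarrow> z - \<tau> *\<^sub>R u \<in> A \<times> B"
  using z[of "- u"] by simp

lemma symmetric_difference_lipschitz:
  "(2 * \<tau> * M)-lipschitz_on (cball 0 1) (\<lambda>u. \<phi> (z + \<tau> *\<^sub>R u) - \<phi> (z - \<tau> *\<^sub>R u))"
proof (rule lipschitz_onI)
  fix u v :: "'a \<times> 'b" assume "u \<in> cball 0 1" "v \<in> cball 0 1"
  then have uv: "norm u \<le> 1" "norm v \<le> 1" by auto
  have "\<bar>\<phi> (z + \<tau> *\<^sub>R u) - \<phi> (z + \<tau> *\<^sub>R v)\<bar> \<le> M * (\<tau> * norm (u - v))"
    using lipschitz_onD[OF lip z[OF uv(1)] z[OF uv(2)]] \<tau>
    by (simp add: dist_norm dist_real_def scaleR_diff_right[symmetric])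
  moreover have "\<bar>\<phi> (z - \<tau> *\<^sub>R v) - \<phi> (z - \<tau> *\<^sub>R u)\<bar> \<le> M * (\<tau> * norm (u - v))"
    using lipschitz_onD[OF lip z_minus[OF uv(2)] z_minus[OF uv(1)]] \<tau>
    by (simp add: dist_norm dist_real_def scaleR_diff_right[symmetric])
  moreover have double: "2 * \<tau> * M * norm (u - v) = M * (\<tau> * norm (u - v)) + M * (\<tau> * norm (u - v))"
    by simp
  ultimately show "dist (\<phi> (z + \<tau> *\<^sub>R u) - \<phi> (z - \<tau> *\<^sub>R u)) (\<phi> (z + \<tau> *\<^sub>R v) - \<phi> (z - \<tau> *\<^sub>R v)) \<le> 2 * \<tau> * M * dist u v"
    unfolding dist_real_def dist_norm[of u v] double by linarith
qed (use \<tau> lipschitz_on_nonneg[OF lip] in auto)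

lemma symmetric_difference_derivative:
  assumes "norm u \<le> 1"
  shows "((\<lambda>u. \<phi> (z + \<tau> *\<^sub>R u) - \<phi> (z - \<tau> *\<^sub>R u)) has_derivative
    (\<lambda>h. (\<tau> *\<^sub>R (G (z + \<tau> *\<^sub>R u) + G (z - \<tau> *\<^sub>R u))) \<bullet> h)) (at u)"
proof -
  have 1: "((\<lambda>u. z + \<tau> *\<^sub>R u) has_derivative (\<lambda>h. \<tau> *\<^sub>R h)) (at u)"
    "((\<lambda>u. z - \<tau> *\<^sub>R u) has_derivative (\<lambda>h. - (\<tau> *\<^sub>R h))) (at u)"
    by (auto intro!: derivative_eq_intros)
  show ?thesis
    using has_derivative_diff[OF has_derivative_compose[OF 1(1) G_der[OF z[OF assms]]]
        has_derivative_compose[OF 1(2) G_der[OF z_minus[OF assms]]]]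
    by (simp add: inner_add_left distrib_left)
qed

lemma continuous_on_gradient_sum:
  "continuous_on (cball 0 1) (\<lambda>u. G (z + \<tau> *\<^sub>R u) + G (z - \<tau> *\<^sub>R u))"
proof (rule continuous_on_add)
  have "(\<lambda>u. z + \<tau> *\<^sub>R u) ` cball 0 1 \<subseteq> A \<times> B" "(\<lambda>u. z - \<tau> *\<^sub>R u) ` cball 0 1 \<subseteq> A \<times> B"
    using z z_minus by (blast dest: mem_cball_0[THEN iffD1])+
  then show "continuous_on (cball 0 1) (\<lambda>u. G (z + \<tau> *\<^sub>R u))" "continuous_on (cball 0 1) (\<lambda>u. G (z - \<tau> *\<^sub>R u))"
    by (auto intro!: continuous_on_compose2[OF G_cont] continuous_intros)
qed

text \<open>The symmetric difference is odd in the direction and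
  \<open>2 * \<tau> * M\<close>-Lipschitz. The 12 is 3, the bound on
  \<open>(pi / 2)\<^sup>2\<close>, times the square of 2.\<close>

lemma second_moment_symmetric_difference:
  "(\<integral>e. (\<phi> (z + \<tau> *\<^sub>R e) - \<phi> (z - \<tau> *\<^sub>R e))\<^sup>2 \<partial>uniform_sphere) \<le> 12 * \<tau>\<^sup>2 * M\<^sup>2 / DIM('a \<times> 'b)"
proof -
  have "(\<integral>e. (\<phi> (z + \<tau> *\<^sub>R e) - \<phi> (z - \<tau> *\<^sub>R e))\<^sup>2 \<partial>uniform_sphere) \<le> (pi / 2)\<^sup>2 * (2 * \<tau> * M)\<^sup>2 / DIM('a \<times> 'b)"
  proof (rule sphere_poincare_odd[where G = "\<lambda>u. \<tau> *\<^sub>R (G (z + \<tau> *\<^sub>R u) + G (z - \<tau> *\<^sub>R u))"])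
    show "(2 * \<tau> * M)-lipschitz_on (sphere 0 1) (\<lambda>u. \<phi> (z + \<tau> *\<^sub>R u) - \<phi> (z - \<tau> *\<^sub>R u))"
      by (rule lipschitz_on_subset[OF symmetric_difference_lipschitz]) auto
    show "continuous_on (sphere 0 1) (\<lambda>u. \<tau> *\<^sub>R (G (z + \<tau> *\<^sub>R u) + G (z - \<tau> *\<^sub>R u)))"
      by (intro continuous_intros continuous_on_subset[OF continuous_on_gradient_sum]) auto
    fix u :: "'a \<times> 'b" assume u: "norm u = 1"
    then show "((\<lambda>u. \<phi> (z + \<tau> *\<^sub>R u) - \<phi> (z - \<tau> *\<^sub>R u)) has_derivative
        (\<lambda>h. (\<tau> *\<^sub>R (G (z + \<tau> *\<^sub>R u) + G (z - \<tau> *\<^sub>R u))) \<bullet> h)) (at u)"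
      by (intro symmetric_difference_derivative) simp
    have "norm (G (z + \<tau> *\<^sub>R u) + G (z - \<tau> *\<^sub>R u)) \<le> M + M"
      using u by (intro norm_triangle_mono G_norm z z_minus) auto
    then have "\<tau> * norm (G (z + \<tau> *\<^sub>R u) + G (z - \<tau> *\<^sub>R u)) \<le> \<tau> * (M + M)"
      using \<tau> by (intro mult_left_mono) auto
    then show "norm (\<tau> *\<^sub>R (G (z + \<tau> *\<^sub>R u) + G (z - \<tau> *\<^sub>R u))) \<le> 2 * \<tau> * M"
      using \<tau> by simp
  qed auto
  also have "\<dots> \<le> 3 * (2 * \<tau> * M)\<^sup>2 / DIM('a \<times> 'b)"
    by (intro divide_right_mono mult_right_mono pi_half_square_le) auto
  finally show ?thesis by (simp add: power_mult_distrib)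
qed

text \<open>The divergence theorem turns the right side into the ball average of half of
  \<open>G (z + \<tau> *\<^sub>R u) + G (z - \<tau> *\<^sub>R u)\<close>, tested against the
  displacement \<open>w\<close>. The gap inequality is then applied with \<open>z\<close> and
  \<open>r\<close> shifted by the same vector: their difference, hence \<open>w\<close> and the
  strong convexity term, is unchanged, while each of the two values of \<phi> moves by at most
  \<open>\<tau> * M\<close>. This is the loss \<open>2 * \<tau> * M\<close>.\<close>

lemma gap_le_smoothed_gradient:
  assumes r: "\<And>u. norm u \<le> 1 \<Longrightarrow> r + \<tau> *\<^sub>R u \<in> A \<times> B"
  shows "\<phi> (fst z, snd r) - \<phi> (fst r, snd z) + \<mu> / 2 * (norm (z - r))\<^sup>2 - 2 * \<tau> * M \<le>
    DIM('a \<times> 'b) / (2 * \<tau>) * (\<integral>e. (\<phi> (z + \<tau> *\<^sub>R e) - \<phi> (z - \<tau> *\<^sub>R e)) *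
      (e \<bullet> (fst z - fst r, snd r - snd z)) \<partial>uniform_sphere)"
proof -
  interpret U: prob_space "uniform_measure lborel (ball (0::'a \<times> 'b) 1)" by (rule prob_space_uniform_ball)
  define w where "w = (fst z - fst r, snd r - snd z)"
  define c where "c = \<phi> (fst z, snd r) - \<phi> (fst r, snd z) + \<mu> / 2 * (norm (z - r))\<^sup>2 - 2 * \<tau> * M"
  define H where "H u = (\<tau> *\<^sub>R (G (z + \<tau> *\<^sub>R u) + G (z - \<tau> *\<^sub>R u))) \<bullet> w" for u
  \<comment> \<open>\<open>G\<close> is controlled only on \<open>A \<times> B\<close>; the
    indicator makes the integrand Borel on the whole space.\<close>
  define D where "D u = indicator (ball 0 1) u *\<^sub>R H u" for u
  have D_eq: "D u = H u" if "norm u < 1" for u using that by (simp add: D_def)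
  have "continuous_on (ball 0 1) H"
    unfolding H_def by (intro continuous_intros continuous_on_subset[OF continuous_on_gradient_sum]) auto
  then have [measurable]: "D \<in> borel_measurable borel"
    unfolding D_def by (intro borel_measurable_continuous_on_indicator) auto
  have bnd: "\<bar>D u\<bar> \<le> 2 * \<tau> * M * norm w" if u: "norm u < 1" for u
  proof -
    have "norm (G (z + \<tau> *\<^sub>R u) + G (z - \<tau> *\<^sub>R u)) \<le> M + M"
      using u by (intro norm_triangle_mono G_norm z z_minus) auto
    then have "norm (\<tau> *\<^sub>R (G (z + \<tau> *\<^sub>R u) + G (z - \<tau> *\<^sub>R u))) \<le> 2 * \<tau> * M"
      using \<tau> by (simp add: mult.assoc)
    then have "norm (\<tau> *\<^sub>R (G (z + \<tau> *\<^sub>R u) + G (z - \<tau> *\<^sub>R u))) * norm w \<le> 2 * \<tau> * M * norm w"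
      by (rule mult_right_mono) simp
    then show ?thesis
      unfolding D_eq[OF u] H_def by (rule order_trans[OF Cauchy_Schwarz_ineq2])
  qed
  have "real DIM('a \<times> 'b) * (\<integral>e. (\<phi> (z + \<tau> *\<^sub>R e) - \<phi> (z - \<tau> *\<^sub>R e)) * (e \<bullet> w) \<partial>uniform_sphere) =
      (\<integral>u. D u \<partial>uniform_measure lborel (ball 0 1))"
  proof (rule sphere_divergence[OF symmetric_difference_lipschitz _ _ _ bnd])
    fix u :: "'a \<times> 'b" assume u: "norm u < 1"
    have "((\<lambda>t. u + t *\<^sub>R w) has_derivative (\<lambda>t. t *\<^sub>R w)) (at 0)"
      by (auto intro!: derivative_eq_intros)
    moreover have "((\<lambda>u. \<phi> (z + \<tau> *\<^sub>R u) - \<phi> (z - \<tau> *\<^sub>R u)) has_derivative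
        (\<lambda>h. (\<tau> *\<^sub>R (G (z + \<tau> *\<^sub>R u) + G (z - \<tau> *\<^sub>R u))) \<bullet> h)) (at (u + 0 *\<^sub>R w))"
      using symmetric_difference_derivative[of u] u by simp
    ultimately have "((\<lambda>t. \<phi> (z + \<tau> *\<^sub>R (u + t *\<^sub>R w)) - \<phi> (z - \<tau> *\<^sub>R (u + t *\<^sub>R w))) has_derivative
        (\<lambda>t. (\<tau> *\<^sub>R (G (z + \<tau> *\<^sub>R u) + G (z - \<tau> *\<^sub>R u))) \<bullet> (t *\<^sub>R w))) (at 0)"
      by (rule has_derivative_compose)
    moreover have "(\<lambda>t. (\<tau> *\<^sub>R (G (z + \<tau> *\<^sub>R u) + G (z - \<tau> *\<^sub>R u))) \<bullet> (t *\<^sub>R w)) = (*) (D u)"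
      by (simp add: D_eq[OF u] H_def fun_eq_iff)
    ultimately show "((\<lambda>t. \<phi> (z + \<tau> *\<^sub>R (u + t *\<^sub>R w)) - \<phi> (z - \<tau> *\<^sub>R (u + t *\<^sub>R w))) has_real_derivative D u) (at 0)"
      by (simp only: has_field_derivative_def)
  qed simp_all
  also have "\<dots> \<ge> 2 * \<tau> * c"
  proof (rule U.integral_ge_const)
    show "integrable (uniform_measure lborel (ball 0 1)) D"
      by (rule integrable_uniform_ball[OF \<open>D \<in> borel_measurable borel\<close> bnd])
    have z0: "z \<in> A \<times> B" and r0: "r \<in> A \<times> B" using z[of 0] r[of 0] by simp_all
    have pt: "G (z + \<tau> *\<^sub>R u) \<bullet> w \<ge> c" if u: "norm u \<le> 1" for u
    proof -
      let ?v = "z + \<tau> *\<^sub>R u" and ?r = "r + \<tau> *\<^sub>R u"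
      have eq1: "(fst z, snd r) + \<tau> *\<^sub>R u = (fst ?v, snd ?r)" and eq2: "(fst r, snd z) + \<tau> *\<^sub>R u = (fst ?r, snd ?v)"
        by (simp_all add: prod_eq_iff)
      have "\<phi> (fst ?v, snd ?r) - \<phi> (fst ?r, snd ?v) \<le>
          G ?v \<bullet> (fst ?v - fst ?r, snd ?r - snd ?v) - \<mu> / 2 * (norm (?v - ?r))\<^sup>2"
        by (rule gap_le_inner_gradient[OF z[OF u] r[OF u]])
      moreover have "\<bar>\<phi> (fst ?v, snd ?r) - \<phi> (fst z, snd r)\<bar> \<le> \<tau> * M"
        unfolding eq1[symmetric]
      proof (rule shifted_lipschitz)
        show "(fst z, snd r) + \<tau> *\<^sub>R u \<in> A \<times> B"
          unfolding eq1 using z[OF u] r[OF u] by (simp add: mem_Times_iff)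
      qed (use z0 r0 u \<tau> in \<open>auto simp: mem_Times_iff\<close>)
      moreover have "\<bar>\<phi> (fst ?r, snd ?v) - \<phi> (fst r, snd z)\<bar> \<le> \<tau> * M"
        unfolding eq2[symmetric]
      proof (rule shifted_lipschitz)
        show "(fst r, snd z) + \<tau> *\<^sub>R u \<in> A \<times> B"
          unfolding eq2 using z[OF u] r[OF u] by (simp add: mem_Times_iff)
      qed (use z0 r0 u \<tau> in \<open>auto simp: mem_Times_iff\<close>)
      moreover have "(fst ?v - fst ?r, snd ?r - snd ?v) = w" "?v - ?r = z - r"
        by (simp_all add: w_def)
      ultimately show ?thesis unfolding c_def by simp
    qed
    have "2 * \<tau> * c \<le> D u" if u: "norm u < 1" for u
    proof -
      have "c + c \<le> G (z + \<tau> *\<^sub>R u) \<bullet> w + G (z - \<tau> *\<^sub>R u) \<bullet> w"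
        using pt[of u] pt[of "- u"] u by simp
      then have "\<tau> * (c + c) \<le> \<tau> * (G (z + \<tau> *\<^sub>R u) \<bullet> w + G (z - \<tau> *\<^sub>R u) \<bullet> w)"
        using \<tau> by (intro mult_left_mono) auto
      then show ?thesis by (simp add: D_eq[OF u] H_def inner_add_left algebra_simps)
    qed
    then show "AE u in uniform_measure lborel (ball 0 1). 2 * \<tau> * c \<le> D u"
      by (auto intro: eventually_mono[OF AE_uniform_ball])
  qed
  finally show ?thesis
    using \<tau> unfolding c_def[symmetric] w_def[symmetric] by (simp add: pos_le_divide_eq mult_ac)
qed

end

end

subsection \<open>Stochastic mirror descent\<close>

text \<open>Disjoint blocks of independent intersection-stable systems generate independent
  \<sigma>-algebras, to which \<open>X\<close> and \<open>Y\<close> are measurable. Working with set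
  systems lets one block mix vector-valued directions with real noises.\<close>

lemma (in prob_space) indep_var_blocks:
  assumes indep: "indep_sets F I" and stable: "\<And>i. i \<in> I \<Longrightarrow> Int_stable (F i)"
    and sub: "I1 \<subseteq> I" "I2 \<subseteq> I" and disj: "I1 \<inter> I2 = {}"
    and X: "X \<in> measurable (sigma (space M) (\<Union>i\<in>I1. F i)) S"
    and Y: "Y \<in> measurable (sigma (space M) (\<Union>i\<in>I2. F i)) T"
  shows "indep_var S X T Y"
proof -
  have ev: "F i \<subseteq> events" if "i \<in> I" for i
    using indep that by (auto simp: indep_sets_def)
  have F_pow: "(\<Union>i\<in>J. F i) \<subseteq> Pow (space M)" if "J \<subseteq> I" for J
    using ev that sets.sets_into_space by blast
  have pre: "Z -` C \<inter> space M \<in> sigma_sets (space M) (\<Union>i\<in>J. F i)"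
    if "Z \<in> measurable (sigma (space M) (\<Union>i\<in>J. F i)) N" "C \<in> sets N" "J \<subseteq> I" for Z J C and N :: "'x measure"
    using measurable_sets[OF that(1,2)] F_pow[OF that(3)] by (simp add: space_measure_of sets_measure_of)
  have rv: "Z \<in> measurable M N"
    if Z: "Z \<in> measurable (sigma (space M) (\<Union>i\<in>J. F i)) N" and J: "J \<subseteq> I" for Z J and N :: "'x measure"
  proof (rule measurableI)
    show "Z x \<in> space N" if "x \<in> space M" for x
      using measurable_space[OF Z] that F_pow[OF J] by (simp add: space_measure_of)
    show "Z -` C \<inter> space M \<in> events" if "C \<in> sets N" for C
    proof -
      have "sigma_sets (space M) (\<Union>i\<in>J. F i) \<subseteq> events"
        using ev J by (intro sets.sigma_sets_subset) auto
      then show ?thesis using pre[OF Z that J] by auto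
    qed
  qed
  have closed: "sigma_sets (space M) {Z -` C \<inter> space M |C. C \<in> sets N} \<subseteq> sigma_sets (space M) (\<Union>i\<in>J. F i)"
    if Z: "Z \<in> measurable (sigma (space M) (\<Union>i\<in>J. F i)) N" and J: "J \<subseteq> I" for Z J and N :: "'x measure"
    using pre[OF Z _ J] by (intro sigma_sets_mono) auto
  have "indep_sets (\<lambda>b. sigma_sets (space M) (\<Union>i\<in>case_bool I1 I2 b. F i)) UNIV"
  proof (rule indep_sets_collect_sigma)
    show "indep_sets F (\<Union>b. case_bool I1 I2 b)"
      by (rule indep_sets_mono_index[OF _ indep]) (use sub in \<open>auto split: bool.splits\<close>)
    show "disjoint_family (case_bool I1 I2)"
      using disj by (auto simp: disjoint_family_on_def split: bool.splits)
  qed (use stable sub in \<open>auto split: bool.splits\<close>)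
  then have "indep_set (sigma_sets (space M) {X -` C \<inter> space M |C. C \<in> sets S})
      (sigma_sets (space M) {Y -` C \<inter> space M |C. C \<in> sets T})"
    unfolding indep_set_def
  proof (rule indep_sets_mono_sets)
    show "case_bool (sigma_sets (space M) {X -` C \<inter> space M |C. C \<in> sets S})
        (sigma_sets (space M) {Y -` C \<inter> space M |C. C \<in> sets T}) b \<subseteq>
      sigma_sets (space M) (\<Union>i\<in>case_bool I1 I2 b. F i)" for b
      using closed[OF X sub(1)] closed[OF Y sub(2)] by (cases b) auto
  qed
  then show ?thesis
    unfolding indep_var_eq using rv[OF X sub(1)] rv[OF Y sub(2)] by simp
qed

text \<open>Independence makes the joint law a product, so Fubini integrates \<open>Y\<close> out
  with \<open>X\<close> frozen. This plays the part of conditioning on the current iterate.\<close>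

lemma (in prob_space) indep_var_expectation:
  fixes X :: "'a \<Rightarrow> 'b::topological_space" and Y :: "'a \<Rightarrow> 'b" and H :: "'b \<times> 'b \<Rightarrow> real"
  assumes indep: "indep_var borel X borel Y"
    and H [measurable]: "H \<in> borel_measurable (borel \<Otimes>\<^sub>M borel)"
    and int: "integrable M (\<lambda>\<omega>. H (X \<omega>, Y \<omega>))"
  shows "integrable M (\<lambda>\<omega>. \<integral>y. H (X \<omega>, y) \<partial>distr M borel Y)"
    and "expectation (\<lambda>\<omega>. H (X \<omega>, Y \<omega>)) = expectation (\<lambda>\<omega>. \<integral>y. H (X \<omega>, y) \<partial>distr M borel Y)"
proof -
  have X [measurable]: "X \<in> borel_measurable M" and Y [measurable]: "Y \<in> borel_measurable M"
    using indep by (auto dest: indep_var_rv1 indep_var_rv2)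
  interpret DX: prob_space "distr M borel X" by (rule prob_space_distr) simp
  interpret DY: prob_space "distr M borel Y" by (rule prob_space_distr) simp
  interpret XY: pair_prob_space "distr M borel X" "distr M borel Y" ..
  have eq: "distr M borel X \<Otimes>\<^sub>M distr M borel Y = distr M (borel \<Otimes>\<^sub>M borel) (\<lambda>\<omega>. (X \<omega>, Y \<omega>))"
    using indep indep_var_distribution_eq by blast
  have i: "integrable (distr M borel X \<Otimes>\<^sub>M distr M borel Y) H"
    unfolding eq using int by (subst integrable_distr_eq) auto
  have m: "(\<lambda>x. \<integral>y. H (x, y) \<partial>distr M borel Y) \<in> borel_measurable borel"
  proof (rule DY.borel_measurable_lebesgue_integral)
    have "sets (borel \<Otimes>\<^sub>M distr M borel Y) = sets (borel \<Otimes>\<^sub>M borel)"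
      by (intro sets_pair_measure_cong) auto
    from measurable_cong_sets[OF this refl] H
    have "H \<in> borel_measurable (borel \<Otimes>\<^sub>M distr M borel Y)" by blast
    then show "(\<lambda>(x, y). H (x, y)) \<in> borel_measurable (borel \<Otimes>\<^sub>M distr M borel Y)" by simp
  qed
  have "integrable (distr M borel X) (\<lambda>x. \<integral>y. H (x, y) \<partial>distr M borel Y)"
    by (rule XY.integrable_fst'[OF i])
  then show "integrable M (\<lambda>\<omega>. \<integral>y. H (X \<omega>, y) \<partial>distr M borel Y)"
    using m by (subst (asm) integrable_distr_eq) auto
  have "expectation (\<lambda>\<omega>. H (X \<omega>, Y \<omega>)) = (\<integral>p. H p \<partial>(distr M borel X \<Otimes>\<^sub>M distr M borel Y))"
    unfolding eq by (subst integral_distr) auto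
  also have "\<dots> = (\<integral>x. \<integral>y. H (x, y) \<partial>distr M borel Y \<partial>distr M borel X)"
    by (rule XY.integral_fst'[OF i, symmetric])
  also have "\<dots> = expectation (\<lambda>\<omega>. \<integral>y. H (X \<omega>, y) \<partial>distr M borel Y)"
    using m by (subst integral_distr) auto
  finally show "expectation (\<lambda>\<omega>. H (X \<omega>, Y \<omega>)) = expectation (\<lambda>\<omega>. \<integral>y. H (X \<omega>, y) \<partial>distr M borel Y)" .
qed

text \<open>Strictly earlier iterations only: the draws of iteration \<open>k\<close> do not belong
  to the past of \<open>z k\<close>.\<close>

definition draws_before :: "nat \<Rightarrow> draw set" where
  "draws_before k = Direction ` {..<k} \<union> Noise_plus ` {..<k} \<union> Noise_minus ` {..<k}"

lemma draws_before_mono: "j \<le> k \<Longrightarrow> draws_before j \<subseteq> draws_before k"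
  by (auto simp: draws_before_def)

lemma Int_stable_generated_events: "Int_stable (generated_events P f)"
proof (rule Int_stableI)
  fix a b assume "a \<in> generated_events P f" "b \<in> generated_events P f"
  then obtain A B where "a = f -` A \<inter> space P" "b = f -` B \<inter> space P" "A \<in> sets borel" "B \<in> sets borel"
    by (auto simp: generated_events_def)
  then have "a \<inter> b = f -` (A \<inter> B) \<inter> space P" "A \<inter> B \<in> sets borel" by auto
  then show "a \<inter> b \<in> generated_events P f" unfolding generated_events_def by blast
qed

lemma measurable_generated_events:
  assumes "generated_events P f \<subseteq> E" "E \<subseteq> Pow (space P)"
  shows "f \<in> borel_measurable (sigma (space P) E)"
proof (rule measurableI)
  fix A :: "'b set" assume "A \<in> sets borel"
  then have "f -` A \<inter> space P \<in> E" using assms(1) by (auto simp: generated_events_def)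
  then show "f -` A \<inter> space (sigma (space P) E) \<in> sets (sigma (space P) E)"
    using assms(2) by (simp add: space_measure_of sets_measure_of sigma_sets.Basic)
qed simp

text \<open>An abstract form of the recursion: \<open>D\<close> collects the deterministic part of
  the oracle difference, \<phi> and \<delta> together, \<open>\<kappa>\<close> is its scaling, and
  \<open>J\<close> the sign change in the second component. \<open>D\<close> is bounded everywhere,
  so unboundedness can come only from the noises. The recursion is asked on \<open>space P\<close>,
  where the directions have norm 1.\<close>

locale mirror_descent = prob_space P for P :: "'w measure" +
  fixes N :: nat and \<sigma> :: real and e :: "nat \<Rightarrow> 'w \<Rightarrow> 'a::euclidean_space" and \<xi>p \<xi>m :: "nat \<Rightarrow> 'w \<Rightarrow> real"
    and Z :: "'a set" and z :: "nat \<Rightarrow> 'w \<Rightarrow> 'a" and z0 :: 'a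
    and D :: "'a \<times> 'a \<Rightarrow> real" and J :: "'a \<Rightarrow> 'a" and \<gamma> :: "nat \<Rightarrow> real" and \<kappa> C :: real
  assumes sampling: "independent_sampling P N \<sigma> e \<xi>p \<xi>m"
    and Z: "compact Z" "convex Z" and z0: "z0 \<in> Z"
    and D [measurable]: "D \<in> borel_measurable (borel \<Otimes>\<^sub>M borel)" and D_bound: "\<And>p. \<bar>D p\<bar> \<le> C"
    and J [measurable]: "J \<in> borel_measurable borel" and J_norm: "\<And>v. norm (J v) = norm v"
    and z_0: "\<And>\<omega>. z 0 \<omega> = z0"
    and z_Suc: "\<And>k \<omega>. k \<le> N \<Longrightarrow> \<omega> \<in> space P \<Longrightarrow> z (Suc k) \<omega> = closest_point Z
      (z k \<omega> - \<gamma> k *\<^sub>R ((\<kappa> * (D (z k \<omega>, e k \<omega>) + \<xi>p k \<omega> - \<xi>m k \<omega>)) *\<^sub>R J (e k \<omega>)))"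
begin

definition events_of :: "draw \<Rightarrow> 'w set set" where
  "events_of d = (case d of Direction k \<Rightarrow> generated_events P (e k)
    | Noise_plus k \<Rightarrow> generated_events P (\<xi>p k) | Noise_minus k \<Rightarrow> generated_events P (\<xi>m k))"

text \<open>For \<open>draws_before k\<close> this is the usual filtration; other index sets add the
  direction of iteration \<open>k\<close> to the past or isolate a single draw.\<close>

definition history :: "draw set \<Rightarrow> 'w measure" where
  "history I = sigma (space P) (\<Union>d\<in>I. events_of d)"

lemma Z_closed: "closed Z" and Z_nonempty: "Z \<noteq> {}"
  using Z z0 by (auto intro: compact_imp_closed)

lemma
  assumes "k \<le> N"
  shows e_measurable [measurable]: "e k \<in> borel_measurable P"
    and e_distr: "distr P borel (e k) = uniform_sphere"
    and e_norm: "\<And>\<omega>. \<omega> \<in> space P \<Longrightarrow> norm (e k \<omega>) = 1"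
    and noise: "centered_noise P \<sigma> (\<xi>p k)" "centered_noise P \<sigma> (\<xi>m k)"
  using sampling assms by (auto simp: independent_sampling_def)

lemma events_of_Pow: "events_of d \<subseteq> Pow (space P)"
  by (auto simp: events_of_def generated_events_def split: draw.splits)

lemma history_mono: "I \<subseteq> I' \<Longrightarrow> measurable (history I) K \<subseteq> measurable (history I') K"
  unfolding history_def using events_of_Pow by (intro measurable_mono1) auto

lemma space_history [simp]: "space (history I) = space P"
  unfolding history_def using events_of_Pow by (intro space_measure_of) auto

lemma
  shows e_history: "Direction k \<in> I \<Longrightarrow> e k \<in> borel_measurable (history I)"
    and \<xi>p_history: "Noise_plus k \<in> I \<Longrightarrow> \<xi>p k \<in> borel_measurable (history I)"
    and \<xi>m_history: "Noise_minus k \<in> I \<Longrightarrow> \<xi>m k \<in> borel_measurable (history I)"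
  unfolding history_def using events_of_Pow
  by (auto intro!: measurable_generated_events simp: events_of_def split: draw.splits)

lemma indep_events: "indep_sets events_of (draws_before (Suc N))"
  using sampling by (simp add: independent_sampling_def events_of_def[abs_def] draws_before_def lessThan_Suc_atMost)

lemma indep_history:
  assumes "I1 \<inter> I2 = {}" "I1 \<subseteq> draws_before (Suc N)" "I2 \<subseteq> draws_before (Suc N)"
    "X \<in> measurable (history I1) S" "Y \<in> measurable (history I2) T"
  shows "indep_var S X T Y"
proof (rule indep_var_blocks[OF indep_events _ assms(2,3,1)])
  show "Int_stable (events_of d)" for d
    by (auto simp: events_of_def Int_stable_generated_events split: draw.splits)
qed (use assms(4,5) in \<open>auto simp: history_def\<close>)

lemma z_in: "k \<le> Suc N \<Longrightarrow> \<omega> \<in> space P \<Longrightarrow> z k \<omega> \<in> Z"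
  by (cases k) (auto simp: z_0 z0 z_Suc closest_point_in_set Z_closed Z_nonempty)

lemma z_history: "k \<le> Suc N \<Longrightarrow> z k \<in> borel_measurable (history (draws_before k))"
proof (induction k)
  case 0
  have "z 0 = (\<lambda>_. z0)" by (auto simp: z_0)
  then show ?case by simp
next
  case (Suc k)
  let ?I = "draws_before (Suc k)"
  have [measurable]: "z k \<in> borel_measurable (history ?I)"
    using Suc history_mono[OF draws_before_mono[of k "Suc k"]] by auto
  have [measurable]: "e k \<in> borel_measurable (history ?I)" "\<xi>p k \<in> borel_measurable (history ?I)"
      "\<xi>m k \<in> borel_measurable (history ?I)"
    by (auto intro!: e_history \<xi>p_history \<xi>m_history simp: draws_before_def)
  have [measurable]: "closest_point Z \<in> borel_measurable borel"
    by (intro borel_measurable_continuous_onI continuous_on_closest_point Z Z_closed Z_nonempty)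
  have "(\<lambda>\<omega>. closest_point Z (z k \<omega> - \<gamma> k *\<^sub>R
      ((\<kappa> * (D (z k \<omega>, e k \<omega>) + \<xi>p k \<omega> - \<xi>m k \<omega>)) *\<^sub>R J (e k \<omega>)))) \<in> borel_measurable (history ?I)"
    by measurable
  then show ?case
    by (subst measurable_cong) (use Suc.prems z_Suc in auto)
qed

lemma history_subalgebra: "I \<subseteq> draws_before (Suc N) \<Longrightarrow> measurable (history I) K \<subseteq> measurable P K"
proof -
  assume I: "I \<subseteq> draws_before (Suc N)"
  have "(\<Union>d\<in>I. events_of d) \<subseteq> events"
    using I indep_events unfolding indep_sets_def by blast
  then have "sigma_sets (space P) (\<Union>d\<in>I. events_of d) \<subseteq> events"
    by (rule sets.sigma_sets_subset)
  moreover have "sets (history I) = sigma_sets (space P) (\<Union>d\<in>I. events_of d)"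
    unfolding history_def using events_of_Pow by (intro sets_measure_of) auto
  ultimately have "sets (history I) \<subseteq> events" by simp
  then show ?thesis by (intro measurable_mono) auto
qed

lemma z_measurable [measurable]: "k \<le> Suc N \<Longrightarrow> z k \<in> borel_measurable P"
  using z_history history_subalgebra[OF draws_before_mono] by blast

text \<open>The iterate \<open>z k\<close> is determined by the draws of earlier iterations, to
  which \<open>e k\<close> does not belong. Either noise of iteration \<open>k\<close> lies outside
  the block made of that past and \<open>e k\<close>, hence is independent of every measurable
  function of the two jointly.\<close>

lemma
  assumes "k \<le> N"
  shows indep_z_e: "indep_var borel (z k) borel (e k)"
    and indep_noise_plus: "h \<in> borel_measurable (borel \<Otimes>\<^sub>M borel) \<Longrightarrow> indep_var borel (\<lambda>\<omega>. h (z k \<omega>, e k \<omega>) :: real) borel (\<xi>p k)"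
    and indep_noise_minus: "h \<in> borel_measurable (borel \<Otimes>\<^sub>M borel) \<Longrightarrow> indep_var borel (\<lambda>\<omega>. h (z k \<omega>, e k \<omega>) :: real) borel (\<xi>m k)"
proof -
  let ?I = "insert (Direction k) (draws_before k)"
  have sub: "draws_before k \<subseteq> draws_before (Suc N)" "?I \<subseteq> draws_before (Suc N)"
    "{Direction k} \<subseteq> draws_before (Suc N)" "{Noise_plus k} \<subseteq> draws_before (Suc N)" "{Noise_minus k} \<subseteq> draws_before (Suc N)"
    using assms by (auto simp: draws_before_def)
  have disj: "draws_before k \<inter> {Direction k} = {}" "?I \<inter> {Noise_plus k} = {}" "?I \<inter> {Noise_minus k} = {}"
    by (auto simp: draws_before_def)
  have zk: "z k \<in> borel_measurable (history (draws_before k))"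
    using assms by (intro z_history) simp
  have "z k \<in> borel_measurable (history ?I)"
    using zk history_mono[of "draws_before k" ?I] by auto
  then have ze: "(\<lambda>\<omega>. h (z k \<omega>, e k \<omega>)) \<in> borel_measurable (history ?I)"
    if "h \<in> borel_measurable (borel \<Otimes>\<^sub>M borel)" for h :: "'a \<times> 'a \<Rightarrow> real"
    using that by (intro measurable_compose[OF _ that] measurable_Pair e_history) auto
  show "indep_var borel (z k) borel (e k)"
    by (rule indep_history[OF disj(1) sub(1,3) zk e_history]) simp
  show "indep_var borel (\<lambda>\<omega>. h (z k \<omega>, e k \<omega>) :: real) borel (\<xi>p k)"
    if "h \<in> borel_measurable (borel \<Otimes>\<^sub>M borel)"
    by (rule indep_history[OF disj(2) sub(2,4) ze[OF that] \<xi>p_history]) simp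
  show "indep_var borel (\<lambda>\<omega>. h (z k \<omega>, e k \<omega>) :: real) borel (\<xi>m k)"
    if "h \<in> borel_measurable (borel \<Otimes>\<^sub>M borel)"
    by (rule indep_history[OF disj(3) sub(2,5) ze[OF that] \<xi>m_history]) simp
qed

end

context mirror_descent
begin

section \<open>Recursion for the distance to a reference point\<close>

context
  fixes u :: 'a and gap :: "'a \<Rightarrow> real" and \<mu> \<beta> V K :: real
  assumes u: "u \<in> Z" and gap [measurable]: "gap \<in> borel_measurable borel"
    and gap_bound: "\<And>v. v \<in> Z \<Longrightarrow> \<bar>gap v\<bar> \<le> K"
    and second_moment: "\<And>v. v \<in> Z \<Longrightarrow> (\<integral>e. (D (v, e))\<^sup>2 \<partial>uniform_sphere) \<le> V"
    and descent: "\<And>v. v \<in> Z \<Longrightarrow> gap v + \<mu> / 2 * (norm (v - u))\<^sup>2 - \<beta> \<le>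
      \<kappa> * (\<integral>e. D (v, e) * (J e \<bullet> (v - u)) \<partial>uniform_sphere)"
begin

lemma integrable_gap: "k \<le> Suc N \<Longrightarrow> integrable P (\<lambda>\<omega>. gap (z k \<omega>))"
  by (rule integrable_const_bound[where B = K])
    (auto intro!: AE_I2 gap_bound z_in measurable_compose[OF z_measurable])

lemma distance_bound:
  obtains R where "R \<ge> 0" "\<And>v. v \<in> Z \<Longrightarrow> norm (v - u) \<le> R"
proof -
  obtain R where "\<And>v. v \<in> Z \<Longrightarrow> norm v \<le> R"
    using Z(1) compact_imp_bounded bounded_iff by metis
  then have "\<And>v. v \<in> Z \<Longrightarrow> norm (v - u) \<le> R + R" "R \<ge> 0"
    using norm_triangle_le_diff u norm_ge_zero order_trans
    by (metis add_mono, meson)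
  then show ?thesis using that[of "R + R"] by simp
qed

lemma integrable_distance: "k \<le> Suc N \<Longrightarrow> integrable P (\<lambda>\<omega>. (norm (z k \<omega> - u))\<^sup>2)"
proof -
  assume k: "k \<le> Suc N"
  have [measurable]: "z k \<in> borel_measurable P" using k by (rule z_measurable)
  obtain R where "R \<ge> 0" "\<And>v. v \<in> Z \<Longrightarrow> norm (v - u) \<le> R" using distance_bound by blast
  then show ?thesis
    using z_in[OF k] by (intro integrable_const_bound[where B = "R\<^sup>2"]) (auto intro!: AE_I2 power_mono)
qed

text \<open>The projection is nonexpansive and fixes \<open>u\<close>, so the squared distance after
  the step is at most that of the unprojected point. In its expansion the mixed terms with a noise
  have mean 0 by independence, and the direction is integrated out with the iterate frozen, which
  brings in \<open>second_moment\<close> and \<open>descent\<close>.\<close>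

lemma one_step:
  assumes k: "k \<le> N" and \<gamma>: "\<gamma> k \<ge> 0"
  shows "expectation (\<lambda>\<omega>. (norm (z (Suc k) \<omega> - u))\<^sup>2) \<le>
    expectation (\<lambda>\<omega>. (norm (z k \<omega> - u))\<^sup>2)
      - 2 * \<gamma> k * (expectation (\<lambda>\<omega>. gap (z k \<omega>)) + \<mu> / 2 * expectation (\<lambda>\<omega>. (norm (z k \<omega> - u))\<^sup>2) - \<beta>)
      + (\<gamma> k)\<^sup>2 * (\<kappa>\<^sup>2 * (V + 4 * \<sigma>\<^sup>2))"
proof -
  have [measurable]: "z k \<in> borel_measurable P" "e k \<in> borel_measurable P"
    using k by (auto intro: z_measurable e_measurable)
  note np = noise(1)[OF k, unfolded centered_noise_def] and nm = noise(2)[OF k, unfolded centered_noise_def]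
  have [measurable]: "\<xi>p k \<in> borel_measurable P" "\<xi>m k \<in> borel_measurable P" using np nm by auto
  have zZ: "z k \<omega> \<in> Z" if "\<omega> \<in> space P" for \<omega> using z_in[of k] k that by simp
  obtain R where R: "R \<ge> 0" "\<And>v. v \<in> Z \<Longrightarrow> norm (v - u) \<le> R" using distance_bound by blast
  define hb where "hb p = J (snd p) \<bullet> (fst p - u)" for p
  have [measurable]: "hb \<in> borel_measurable (borel \<Otimes>\<^sub>M borel)" unfolding hb_def by measurable
  define a where "a \<omega> = D (z k \<omega>, e k \<omega>)" for \<omega>
  define b where "b \<omega> = hb (z k \<omega>, e k \<omega>)" for \<omega>
  have [measurable]: "a \<in> borel_measurable P" "b \<in> borel_measurable P" unfolding a_def b_def by measurable
  have a_le: "\<bar>a \<omega>\<bar> \<le> C" for \<omega> by (simp add: a_def D_bound)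
  then have "C \<ge> 0" using abs_ge_zero order_trans by blast
  have b_le: "\<bar>b \<omega>\<bar> \<le> R" if "\<omega> \<in> space P" for \<omega>
    using Cauchy_Schwarz_ineq2[of "J (e k \<omega>)" "z k \<omega> - u"] R(2)[OF zZ[OF that]] e_norm[OF k that]
    by (simp add: b_def hb_def J_norm)
  have int_bounded: "integrable P X" if "X \<in> borel_measurable P" "\<And>\<omega>. \<omega> \<in> space P \<Longrightarrow> \<bar>X \<omega>\<bar> \<le> c"
    for X :: "'w \<Rightarrow> real" and c :: real
    using that by (intro integrable_const_bound[where B = c]) (auto intro!: AE_I2)
  have ia: "integrable P a" by (rule int_bounded[of _ C]) (auto simp: a_le)
  have ia2: "integrable P (\<lambda>\<omega>. (a \<omega>)\<^sup>2)"
    using a_le \<open>C \<ge> 0\<close> abs_le_square_iff[of _ C] by (intro int_bounded[of _ "C\<^sup>2"]) auto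
  have ib: "integrable P b" by (rule int_bounded[of _ R]) (auto simp: b_le)
  have iab: "integrable P (\<lambda>\<omega>. a \<omega> * b \<omega>)"
    using a_le b_le \<open>C \<ge> 0\<close> by (intro int_bounded[of _ "C * R"]) (auto simp: abs_mult intro!: mult_mono)
  have p: "integrable P (\<xi>p k)" "integrable P (\<lambda>\<omega>. (\<xi>p k \<omega>)\<^sup>2)" "expectation (\<xi>p k) = 0"
      "expectation (\<lambda>\<omega>. (\<xi>p k \<omega>)\<^sup>2) \<le> \<sigma>\<^sup>2"
    and m: "integrable P (\<xi>m k)" "integrable P (\<lambda>\<omega>. (\<xi>m k \<omega>)\<^sup>2)" "expectation (\<xi>m k) = 0"
      "expectation (\<lambda>\<omega>. (\<xi>m k \<omega>)\<^sup>2) \<le> \<sigma>\<^sup>2"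
    using np nm by auto
  have indep: "indep_var borel a borel (\<xi>p k)" "indep_var borel a borel (\<xi>m k)"
      "indep_var borel b borel (\<xi>p k)" "indep_var borel b borel (\<xi>m k)"
    unfolding a_def b_def by (auto intro!: indep_noise_plus indep_noise_minus k)
  have i: "integrable P (\<lambda>\<omega>. a \<omega> * \<xi>p k \<omega>)" "integrable P (\<lambda>\<omega>. a \<omega> * \<xi>m k \<omega>)"
      "integrable P (\<lambda>\<omega>. b \<omega> * \<xi>p k \<omega>)" "integrable P (\<lambda>\<omega>. b \<omega> * \<xi>m k \<omega>)"
    using indep_var_integrable[OF indep(1) ia p(1)] indep_var_integrable[OF indep(2) ia m(1)]
      indep_var_integrable[OF indep(3) ib p(1)] indep_var_integrable[OF indep(4) ib m(1)] .
  have E0: "expectation (\<lambda>\<omega>. a \<omega> * \<xi>p k \<omega>) = 0" "expectation (\<lambda>\<omega>. a \<omega> * \<xi>m k \<omega>) = 0"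
      "expectation (\<lambda>\<omega>. b \<omega> * \<xi>p k \<omega>) = 0" "expectation (\<lambda>\<omega>. b \<omega> * \<xi>m k \<omega>) = 0"
    using indep_var_lebesgue_integral[OF indep(1) ia p(1)] indep_var_lebesgue_integral[OF indep(2) ia m(1)]
      indep_var_lebesgue_integral[OF indep(3) ib p(1)] indep_var_lebesgue_integral[OF indep(4) ib m(1)]
    by (simp_all add: p(3) m(3))
  have "expectation (\<lambda>\<omega>. (a \<omega>)\<^sup>2) = expectation (\<lambda>\<omega>. \<integral>y. (D (z k \<omega>, y))\<^sup>2 \<partial>uniform_sphere)"
    and "integrable P (\<lambda>\<omega>. \<integral>y. (D (z k \<omega>, y))\<^sup>2 \<partial>uniform_sphere)"
    using indep_var_expectation[OF indep_z_e[OF k], of "\<lambda>p. (D p)\<^sup>2"] ia2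
    by (simp_all add: a_def e_distr[OF k])
  then have Ea2: "expectation (\<lambda>\<omega>. (a \<omega>)\<^sup>2) \<le> V"
    using zZ by (auto intro!: integral_le_const AE_I2 second_moment)
  have "expectation (\<lambda>\<omega>. a \<omega> * b \<omega>) = expectation (\<lambda>\<omega>. \<integral>y. D (z k \<omega>, y) * (J y \<bullet> (z k \<omega> - u)) \<partial>uniform_sphere)"
    and iH: "integrable P (\<lambda>\<omega>. \<integral>y. D (z k \<omega>, y) * (J y \<bullet> (z k \<omega> - u)) \<partial>uniform_sphere)"
    using indep_var_expectation[OF indep_z_e[OF k], of "\<lambda>p. D p * hb p"] iab
    by (simp_all add: a_def b_def hb_def e_distr[OF k])
  then have Eab_eq: "\<kappa> * expectation (\<lambda>\<omega>. a \<omega> * b \<omega>) =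
      expectation (\<lambda>\<omega>. \<kappa> * (\<integral>y. D (z k \<omega>, y) * (J y \<bullet> (z k \<omega> - u)) \<partial>uniform_sphere))"
    by simp
  have ig: "integrable P (\<lambda>\<omega>. gap (z k \<omega>))" "integrable P (\<lambda>\<omega>. (norm (z k \<omega> - u))\<^sup>2)"
    using k by (auto intro!: integrable_gap integrable_distance)
  have "expectation (\<lambda>\<omega>. gap (z k \<omega>)) + \<mu> / 2 * expectation (\<lambda>\<omega>. (norm (z k \<omega> - u))\<^sup>2) - \<beta> =
      expectation (\<lambda>\<omega>. gap (z k \<omega>) + \<mu> / 2 * (norm (z k \<omega> - u))\<^sup>2 - \<beta>)"
    using ig prob_space by simp
  also have "\<dots> \<le> \<kappa> * expectation (\<lambda>\<omega>. a \<omega> * b \<omega>)"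
    unfolding Eab_eq
  proof (rule integral_mono)
    show "integrable P (\<lambda>\<omega>. gap (z k \<omega>) + \<mu> / 2 * (norm (z k \<omega> - u))\<^sup>2 - \<beta>)"
      using ig by simp
    show "integrable P (\<lambda>\<omega>. \<kappa> * (\<integral>y. D (z k \<omega>, y) * (J y \<bullet> (z k \<omega> - u)) \<partial>uniform_sphere))"
      using iH by simp
  qed (rule descent, rule zZ)
  finally have Eab: "expectation (\<lambda>\<omega>. gap (z k \<omega>)) + \<mu> / 2 * expectation (\<lambda>\<omega>. (norm (z k \<omega> - u))\<^sup>2) - \<beta> \<le>
      \<kappa> * expectation (\<lambda>\<omega>. a \<omega> * b \<omega>)" .
  have total: "expectation (\<lambda>\<omega>. (a \<omega>)\<^sup>2) + 2 * expectation (\<lambda>\<omega>. (\<xi>p k \<omega>)\<^sup>2) + 2 * expectation (\<lambda>\<omega>. (\<xi>m k \<omega>)\<^sup>2) \<le> V + 4 * \<sigma>\<^sup>2"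
    using Ea2 p(4) m(4) by linarith
  \<comment> \<open>A pathwise bound for the new squared distance that contains no product of the
    two noises, so the expectation of every term is known or bounded.\<close>
  define T where "T \<omega> = (norm (z k \<omega> - u))\<^sup>2 - 2 * \<gamma> k * \<kappa> * (a \<omega> * b \<omega> + b \<omega> * \<xi>p k \<omega> - b \<omega> * \<xi>m k \<omega>) +
      (\<gamma> k)\<^sup>2 * \<kappa>\<^sup>2 * ((a \<omega>)\<^sup>2 + 2 * (a \<omega> * \<xi>p k \<omega>) - 2 * (a \<omega> * \<xi>m k \<omega>) + 2 * (\<xi>p k \<omega>)\<^sup>2 + 2 * (\<xi>m k \<omega>)\<^sup>2)" for \<omega>
  have "(norm (z (Suc k) \<omega> - u))\<^sup>2 \<le> T \<omega>" if \<omega>: "\<omega> \<in> space P" for \<omega>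
  proof -
    define s where "s = a \<omega> + \<xi>p k \<omega> - \<xi>m k \<omega>"
    let ?g = "(\<kappa> * s) *\<^sub>R J (e k \<omega>)"
    have "norm (z (Suc k) \<omega> - u) \<le> norm (z k \<omega> - \<gamma> k *\<^sub>R ?g - u)"
      using closest_point_lipschitz[OF Z(2) Z_closed Z_nonempty, of "z k \<omega> - \<gamma> k *\<^sub>R ?g" u] z_Suc[OF k \<omega>]
      by (simp add: closest_point_self[OF u] dist_norm s_def a_def)
    then have "(norm (z (Suc k) \<omega> - u))\<^sup>2 \<le> (norm ((z k \<omega> - u) - (\<gamma> k * \<kappa> * s) *\<^sub>R J (e k \<omega>)))\<^sup>2"
      by (intro power_mono) (simp_all add: algebra_simps)
    also have "\<dots> = (norm (z k \<omega> - u))\<^sup>2 - 2 * (\<gamma> k * \<kappa> * s) * b \<omega> + (\<gamma> k * \<kappa> * s)\<^sup>2"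
    proof -
      have "J (e k \<omega>) \<bullet> J (e k \<omega>) = 1"
        using e_norm[OF k \<omega>] by (simp add: dot_square_norm J_norm)
      then show ?thesis
        unfolding power2_norm_eq_inner b_def hb_def fst_conv snd_conv
        by (simp add: inner_diff_left inner_diff_right inner_commute power2_eq_square algebra_simps)
    qed
    also have "\<dots> = (norm (z k \<omega> - u))\<^sup>2 - 2 * \<gamma> k * \<kappa> * (a \<omega> * b \<omega> + b \<omega> * \<xi>p k \<omega> - b \<omega> * \<xi>m k \<omega>) + (\<gamma> k)\<^sup>2 * \<kappa>\<^sup>2 * s\<^sup>2"
      by (simp add: s_def power2_eq_square algebra_simps)
    also have "\<dots> \<le> T \<omega>"
    proof -
      \<comment> \<open>This bounds the product of the noises by their squares; the resulting
        doubling is the origin of \<open>4 * \<sigma>\<^sup>2\<close>.\<close>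
      have "0 \<le> (\<xi>p k \<omega> + \<xi>m k \<omega>)\<^sup>2" by simp
      then have "s\<^sup>2 \<le> (a \<omega>)\<^sup>2 + 2 * (a \<omega> * \<xi>p k \<omega>) - 2 * (a \<omega> * \<xi>m k \<omega>) + 2 * (\<xi>p k \<omega>)\<^sup>2 + 2 * (\<xi>m k \<omega>)\<^sup>2"
        by (simp add: s_def power2_eq_square algebra_simps)
      then have "(\<gamma> k)\<^sup>2 * \<kappa>\<^sup>2 * s\<^sup>2 \<le> (\<gamma> k)\<^sup>2 * \<kappa>\<^sup>2 * ((a \<omega>)\<^sup>2 + 2 * (a \<omega> * \<xi>p k \<omega>) - 2 * (a \<omega> * \<xi>m k \<omega>) + 2 * (\<xi>p k \<omega>)\<^sup>2 + 2 * (\<xi>m k \<omega>)\<^sup>2)"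
        by (rule mult_left_mono) simp
      then show ?thesis unfolding T_def by linarith
    qed
    finally show ?thesis .
  qed
  moreover have iT: "integrable P T"
    unfolding T_def using k i ia2 iab p(2) m(2) integrable_distance[of k] by simp
  ultimately have "expectation (\<lambda>\<omega>. (norm (z (Suc k) \<omega> - u))\<^sup>2) \<le> expectation T"
    using k integrable_distance[of "Suc k"] by (intro integral_mono) auto
  also have "expectation T = expectation (\<lambda>\<omega>. (norm (z k \<omega> - u))\<^sup>2)
      - 2 * \<gamma> k * (\<kappa> * expectation (\<lambda>\<omega>. a \<omega> * b \<omega>))
      + (\<gamma> k)\<^sup>2 * \<kappa>\<^sup>2 * (expectation (\<lambda>\<omega>. (a \<omega>)\<^sup>2) + 2 * expectation (\<lambda>\<omega>. (\<xi>p k \<omega>)\<^sup>2) + 2 * expectation (\<lambda>\<omega>. (\<xi>m k \<omega>)\<^sup>2))"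
    unfolding T_def using k i ia2 iab p(2) m(2) integrable_distance[of k] E0 by simp
  also have "\<dots> \<le> expectation (\<lambda>\<omega>. (norm (z k \<omega> - u))\<^sup>2)
      - 2 * \<gamma> k * (expectation (\<lambda>\<omega>. gap (z k \<omega>)) + \<mu> / 2 * expectation (\<lambda>\<omega>. (norm (z k \<omega> - u))\<^sup>2) - \<beta>)
      + (\<gamma> k)\<^sup>2 * \<kappa>\<^sup>2 * (V + 4 * \<sigma>\<^sup>2)"
    using \<gamma> by (intro add_mono[OF diff_mono[OF order_refl mult_left_mono[OF Eab]] mult_left_mono[OF total]]) auto
  finally show ?thesis by (simp only: mult.assoc)
qed

text \<open>Multiply the one-step bound by \<open>\<mu> * (k + 1) / 2\<close>. The strong convexity
  term takes \<open>\<mu> / 2\<close> off the coefficient of the old distance, so the old and new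
  distances carry \<open>\<mu> * k / 2\<close> and \<open>\<mu> * (k + 1) / 2\<close> and the sum
  telescopes. At \<open>k = 0\<close> the coefficient is 0, so the initial distance leaves no
  trace.\<close>

lemma sum_gap_le:
  assumes "\<mu> > 0" and \<gamma>: "\<And>k. \<gamma> k = 1 / (\<mu> * (real k + 1))"
  shows "(\<Sum>k\<le>N. expectation (\<lambda>\<omega>. gap (z k \<omega>))) \<le>
    \<kappa>\<^sup>2 * (V + 4 * \<sigma>\<^sup>2) / (2 * \<mu>) * (\<Sum>k\<le>N. 1 / (real k + 1)) + (real N + 1) * \<beta>"
proof -
  define d where "d k = expectation (\<lambda>\<omega>. (norm (z k \<omega> - u))\<^sup>2)" for k
  define Q where "Q = \<kappa>\<^sup>2 * (V + 4 * \<sigma>\<^sup>2)"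
  have step: "expectation (\<lambda>\<omega>. gap (z k \<omega>)) \<le>
      Q / (2 * \<mu>) * (1 / (real k + 1)) + \<beta> + (\<mu> / 2 * (real k * d k) - \<mu> / 2 * (real (Suc k) * d (Suc k)))" if "k \<le> N" for k
  proof -
    define c where "c = real k + 1"
    have "c > 0" by (simp add: c_def)
    have gc: "\<gamma> k = 1 / (\<mu> * c)" by (simp add: \<gamma> c_def)
    define g where "g = expectation (\<lambda>\<omega>. gap (z k \<omega>))"
    have "d (Suc k) \<le> d k - 2 * \<gamma> k * (g + \<mu> / 2 * d k - \<beta>) + (\<gamma> k)\<^sup>2 * Q"
      using one_step[OF that] \<open>\<mu> > 0\<close> unfolding d_def Q_def g_def \<gamma> by simp
    then have "\<mu> * c / 2 * d (Suc k) \<le> \<mu> * c / 2 * (d k - 2 * \<gamma> k * (g + \<mu> / 2 * d k - \<beta>) + (\<gamma> k)\<^sup>2 * Q)"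
      using \<open>\<mu> > 0\<close> \<open>c > 0\<close> by (intro mult_left_mono) auto
    also have "\<dots> = \<mu> * c / 2 * d k - (g + \<mu> / 2 * d k - \<beta>) + Q / (2 * \<mu>) * (1 / c)"
      using \<open>\<mu> > 0\<close> \<open>c > 0\<close> unfolding gc by (simp add: field_simps power2_eq_square)
    finally have "g \<le> Q / (2 * \<mu>) * (1 / c) + \<beta> + (\<mu> / 2 * ((c - 1) * d k) - \<mu> / 2 * (c * d (Suc k)))"
      by (simp add: algebra_simps)
    then show ?thesis by (simp add: g_def c_def add.commute)
  qed
  have "(\<Sum>k\<le>N. expectation (\<lambda>\<omega>. gap (z k \<omega>))) \<le>
      (\<Sum>k\<le>N. Q / (2 * \<mu>) * (1 / (real k + 1)) + \<beta> + (\<mu> / 2 * (real k * d k) - \<mu> / 2 * (real (Suc k) * d (Suc k))))"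
    by (intro sum_mono step) simp
  also have "\<dots> = Q / (2 * \<mu>) * (\<Sum>k\<le>N. 1 / (real k + 1)) + (real N + 1) * \<beta> +
      (\<Sum>k\<le>N. \<mu> / 2 * (real k * d k) - \<mu> / 2 * (real (Suc k) * d (Suc k)))"
    by (simp add: sum.distrib sum_distrib_left add.commute)
  also have "(\<Sum>k\<le>N. \<mu> / 2 * (real k * d k) - \<mu> / 2 * (real (Suc k) * d (Suc k))) = - (\<mu> / 2 * (real (Suc N) * d (Suc N)))"
    by (subst sum_telescope) simp
  also have "\<dots> \<le> 0"
    using \<open>\<mu> > 0\<close> by (simp add: d_def)
  finally show ?thesis by (simp add: Q_def)
qed

end

end

subsection \<open>The rate of convergence\<close>

context saddle_problem
begin

text \<open>Jensen's inequality in first-order form: the gradients are taken at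
  \<open>(fst zbar, snd r)\<close> and \<open>(fst r, snd zbar)\<close>, the same points for all
  \<open>k\<close>, so the linear terms sum to 0 by the choice of \<open>zbar\<close>.\<close>

lemma average_gap_le:
  fixes zs :: "nat \<Rightarrow> 'a \<times> 'b"
  assumes zs: "\<And>k. k \<le> N \<Longrightarrow> zs k \<in> A \<times> B" and r: "r \<in> A \<times> B" and "\<mu> \<ge> 0"
    and zbar: "zbar = (1 / (real N + 1)) *\<^sub>R (\<Sum>k\<le>N. zs k)" "zbar \<in> A \<times> B"
  shows "\<phi> (fst zbar, snd r) - \<phi> (fst r, snd zbar) \<le>
    (\<Sum>k\<le>N. \<phi> (fst (zs k), snd r) - \<phi> (fst r, snd (zs k))) / (real N + 1)"
proof -
  let ?gx = "fst (G (fst zbar, snd r))" and ?gy = "snd (G (fst r, snd zbar))"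
  have mem: "(fst zbar, snd r) \<in> A \<times> B" "(fst r, snd zbar) \<in> A \<times> B"
    using zbar(2) r by (auto simp: mem_Times_iff)
  have nn: "0 \<le> \<mu> / 2 * (norm v)\<^sup>2" for v :: "'c::real_normed_vector"
    using \<open>\<mu> \<ge> 0\<close> by simp
  have "(\<Sum>k\<le>N. zs k - zbar) = (\<Sum>k\<le>N. zs k) - (real N + 1) *\<^sub>R zbar"
    by (simp add: sum_subtractf sum_constant_scaleR add.commute)
  also have "\<dots> = 0"
    by (simp add: zbar(1) add_eq_0_iff)
  finally have zero: "(\<Sum>k\<le>N. zs k - zbar) = 0" .
  have zero': "(\<Sum>k\<le>N. fst (zs k) - fst zbar) = 0" "(\<Sum>k\<le>N. snd (zs k) - snd zbar) = 0"
    using arg_cong[OF zero, of fst] arg_cong[OF zero, of snd] by (simp_all add: fst_sum snd_sum)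
  have "\<phi> (fst zbar, snd r) - \<phi> (fst r, snd zbar) + ?gx \<bullet> (fst (zs k) - fst zbar) - ?gy \<bullet> (snd (zs k) - snd zbar) \<le>
      \<phi> (fst (zs k), snd r) - \<phi> (fst r, snd (zs k))" if "k \<le> N" for k
  proof -
    have m: "fst (zs k) \<in> A" "snd (zs k) \<in> B" using zs[OF that] by (auto simp: mem_Times_iff)
    show ?thesis
      using G_convex[OF mem(1) m(1)] G_concave[OF mem(2) m(2)] nn[of "fst (zs k) - fst zbar"] nn[of "snd (zs k) - snd zbar"]
      by simp
  qed
  then have "(\<Sum>k\<le>N. \<phi> (fst zbar, snd r) - \<phi> (fst r, snd zbar) + ?gx \<bullet> (fst (zs k) - fst zbar) - ?gy \<bullet> (snd (zs k) - snd zbar)) \<le>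
      (\<Sum>k\<le>N. \<phi> (fst (zs k), snd r) - \<phi> (fst r, snd (zs k)))"
    by (intro sum_mono) simp
  moreover have "(\<Sum>k\<le>N. \<phi> (fst zbar, snd r) - \<phi> (fst r, snd zbar) + ?gx \<bullet> (fst (zs k) - fst zbar) - ?gy \<bullet> (snd (zs k) - snd zbar)) =
      (real N + 1) * (\<phi> (fst zbar, snd r) - \<phi> (fst r, snd zbar)) +
      ?gx \<bullet> (\<Sum>k\<le>N. fst (zs k) - fst zbar) - ?gy \<bullet> (\<Sum>k\<le>N. snd (zs k) - snd zbar)"
    by (simp only: sum.distrib sum_subtractf[of _ "\<lambda>k. ?gy \<bullet> (snd (zs k) - snd zbar)"] inner_sum_right) (simp add: add.commute)
  ultimately show ?thesis
    by (simp add: zero' pos_le_divide_eq mult.commute)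
qed

end

text \<open>\<open>ln t \<le> t - 1\<close> at \<open>t = (N + 1) / (N + 2)\<close> bounds the new
  summand \<open>1 / (N + 2)\<close> by the increment of the logarithm.\<close>

lemma harmonic_le_ln: "(\<Sum>k\<le>N. 1 / (real k + 1)) \<le> 1 + ln (real N + 1)"
proof (induction N)
  case (Suc N)
  have "1 - 1 / ((real N + 2) / (real N + 1)) \<le> ln ((real N + 2) / (real N + 1))"
    using ln_le_minus_one[of "(real N + 1) / (real N + 2)"] by (simp add: ln_div)
  moreover have "1 - 1 / ((real N + 2) / (real N + 1)) = 1 / (real (Suc N) + 1)"
    by (simp add: field_simps)
  moreover have "ln ((real N + 2) / (real N + 1)) = ln (real (Suc N) + 1) - ln (real N + 1)"
    by (subst ln_div) (simp_all add: add.commute)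
  ultimately show ?case using Suc by simp
qed simp

theorem theorem2:
  fixes X UX :: "(real^'nx) set" and Y UY :: "(real^'ny) set"
    and \<phi> \<delta> :: "(real^'nx) \<times> (real^'ny) \<Rightarrow> real"
    and P :: "'w measure"
    and e :: "nat \<Rightarrow> 'w \<Rightarrow> (real^'nx) \<times> (real^'ny)"
    and \<xi>p \<xi>m :: "nat \<Rightarrow> 'w \<Rightarrow> real"
    and z :: "nat \<Rightarrow> 'w \<Rightarrow> (real^'nx) \<times> (real^'ny)"
    and zbar :: "'w \<Rightarrow> (real^'nx) \<times> (real^'ny)"
    and z0 :: "(real^'nx) \<times> (real^'ny)"
    and xs :: "real^'nx" and ys :: "real^'ny"
    and \<gamma> :: "nat \<Rightarrow> real"
    and N :: nat and n \<tau> \<mu> M \<Delta> \<sigma> \<Omega> Mall2 :: real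
  assumes "X \<noteq> {}" "compact X" "convex X"
    and "Y \<noteq> {}" "compact Y" "convex Y"
    and "open UX" "convex UX" "open UY" "convex UY"
    and "N \<ge> 1" "\<tau> > 0" "\<mu> > 0" "M > 0" "\<Delta> > 0" "\<sigma> > 0"
    and nbhd: "\<And>v u. v \<in> X \<times> Y \<Longrightarrow> norm u \<le> 1 \<Longrightarrow> v + \<tau> *\<^sub>R u \<in> UX \<times> UY"
    and "strongly_convex_concave_on UX UY \<mu> \<phi>"
    and "M-lipschitz_on (UX \<times> UY) \<phi>"
    and "\<delta> \<in> borel_measurable (restrict_space borel (UX \<times> UY))"
    and "\<And>v. v \<in> UX \<times> UY \<Longrightarrow> \<bar>\<delta> v\<bar> \<le> \<Delta>"
    and "prob_space P"
    and "independent_sampling P N \<sigma> e \<xi>p \<xi>m"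
    and "z0 \<in> X \<times> Y"
    and "\<And>k. \<gamma> k = 1 / (\<mu> * (real k + 1))"
    and "\<And>\<omega>. z 0 \<omega> = z0"
    and "\<And>k \<omega>. k \<le> N \<Longrightarrow> z (Suc k) \<omega> =
           closest_point (X \<times> Y)
             (z k \<omega> - \<gamma> k *\<^sub>R grad_estimator (noisy_value \<phi> \<delta>) (z k \<omega>) (e k \<omega>) \<tau> (\<xi>p k \<omega>) (\<xi>m k \<omega>))"
    and "\<And>\<omega>. zbar \<omega> = (1 / (real N + 1)) *\<^sub>R (\<Sum>k\<le>N. z k \<omega>)"
    and "saddle_point \<phi> X Y xs ys"
    and "n = real (CARD('nx) + CARD('ny))"
    and "\<Omega> = diameter (X \<times> Y)"
    and "Mall2 = 3 * (3 * n * M\<^sup>2 + n\<^sup>2 * (\<sigma>\<^sup>2 + \<Delta>\<^sup>2) / \<tau>\<^sup>2)"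
  shows "integrable P (\<lambda>\<omega>. \<phi> (fst (zbar \<omega>), ys) - \<phi> (xs, snd (zbar \<omega>))) \<and>
         prob_space.expectation P (\<lambda>\<omega>. \<phi> (fst (zbar \<omega>), ys) - \<phi> (xs, snd (zbar \<omega>)))
           \<le> Mall2 * ln (real N + 1) / (2 * \<mu> * (real N + 1)) + \<Delta> * n * \<Omega> / \<tau> + 2 * \<tau> * M"
proof -
  note A = assms(1-16) and nb = assms(17) and scc = assms(18) and lip = assms(19) and dm = assms(20) and db = assms(21)
    and prob = assms(22) and samp = assms(23) and z0 = assms(24) and gam = assms(25) and z_0 = assms(26)
    and z_Suc = assms(27) and zbar = assms(28) and sp = assms(29) and n = assms(30) and Om = assms(31) and Mall = assms(32)
  note pos = \<open>\<tau> > 0\<close> \<open>\<mu> > 0\<close> \<open>M > 0\<close> \<open>\<Delta> > 0\<close> \<open>\<sigma> > 0\<close>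
  define U where "U = UX \<times> UY"
  define Z where "Z = X \<times> Y"
  have U_open: "open U" using A by (simp add: U_def open_Times)
  then have [measurable]: "U \<in> sets borel" by simp
  have Z: "compact Z" "convex Z" "Z \<noteq> {}" "closed Z"
    using A by (auto simp: Z_def compact_Times convex_Times intro!: compact_imp_closed)
  then have [measurable]: "Z \<in> sets borel" by simp
  have Z_in: "v + \<tau> *\<^sub>R u \<in> U" if "v \<in> Z" "norm u \<le> 1" for v u
    using nb that by (simp add: U_def Z_def)
  have Z_in': "v - \<tau> *\<^sub>R u \<in> U" if "v \<in> Z" "norm u \<le> 1" for v u
    using Z_in[of v "- u"] that by simp
  have ZU: "v \<in> U" if "v \<in> Z" for v using Z_in[OF that, of 0] by simp
  \<comment> \<open>\<phi> and \<delta> are controlled only on \<open>U\<close>. Their extensions by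
    0 are Borel everywhere, and all query points lie in \<open>U\<close>, so the run of the
    algorithm does not change.\<close>
  define \<phi>0 where "\<phi>0 v = indicator U v *\<^sub>R \<phi> v" for v
  define \<delta>0 where "\<delta>0 v = indicator U v *\<^sub>R \<delta> v" for v
  have phi0: "\<phi>0 v = \<phi> v" and delta0: "\<delta>0 v = \<delta> v" if "v \<in> U" for v
    using that by (simp_all add: \<phi>0_def \<delta>0_def)
  have [measurable]: "\<phi>0 \<in> borel_measurable borel"
    unfolding \<phi>0_def using lipschitz_on_continuous_on[OF lip]
    by (intro borel_measurable_continuous_on_indicator) (auto simp: U_def[symmetric])
  have [measurable]: "\<delta>0 \<in> borel_measurable borel"
    unfolding \<delta>0_def using dm by (subst (asm) borel_measurable_restrict_space_iff) (auto simp: U_def[symmetric])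
  obtain G where G: "continuous_on (UX \<times> UY) G"
    "\<And>v. v \<in> UX \<times> UY \<Longrightarrow> (\<phi> has_derivative (\<lambda>h. G v \<bullet> h)) (at v)"
    "\<And>v. v \<in> UX \<times> UY \<Longrightarrow> norm (G v) \<le> M"
    "\<And>v x. v \<in> UX \<times> UY \<Longrightarrow> x \<in> UX \<Longrightarrow>
      \<phi> (x, snd v) \<ge> \<phi> v + fst (G v) \<bullet> (x - fst v) + \<mu> / 2 * (norm (x - fst v))\<^sup>2"
    "\<And>v y. v \<in> UX \<times> UY \<Longrightarrow> y \<in> UY \<Longrightarrow>
      \<phi> (fst v, y) \<le> \<phi> v + snd (G v) \<bullet> (y - snd v) - \<mu> / 2 * (norm (y - snd v))\<^sup>2"
    using strongly_convex_concave_gradient[OF A(7-10) scc less_imp_le[OF \<open>\<mu> > 0\<close>] lip] by metis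
  interpret S: saddle_problem UX UY \<phi>0 G M \<mu>
  proof
    show "M-lipschitz_on (UX \<times> UY) \<phi>0"
      by (rule lipschitz_on_transform[OF lip]) (simp add: phi0 U_def)
    show "(\<phi>0 has_derivative (\<lambda>h. G v \<bullet> h)) (at v)" if v: "v \<in> UX \<times> UY" for v
      by (rule has_derivative_transform_within_open[OF G(2)[OF v] U_open])
        (use v in \<open>auto simp: phi0 U_def\<close>)
    show "\<phi>0 v + fst (G v) \<bullet> (x - fst v) + \<mu> / 2 * (norm (x - fst v))\<^sup>2 \<le> \<phi>0 (x, snd v)"
      if "v \<in> UX \<times> UY" "x \<in> UX" for v x
      using G(4)[OF that] that by (auto simp: phi0 U_def)
    show "\<phi>0 (fst v, y) \<le> \<phi>0 v + snd (G v) \<bullet> (y - snd v) - \<mu> / 2 * (norm (y - snd v))\<^sup>2"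
      if "v \<in> UX \<times> UY" "y \<in> UY" for v y
      using G(5)[OF that] that by (auto simp: phi0 U_def)
  qed (use A G in auto)
  interpret P: prob_space P by (rule prob)
  interpret E: prob_space "uniform_sphere :: ((real^'nx) \<times> (real^'ny)) measure" by (rule prob_space_uniform_sphere)
  have nDIM: "n = real DIM((real^'nx) \<times> (real^'ny))" by (simp add: n)
  have "n \<ge> 2"
    using zero_less_card_finite[where 'a='nx] zero_less_card_finite[where 'a='ny] unfolding n by linarith
  define \<kappa> where "\<kappa> = n / (2 * \<tau>)"
  have "\<kappa> > 0" using \<open>n \<ge> 2\<close> pos by (simp add: \<kappa>_def)
  define J where "J v = (fst v, - snd v)" for v :: "(real^'nx) \<times> (real^'ny)"
  define d where "d v e = \<phi>0 (v + \<tau> *\<^sub>R e) - \<phi>0 (v - \<tau> *\<^sub>R e)" for v e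
  define d\<delta> where "d\<delta> v e = \<delta>0 (v + \<tau> *\<^sub>R e) - \<delta>0 (v - \<tau> *\<^sub>R e)" for v e
  \<comment> \<open>The default 0 provides a bound valid everywhere and is never met by the run,
    whose iterates lie in \<open>Z\<close> and whose directions have norm 1.\<close>
  define D where "D p = (if fst p \<in> Z \<and> norm (snd p) = 1 then d (fst p) (snd p) + d\<delta> (fst p) (snd p) else 0)" for p
  have D_meas [measurable]: "D \<in> borel_measurable (borel \<Otimes>\<^sub>M borel)"
    unfolding D_def d_def d\<delta>_def by measurable
  have [measurable]: "d v \<in> borel_measurable borel" for v unfolding d_def by measurable
  have J_meas [measurable]: "J \<in> borel_measurable borel"
    unfolding J_def by (intro borel_measurable_continuous_onI continuous_intros)
  have J_norm: "norm (J v) = norm v" for v by (simp add: J_def norm_prod_def)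
  have zk: "z k \<omega> \<in> Z" if "k \<le> Suc N" for k \<omega>
    using that z0 z_Suc Z by (cases k) (auto simp: z_0 Z_def[symmetric] closest_point_in_set)
  have d_bound: "\<bar>d v e\<bar> \<le> 2 * \<tau> * M" if "v \<in> Z" "norm e \<le> 1" for v e
  proof -
    have "\<bar>d v e\<bar> \<le> M * norm ((v + \<tau> *\<^sub>R e) - (v - \<tau> *\<^sub>R e))"
      using lipschitz_onD[OF S.lip, of "v + \<tau> *\<^sub>R e" "v - \<tau> *\<^sub>R e"] Z_in[OF that] Z_in'[OF that]
      by (simp add: d_def U_def dist_norm dist_real_def)
    also have "(v + \<tau> *\<^sub>R e) - (v - \<tau> *\<^sub>R e) = (2 * \<tau>) *\<^sub>R e" by (simp flip: scaleR_2)
    also have "M * norm ((2 * \<tau>) *\<^sub>R e) \<le> M * (2 * \<tau>)"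
      using pos that by (intro mult_left_mono) auto
    finally show ?thesis by (simp add: mult_ac)
  qed
  have dd_bound: "\<bar>d\<delta> v e\<bar> \<le> 2 * \<Delta>" if "v \<in> Z" "norm e \<le> 1" for v e
    using db[of "v + \<tau> *\<^sub>R e"] db[of "v - \<tau> *\<^sub>R e"] Z_in[OF that] Z_in'[OF that]
    by (simp add: d\<delta>_def delta0 U_def)
  interpret MD: mirror_descent P N \<sigma> e \<xi>p \<xi>m Z z z0 D J \<gamma> \<kappa> "2 * \<tau> * M + 2 * \<Delta>"
  proof
    show "\<bar>D p\<bar> \<le> 2 * \<tau> * M + 2 * \<Delta>" for p
      using d_bound[of "fst p" "snd p"] dd_bound[of "fst p" "snd p"] pos by (auto simp: D_def)
    show "z (Suc k) \<omega> = closest_point Z (z k \<omega> - \<gamma> k *\<^sub>R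
        ((\<kappa> * (D (z k \<omega>, e k \<omega>) + \<xi>p k \<omega> - \<xi>m k \<omega>)) *\<^sub>R J (e k \<omega>)))" if "k \<le> N" "\<omega> \<in> space P" for k \<omega>
    proof -
      have e1: "norm (e k \<omega>) = 1" using samp that by (auto simp: independent_sampling_def)
      have v: "z k \<omega> \<in> Z" using zk that by simp
      have "noisy_value \<phi> \<delta> (z k \<omega> + \<tau> *\<^sub>R e k \<omega>) (\<xi>p k \<omega>) - noisy_value \<phi> \<delta> (z k \<omega> - \<tau> *\<^sub>R e k \<omega>) (\<xi>m k \<omega>) =
          D (z k \<omega>, e k \<omega>) + \<xi>p k \<omega> - \<xi>m k \<omega>"
        using Z_in[OF v, of "e k \<omega>"] Z_in'[OF v, of "e k \<omega>"] e1 v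
        by (simp add: noisy_value_def D_def d_def d\<delta>_def phi0 delta0)
      then have "grad_estimator (noisy_value \<phi> \<delta>) (z k \<omega>) (e k \<omega>) \<tau> (\<xi>p k \<omega>) (\<xi>m k \<omega>) =
          (\<kappa> * (D (z k \<omega>, e k \<omega>) + \<xi>p k \<omega> - \<xi>m k \<omega>)) *\<^sub>R J (e k \<omega>)"
        by (simp only: grad_estimator_def \<kappa>_def J_def n times_divide_eq_left)
      then show ?thesis using z_Suc[OF that(1)] by (simp add: Z_def)
    qed
  qed (use samp Z z0 z_0 D_meas J_meas J_norm in \<open>auto simp: Z_def\<close>)
  define u where "u = (xs, ys)"
  have u: "u \<in> Z" using sp by (simp add: u_def Z_def saddle_point_def)
  define gap where "gap v = \<phi>0 (fst v, ys) - \<phi>0 (xs, snd v)" for v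
  have uU: "xs \<in> UX" "ys \<in> UY" using ZU[OF u] by (auto simp: u_def U_def)
  have dist_Om: "norm (v - u) \<le> \<Omega>" if "v \<in> Z" for v
    using diameter_bounded_bound[OF compact_imp_bounded[OF Z(1)] that u] by (simp add: Om Z_def dist_norm)
  then have "\<Omega> \<ge> 0" using u norm_ge_zero order_trans by blast
  have "(\<lambda>v :: (real^'nx) \<times> (real^'ny). (fst v, ys)) \<in> borel_measurable borel"
    "(\<lambda>v :: (real^'nx) \<times> (real^'ny). (xs, snd v)) \<in> borel_measurable borel"
    by (intro borel_measurable_continuous_onI continuous_intros)+
  then have gap_meas: "gap \<in> borel_measurable borel"
    unfolding gap_def[abs_def] by (intro borel_measurable_diff measurable_compose[OF _ S.phi_measurable])
  have gap_bound: "\<bar>gap v\<bar> \<le> M * \<Omega>" if v: "v \<in> Z" for v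
  proof -
    have "\<bar>gap v\<bar> \<le> M * norm ((fst v, ys) - (xs, snd v))"
      using lipschitz_onD[OF S.lip, of "(fst v, ys)" "(xs, snd v)"] ZU[OF v] uU
      by (auto simp: gap_def U_def dist_norm dist_real_def)
    also have "norm ((fst v, ys) - (xs, snd v)) = norm (v - u)"
      by (simp add: norm_prod_def u_def norm_minus_commute)
    also have "M * norm (v - u) \<le> M * \<Omega>" using dist_Om[OF v] pos by (intro mult_left_mono) auto
    finally show ?thesis .
  qed
  \<comment> \<open>From \<open>(a + b)\<^sup>2 \<le> 2 * a\<^sup>2 + 2 * b\<^sup>2\<close>: the
    \<phi>-part has mean square at most \<open>12 * \<tau>\<^sup>2 * M\<^sup>2 / n\<close>, and the
    \<delta>-part is at most \<open>2 * \<Delta>\<close>.\<close>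
  define V where "V = 24 * \<tau>\<^sup>2 * M\<^sup>2 / n + 8 * \<Delta>\<^sup>2"
  define \<beta> where "\<beta> = \<Delta> * n * \<Omega> / \<tau> + 2 * \<tau> * M"
  have second: "(\<integral>e. (D (v, e))\<^sup>2 \<partial>uniform_sphere) \<le> V" if v: "v \<in> Z" for v
  proof -
    have 1: "AE e in uniform_sphere. (D (v, e))\<^sup>2 \<le> 2 * (d v e)\<^sup>2 + 8 * \<Delta>\<^sup>2"
      using AE_uniform_sphere
    proof eventually_elim
      case (elim e)
      have "(d\<delta> v e)\<^sup>2 \<le> (2 * \<Delta>)\<^sup>2"
        using dd_bound[OF v, of e] elim pos abs_le_square_iff[of "d\<delta> v e" "2 * \<Delta>"] by simp
      moreover have "0 \<le> (d v e - d\<delta> v e)\<^sup>2" by simp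
      ultimately show ?case
        using v elim by (simp add: D_def power2_eq_square algebra_simps)
    qed
    have id: "integrable uniform_sphere (\<lambda>e. (d v e)\<^sup>2)"
    proof (rule E.integrable_const_bound)
      show "AE e in uniform_sphere. norm ((d v e)\<^sup>2) \<le> (2 * \<tau> * M)\<^sup>2"
        using AE_uniform_sphere
      proof eventually_elim
        case (elim e)
        then show ?case using d_bound[OF v, of e] pos abs_le_square_iff[of "d v e" "2 * \<tau> * M"] by simp
      qed
    qed simp
    have "(\<integral>e. (D (v, e))\<^sup>2 \<partial>uniform_sphere) \<le> (\<integral>e. 2 * (d v e)\<^sup>2 + 8 * \<Delta>\<^sup>2 \<partial>uniform_sphere)"
    proof (rule integral_mono_AE[OF _ _ 1])
      show "integrable uniform_sphere (\<lambda>e. (D (v, e))\<^sup>2)"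
      proof (rule Bochner_Integration.integrable_bound)
        show "integrable uniform_sphere (\<lambda>e. 2 * (d v e)\<^sup>2 + 8 * \<Delta>\<^sup>2)" using id by simp
        show "AE e in uniform_sphere. norm ((D (v, e))\<^sup>2) \<le> norm (2 * (d v e)\<^sup>2 + 8 * \<Delta>\<^sup>2)"
          using 1 by eventually_elim simp
      qed simp
    qed (use id in simp)
    also have "\<dots> = 2 * (\<integral>e. (d v e)\<^sup>2 \<partial>uniform_sphere) + 8 * \<Delta>\<^sup>2"
      using id E.prob_space by simp
    also have "\<dots> \<le> 2 * (12 * \<tau>\<^sup>2 * M\<^sup>2 / n) + 8 * \<Delta>\<^sup>2"
      using S.second_moment_symmetric_difference[OF \<open>\<tau> > 0\<close>, of v] Z_in[OF v]
      by (simp add: d_def nDIM U_def)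
    finally show ?thesis by (simp add: V_def)
  qed
  \<comment> \<open>The smoothing estimate handles the \<phi>-part. The \<delta>-part lowers the
    integrand by at most \<open>2 * \<Delta> * \<Omega>\<close>, which after scaling by
    \<open>\<kappa>\<close> is the term \<open>\<Delta> * n * \<Omega> / \<tau>\<close>.\<close>
  have desc: "gap v + \<mu> / 2 * (norm (v - u))\<^sup>2 - \<beta> \<le> \<kappa> * (\<integral>e. D (v, e) * (J e \<bullet> (v - u)) \<partial>uniform_sphere)"
    if v: "v \<in> Z" for v
  proof -
    \<comment> \<open>\<open>J\<close> is self-adjoint, so its sign change can be moved from the
      direction to the displacement.\<close>
    define w where "w = (fst v - xs, ys - snd v)"
    have w: "J e \<bullet> (v - u) = e \<bullet> w" for e
      by (simp add: J_def w_def u_def inner_prod_def inner_diff_right)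
    have "norm w = norm (v - u)" by (simp add: w_def u_def norm_prod_def norm_minus_commute)
    then have nw: "norm w \<le> \<Omega>" using dist_Om[OF v] by simp
    have ew: "\<bar>e \<bullet> w\<bar> \<le> \<Omega>" if "norm e = 1" for e
      using Cauchy_Schwarz_ineq2[of e w] nw that by simp
    have "AE e in uniform_sphere. norm (d v e * (e \<bullet> w)) \<le> 2 * \<tau> * M * \<Omega>"
      using AE_uniform_sphere
    proof eventually_elim
      case (elim e)
      then show ?case
        using d_bound[OF v, of e] ew[of e] pos \<open>\<Omega> \<ge> 0\<close> by (auto simp: abs_mult intro!: mult_mono)
    qed
    then have id: "integrable uniform_sphere (\<lambda>e. d v e * (e \<bullet> w))"
      by (rule E.integrable_const_bound) simp
    have iD: "integrable uniform_sphere (\<lambda>e. D (v, e) * (e \<bullet> w))"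
    proof (rule E.integrable_const_bound)
      show "AE e in uniform_sphere. norm (D (v, e) * (e \<bullet> w)) \<le> (2 * \<tau> * M + 2 * \<Delta>) * \<Omega>"
        using AE_uniform_sphere
      proof eventually_elim
        case (elim e)
        then show ?case
          using MD.D_bound[of "(v, e)"] ew[of e] pos \<open>\<Omega> \<ge> 0\<close> by (auto simp: abs_mult intro!: mult_mono)
      qed
    qed simp
    have "(\<integral>e. d v e * (e \<bullet> w) - 2 * \<Delta> * \<Omega> \<partial>uniform_sphere) \<le> (\<integral>e. D (v, e) * (e \<bullet> w) \<partial>uniform_sphere)"
    proof (rule integral_mono_AE)
      show "AE e in uniform_sphere. d v e * (e \<bullet> w) - 2 * \<Delta> * \<Omega> \<le> D (v, e) * (e \<bullet> w)"
        using AE_uniform_sphere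
      proof eventually_elim
        case (elim e)
        have "\<bar>d\<delta> v e * (e \<bullet> w)\<bar> \<le> 2 * \<Delta> * \<Omega>"
          unfolding abs_mult using dd_bound[OF v, of e] ew[of e] elim pos by (intro mult_mono) auto
        then show ?case using v elim by (simp add: D_def distrib_right)
      qed
    qed (use id iD in auto)
    then have "(\<integral>e. d v e * (e \<bullet> w) \<partial>uniform_sphere) - 2 * \<Delta> * \<Omega> \<le> (\<integral>e. D (v, e) * (e \<bullet> w) \<partial>uniform_sphere)"
      using id E.prob_space by simp
    then have "\<kappa> * ((\<integral>e. d v e * (e \<bullet> w) \<partial>uniform_sphere) - 2 * \<Delta> * \<Omega>) \<le> \<kappa> * (\<integral>e. D (v, e) * (e \<bullet> w) \<partial>uniform_sphere)"
      using \<open>\<kappa> > 0\<close> by (intro mult_left_mono) auto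
    moreover have "\<kappa> * (2 * \<Delta> * \<Omega>) = \<Delta> * n * \<Omega> / \<tau>" by (simp add: \<kappa>_def)
    moreover have "gap v + \<mu> / 2 * (norm (v - u))\<^sup>2 - 2 * \<tau> * M \<le> \<kappa> * (\<integral>e. d v e * (e \<bullet> w) \<partial>uniform_sphere)"
      using S.gap_le_smoothed_gradient[OF \<open>\<tau> > 0\<close>, of v u] Z_in[OF v] Z_in[OF u]
      by (simp add: gap_def d_def w_def \<kappa>_def nDIM U_def u_def)
    ultimately show ?thesis unfolding w \<beta>_def by (simp add: right_diff_distrib)
  qed
  note md = u gap_meas gap_bound second desc

  \<comment> \<open>The averaged iterate and the comparison of constants\<close>
  define h where "h \<omega> = gap (zbar \<omega>)" for \<omega>
  have zbarZ: "zbar \<omega> \<in> Z" for \<omega>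
  proof -
    have "(\<Sum>k\<le>N. (1 / (real N + 1)) *\<^sub>R z k \<omega>) \<in> Z"
      by (rule convex_sum[OF _ Z(2)]) (auto intro!: zk)
    then show ?thesis by (simp add: zbar scaleR_sum_right)
  qed
  have h_eq: "\<phi> (fst (zbar \<omega>), ys) - \<phi> (xs, snd (zbar \<omega>)) = h \<omega>" for \<omega>
    using ZU[OF zbarZ[of \<omega>]] uU unfolding h_def gap_def by (subst (1 2) phi0) (auto simp: U_def)
  have [measurable]: "zbar \<in> borel_measurable P"
    unfolding zbar[abs_def] by (intro borel_measurable_scaleR borel_measurable_const borel_measurable_sum MD.z_measurable) simp
  have h_meas: "h \<in> borel_measurable P"
    unfolding h_def using gap_meas by measurable
  have h_int: "integrable P h"
    using gap_bound[OF zbarZ] h_meas by (intro P.integrable_const_bound[where B = "M * \<Omega>"]) (auto simp: h_def)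
  have "\<beta> \<ge> 0" using pos \<open>n \<ge> 2\<close> \<open>\<Omega> \<ge> 0\<close> by (simp add: \<beta>_def)
  let ?L = "ln (real N + 1)" and ?m = "real N + 1"
  have "Mall2 \<ge> 0" using pos \<open>n \<ge> 2\<close> by (simp add: Mall)
  have "ln 2 \<le> ?L" using \<open>N \<ge> 1\<close> by (subst ln_le_cancel_iff) auto
  then have ln2: "2 / 3 \<le> ?L" using ln2_ge_two_thirds by linarith
  have "P.expectation h \<le> Mall2 * ?L / (2 * \<mu> * ?m) + \<beta>"
  proof (cases "N < 7")
    case True
    have "h \<omega> \<le> M\<^sup>2 / (2 * \<mu>)" for \<omega>
      using S.gap_le[of "zbar \<omega>" u] ZU[OF zbarZ[of \<omega>]] ZU[OF u] pos by (simp add: h_def gap_def u_def U_def)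
    then have "P.expectation h \<le> M\<^sup>2 / (2 * \<mu>)"
      using h_int by (intro P.integral_le_const) auto
    also have "\<dots> \<le> Mall2 * ?L / (2 * \<mu> * ?m)"
    proof -
      \<comment> \<open>As \<open>n \<ge> 2\<close>, \<open>Mall2\<close> is at least
        \<open>18 * M\<^sup>2\<close>. Times the lower bound 2/3 for the logarithm this is
        \<open>12 * M\<^sup>2\<close>, which covers \<open>M\<^sup>2 * (N + 1)\<close> because
        \<open>N + 1 \<le> 7\<close>.\<close>
      have "18 * M\<^sup>2 \<le> 9 * n * M\<^sup>2" using \<open>n \<ge> 2\<close> by (intro mult_right_mono) auto
      also have "\<dots> \<le> Mall2" by (simp add: Mall)
      finally have "18 * M\<^sup>2 * (2 / 3) \<le> Mall2 * ?L"
        using ln2 \<open>Mall2 \<ge> 0\<close> by (intro mult_mono) auto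
      moreover have "M\<^sup>2 * ?m \<le> M\<^sup>2 * 12" using True by (intro mult_left_mono) auto
      ultimately have "M\<^sup>2 * ?m \<le> Mall2 * ?L" by simp
      then have "M\<^sup>2 * ?m / (2 * \<mu> * ?m) \<le> Mall2 * ?L / (2 * \<mu> * ?m)"
        using pos by (intro divide_right_mono) auto
      moreover have "?m \<noteq> 0" using of_nat_0_le_iff[of N] by linarith
      ultimately show ?thesis by simp
    qed
    finally show ?thesis using \<open>\<beta> \<ge> 0\<close> by simp
  next
    case False
    \<comment> \<open>From \<open>N + 1 \<ge> 8\<close> and \<open>ln 2 \<ge> 2 / 3\<close> the
      logarithm is at least 2, so the summand 1 in \<open>harmonic_le_ln\<close> is at most half of
      it.\<close>
    have "?L \<ge> ln (2 ^ 3)" using False by (subst ln_le_cancel_iff) auto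
    moreover have "ln (2 ^ 3) = 3 * ln (2::real)" using ln_realpow[of 2 3] by simp
    ultimately have "?L \<ge> 2" using ln2_ge_two_thirds by linarith
    then have H: "(\<Sum>k\<le>N. 1 / (real k + 1)) \<le> 3 / 2 * ?L"
      using harmonic_le_ln[of N] by simp
    have "h \<omega> \<le> (\<Sum>k\<le>N. gap (z k \<omega>)) / ?m" for \<omega>
      using S.average_gap_le[of N "\<lambda>k. z k \<omega>" u "zbar \<omega>"] ZU[OF zk] ZU[OF u] ZU[OF zbarZ[of \<omega>]] zbar pos
      by (simp add: h_def gap_def u_def U_def)
    moreover have ig: "integrable P (\<lambda>\<omega>. gap (z k \<omega>))" if "k \<le> N" for k
      using MD.integrable_gap[OF md, of k] that by simp
    ultimately have "P.expectation h \<le> P.expectation (\<lambda>\<omega>. (\<Sum>k\<le>N. gap (z k \<omega>)) / ?m)"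
      using h_int by (intro integral_mono integrable_divide Bochner_Integration.integrable_sum) auto
    also have "\<dots> = (\<Sum>k\<le>N. P.expectation (\<lambda>\<omega>. gap (z k \<omega>))) / ?m"
      using ig by (simp add: Bochner_Integration.integral_sum)
    also have "\<dots> \<le> (\<kappa>\<^sup>2 * (V + 4 * \<sigma>\<^sup>2) / (2 * \<mu>) * (\<Sum>k\<le>N. 1 / (real k + 1)) + ?m * \<beta>) / ?m"
      using MD.sum_gap_le[OF md \<open>\<mu> > 0\<close> gam] by (intro divide_right_mono) auto
    also have "\<dots> \<le> (2 / 3 * Mall2 / (2 * \<mu>) * (3 / 2 * ?L) + ?m * \<beta>) / ?m"
    proof -
      \<comment> \<open>The terms in \<open>M\<close> and \<open>\<Delta>\<close> match 2/3 of
        \<open>Mall2\<close> exactly; the slack lies in the \<sigma> term alone.\<close>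
      have "\<kappa>\<^sup>2 * (V + 4 * \<sigma>\<^sup>2) = 6 * n * M\<^sup>2 + n\<^sup>2 * (\<sigma>\<^sup>2 + 2 * \<Delta>\<^sup>2) / \<tau>\<^sup>2"
        using pos \<open>n \<ge> 2\<close> by (simp add: \<kappa>_def V_def power2_eq_square field_simps)
      also have "\<dots> \<le> 6 * n * M\<^sup>2 + n\<^sup>2 * (2 * (\<sigma>\<^sup>2 + \<Delta>\<^sup>2)) / \<tau>\<^sup>2"
        by (intro add_left_mono divide_right_mono mult_left_mono) auto
      also have "\<dots> = 2 / 3 * Mall2" by (simp add: Mall)
      finally have coef: "\<kappa>\<^sup>2 * (V + 4 * \<sigma>\<^sup>2) / (2 * \<mu>) \<le> 2 / 3 * Mall2 / (2 * \<mu>)"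
        using pos by (intro divide_right_mono) auto
      have "\<kappa>\<^sup>2 * (V + 4 * \<sigma>\<^sup>2) / (2 * \<mu>) * (\<Sum>k\<le>N. 1 / (real k + 1)) \<le> 2 / 3 * Mall2 / (2 * \<mu>) * (3 / 2 * ?L)"
        using pos \<open>Mall2 \<ge> 0\<close> by (intro mult_mono[OF coef H]) (auto intro!: sum_nonneg)
      then show ?thesis
        by (intro divide_right_mono add_right_mono) auto
    qed
    also have "2 / 3 * Mall2 / (2 * \<mu>) * (3 / 2 * ?L) = Mall2 * ?L / (2 * \<mu>)"
      by simp
    also have "(Mall2 * ?L / (2 * \<mu>) + ?m * \<beta>) / ?m = Mall2 * ?L / (2 * \<mu> * ?m) + \<beta>"
    proof -
      have "?m \<noteq> 0" using of_nat_0_le_iff[of N] by linarith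
      from nonzero_mult_div_cancel_left[OF this, of \<beta>] show ?thesis
        by (simp only: add_divide_distrib divide_divide_eq_left)
    qed
    finally show ?thesis .
  qed
  then show ?thesis
    using h_int unfolding h_eq \<beta>_def by simp
qed

end
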